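(* Let $G$ be a $5$-regular graph that has no $(4,1)$-coloring, and which is vertex-minimal with this property (every $5$-regular graph with fewer vertices than $G$ has a $(4,1)$-coloring). Then: (a) $G$ does not contain a $4$-regular subgraph with at least $2$ vertices. (b) $G$ does not have $3$ parallel edges. (c) $G$ does not contain a path of length three consisting of double edges, i.e., there are no distinct vertices $v_1,v_2,v_3,v_4$ such that $v_i$ and $v_{i+1}$ are joined by (at least) two parallel edges for $i=1,2,3$. (d) No vertex of $G$ that has a loop is incident to a double edge (two parallel non-loop edges). (e) No two vertices with loops are adjacent. (f) $G$ contains at least $5$ loops. (g) There do not exist vertices $u_1,u_2,u_3,v_1,v_2,v_3\in V(G)$ such that each $u_i$ has a loop and $u_i$ is adjacent to $v_j$ for all $i,j\in\{1,2,3\}$. (h) No vertex is adjacent to more than $3$ vertices with loops. (i) No $4$-vertex subgraph of $G$ has $8$ or more edges.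
   Context: All graphs are finite, undirected pseudographs (multiple edges and loops allowed; a loop contributes $2$ to the degree; loops count as edges of subgraphs). A $(4,1)$-coloring of a $5$-regular graph is an edge-coloring using at least two colors such that every vertex is incident to exactly $4$ edges of one color and exactly $1$ edge of a different color. *)

theory Defs
  imports Main "HOL-Library.Uprod"
begin

text \<open>
  Finite undirected pseudographs: the ends of an edge form an unordered pair, so \<open>Upair v v\<close>
  is a loop at \<open>v\<close>, and distinct edges may have the same ends.
\<close>

record ('v, 'e) pgraph =
  verts :: "'v set"
  edges :: "'e set"
  ends :: "'e \<Rightarrow> 'v uprod"

text \<open>
  Graphs have at least one vertex. Without this convention the empty graph, which has no coloring
  with two colors, would be the unique vertex-minimal 5-regular graph without a (4,1)-coloring.
\<close>

definition pseudograph :: "('v, 'e) pgraph \<Rightarrow> bool" where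
  "pseudograph G \<longleftrightarrow> finite (verts G) \<and> verts G \<noteq> {} \<and> finite (edges G) \<and>
     (\<forall>e\<in>edges G. set_uprod (ends G e) \<subseteq> verts G)"

definition subgraph :: "('v, 'e) pgraph \<Rightarrow> ('v, 'e) pgraph \<Rightarrow> bool" where
  "subgraph H G \<longleftrightarrow> pseudograph H \<and> verts H \<subseteq> verts G \<and> edges H \<subseteq> edges G \<and>
     (\<forall>e\<in>edges H. ends H e = ends G e)"

definition edges_between :: "('v, 'e) pgraph \<Rightarrow> 'v \<Rightarrow> 'v \<Rightarrow> 'e set" where
  "edges_between G u v = {e \<in> edges G. ends G e = Upair u v}"

definition adjacent :: "('v, 'e) pgraph \<Rightarrow> 'v \<Rightarrow> 'v \<Rightarrow> bool" where
  "adjacent G u v \<longleftrightarrow> edges_between G u v \<noteq> {}"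

definition loops :: "('v, 'e) pgraph \<Rightarrow> 'e set" where
  "loops G = {e \<in> edges G. \<exists>v. ends G e = Upair v v}"

definition has_loop :: "('v, 'e) pgraph \<Rightarrow> 'v \<Rightarrow> bool" where
  "has_loop G v \<longleftrightarrow> edges_between G v v \<noteq> {}"

text \<open>The second summand makes every loop contribute 2 to the degree.\<close>

definition degree :: "('v, 'e) pgraph \<Rightarrow> 'v \<Rightarrow> nat" where
  "degree G v = card {e \<in> edges G. v \<in> set_uprod (ends G e)} + card (edges_between G v v)"

definition regular :: "nat \<Rightarrow> ('v, 'e) pgraph \<Rightarrow> bool" where
  "regular k G \<longleftrightarrow> pseudograph G \<and> (\<forall>v\<in>verts G. degree G v = k)"

definition color_degree :: "('v, 'e) pgraph \<Rightarrow> ('e \<Rightarrow> 'c) \<Rightarrow> 'c \<Rightarrow> 'v \<Rightarrow> nat" where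
  "color_degree G c a v = degree (G\<lparr>edges := {e \<in> edges G. c e = a}\<rparr>) v"

text \<open>
  The edges of a color at a vertex are counted as in the degree, so that a loop counts twice. There
  is no bound on the number of colors; since graphs are finite, natural numbers suffice as colors.
\<close>

definition coloring_4_1 :: "('v, 'e) pgraph \<Rightarrow> ('e \<Rightarrow> nat) \<Rightarrow> bool" where
  "coloring_4_1 G c \<longleftrightarrow> 2 \<le> card (c ` edges G) \<and>
     (\<forall>v\<in>verts G. \<exists>a b. a \<noteq> b \<and> color_degree G c a v = 4 \<and> color_degree G c b v = 1)"

definition has_coloring_4_1 :: "('v, 'e) pgraph \<Rightarrow> bool" where
  "has_coloring_4_1 G \<longleftrightarrow> (\<exists>c. coloring_4_1 G c)"

text \<open>
  A bound variable for graphs needs a fixed type. The lemmas below show that quantifying over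
  graphs on natural numbers is no restriction: every graph has an isomorphic copy there.
\<close>

definition graph_iso ::
  "('v \<Rightarrow> 'w) \<Rightarrow> ('e \<Rightarrow> 'f) \<Rightarrow> ('v, 'e) pgraph \<Rightarrow> ('w, 'f) pgraph \<Rightarrow> bool" where
  "graph_iso f g G H \<longleftrightarrow> bij_betw f (verts G) (verts H) \<and> bij_betw g (edges G) (edges H) \<and>
     (\<forall>e\<in>edges G. ends H (g e) = map_uprod f (ends G e))"

lemma map_uprod_eq_Upair_iff:
  assumes "inj_on f A" "set_uprod p \<subseteq> A" "u \<in> A" "v \<in> A"
  shows "map_uprod f p = Upair (f u) (f v) \<longleftrightarrow> p = Upair u v"
  using assms by (cases p) (auto simp: inj_on_eq_iff)

lemma degree_graph_iso:
  assumes G: "pseudograph G" and iso: "graph_iso f g G H" and v: "v \<in> verts G"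
  shows "degree H (f v) = degree G v"
proof -
  have f: "inj_on f (verts G)" and g: "inj_on g (edges G)" and E: "edges H = g ` edges G"
    and e: "\<And>e. e \<in> edges G \<Longrightarrow> ends H (g e) = map_uprod f (ends G e)"
    using iso by (auto simp: graph_iso_def bij_betw_def)
  have sub: "set_uprod (ends G e) \<subseteq> verts G" if "e \<in> edges G" for e
    using G that by (auto simp: pseudograph_def)
  have "{e \<in> edges H. f v \<in> set_uprod (ends H e)} = g ` {e \<in> edges G. v \<in> set_uprod (ends G e)}"
    using sub v inj_on_image_mem_iff[OF f v] by (auto simp: E e uprod.set_map)
  moreover have "edges_between H (f v) (f v) = g ` edges_between G v v"
    using map_uprod_eq_Upair_iff[OF f sub v v] by (auto simp: edges_between_def E e)
  ultimately show ?thesis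
    unfolding degree_def
    by (metis (no_types, lifting) card_image edges_between_def g inj_on_subset mem_Collect_eq subsetI)
qed

lemma pseudograph_graph_iso:
  assumes "pseudograph G" "graph_iso f g G H"
  shows "pseudograph H"
proof -
  have "verts H = f ` verts G" "edges H = g ` edges G"
    using assms by (auto simp: graph_iso_def bij_betw_def)
  then show ?thesis
    using assms by (simp add: pseudograph_def graph_iso_def uprod.set_map image_mono)
qed

lemma regular_graph_iso:
  assumes "regular k G" "graph_iso f g G H"
  shows "regular k H"
proof -
  have "verts H = f ` verts G"
    using assms by (auto simp: graph_iso_def bij_betw_def)
  then show ?thesis
    using assms degree_graph_iso[of G f g H] pseudograph_graph_iso[of G f g H]
    by (auto simp: regular_def)
qed

lemma has_coloring_4_1_graph_iso:
  assumes G: "pseudograph G" and iso: "graph_iso f g G H" and col: "has_coloring_4_1 H"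
  shows "has_coloring_4_1 G"
proof -
  obtain c where c: "coloring_4_1 H c" using col by (auto simp: has_coloring_4_1_def)
  have V: "verts H = f ` verts G" and E: "edges H = g ` edges G" and g: "inj_on g (edges G)"
    using iso by (auto simp: graph_iso_def bij_betw_def)
  have "color_degree G (c \<circ> g) a v = color_degree H c a (f v)" if v: "v \<in> verts G" for a v
  proof -
    have "pseudograph (G\<lparr>edges := {e \<in> edges G. (c \<circ> g) e = a}\<rparr>)"
      using G by (auto simp: pseudograph_def)
    moreover have "graph_iso f g (G\<lparr>edges := {e \<in> edges G. (c \<circ> g) e = a}\<rparr>)
        (H\<lparr>edges := {e \<in> edges H. c e = a}\<rparr>)"
      using iso E g by (auto simp: graph_iso_def bij_betw_def intro: inj_on_subset)
    ultimately show ?thesis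
      using v by (simp add: color_degree_def degree_graph_iso)
  qed
  then have "coloring_4_1 G (c \<circ> g)"
    using c by (auto simp: coloring_4_1_def V E image_comp)
  then show ?thesis by (auto simp: has_coloring_4_1_def)
qed

lemma ex_graph_iso_nat:
  fixes G :: "('a, 'b) pgraph"
  assumes "pseudograph G"
  shows "\<exists>(H :: (nat, nat) pgraph) f g. graph_iso f g G H"
proof -
  obtain f :: "'a \<Rightarrow> nat" and g :: "'b \<Rightarrow> nat"
    where f: "inj_on f (verts G)" and g: "inj_on g (edges G)"
    using assms finite_imp_inj_to_nat_seg unfolding pseudograph_def by metis
  have "graph_iso f g G \<lparr>verts = f ` verts G, edges = g ` edges G,
      ends = \<lambda>e. map_uprod f (ends G (inv_into (edges G) g e))\<rparr>"
    using f g by (auto simp: graph_iso_def bij_betw_def)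
  then show ?thesis by blast
qed

lemma minimality_nat_imp_all:
  assumes "\<And>H :: (nat, nat) pgraph. regular 5 H \<Longrightarrow> card (verts H) < n \<Longrightarrow> has_coloring_4_1 H"
  assumes "regular 5 G" "card (verts G) < n"
  shows "has_coloring_4_1 G"
proof -
  have G: "pseudograph G" using assms(2) by (simp add: regular_def)
  obtain H :: "(nat, nat) pgraph" and f g where iso: "graph_iso f g G H"
    using ex_graph_iso_nat[OF G] by blast
  have "card (verts H) = card (verts G)"
    using iso by (auto simp: graph_iso_def dest: bij_betw_same_card)
  then show ?thesis
    using assms regular_graph_iso[OF assms(2) iso] has_coloring_4_1_graph_iso[OF G iso] by simp
qed

end

theory Submission
  imports Defs "HOL-Library.Multiset" "HOL-Library.Disjoint_Sets"
begin

text \<open>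
  Parts (a)-(e) and (g)-(i) delete a set \<open>X\<close> of vertices and join the dangling edges in pairs so
  that the smaller graph, which has a coloring by minimality, gives enough information to color the
  edges inside \<open>X\<close>. An odd dangling edge is closed off by a vertex with two loops. For (f), a
  perfect matching and its complement would form a coloring, so by the Tutte-Berge formula there
  are a set \<open>S\<close> of vertices and at least \<open>|S| + 2\<close> disjoint odd sets \<open>K\<close> joined only to \<open>S\<close>.
  Colorings of the two sides of an edge cut of size 1 or 3 can be matched along the cut, so
  minimality forces a set \<open>K\<close> with fewer than 5 outgoing edges to be a single vertex with loops;
  counting edges at \<open>S\<close> leaves room for no fewer than 5 loops.
\<close>

section \<open>Maximum matchings and the Tutte-Berge formula\<close>

text \<open>The number of colors is unbounded, so a color that no dangling edge uses is always at
  hand. This gives two basic ways to color the inside of \<open>X\<close>: a 4-regular graph on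
  \<open>X\<close> takes the fresh color, or, if all outside colors agree, the inner edges repeat
  that color except for a perfect matching in the fresh one. The pairing of dangling edges is chosen
  so that the other distributions of outside colors extend as well. Joining edges can create new
  loops, closed curves without a vertex, and vertices with equal stars. Multisets of edge names
  absorb all of this: merging two edges becomes a substitution of names. Part (c) resists the
  scheme, because the colors found outside may fit no coloring of the deleted edges; there the
  neighboring vertices are recolored too. The 5 in (f) comes from the inequality 5 (|S| + 2) \<le> 5
  |S| + 2 L, where L is the number of loops: each odd set \<open>K\<close> has cut edges plus twice
  its loops at least 5, the cuts are disjoint, and a vertex of \<open>S\<close> meets at most 5 of
  their edges. The surplus 2 instead of 1 is due to parity.\<close>

definition matching_in :: "'v set set \<Rightarrow> 'v set set \<Rightarrow> bool" where
  "matching_in E M \<longleftrightarrow> M \<subseteq> E \<and> disjoint M"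

definition maximum_matching_in :: "'v set set \<Rightarrow> 'v set set \<Rightarrow> bool" where
  "maximum_matching_in E M \<longleftrightarrow> matching_in E M \<and> (\<forall>M'. matching_in E M' \<longrightarrow> card M' \<le> card M)"

lemma card_Union_matching:
  assumes "matching_in E M" "\<And>e. e \<in> E \<Longrightarrow> card e = 2" "finite M"
  shows "card (\<Union>M) = 2 * card M"
proof -
  have "card (\<Union>M) = (\<Sum>e\<in>M. card e)"
    using assms by (intro card_Union_disjoint) (auto simp: matching_in_def intro!: card_ge_0_finite)
  also have "\<dots> = (\<Sum>e\<in>M. 2)" using assms by (intro sum.cong) (auto simp: matching_in_def)
  finally show ?thesis by simp
qed

lemma ex_maximizer:
  fixes f :: "'a \<Rightarrow> 'b :: linorder"
  assumes "finite A" "A \<noteq> {}"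
  shows "\<exists>x\<in>A. \<forall>y\<in>A. f y \<le> f x"
proof -
  have "Max (f ` A) \<in> f ` A" using assms by (intro Max_in) auto
  then obtain x where "x \<in> A" "Max (f ` A) = f x" by auto
  then show ?thesis using assms Max_ge[of "f ` A"] by (metis finite_imageI imageI)
qed

lemma ex_maximum_matching:
  assumes "finite E"
  shows "\<exists>M. maximum_matching_in E M"
proof -
  have fin: "finite {M. matching_in E M}"
    by (rule finite_subset[of _ "Pow E"]) (use assms in \<open>auto simp: matching_in_def\<close>)
  have "{} \<in> {M. matching_in E M}" by (simp add: matching_in_def)
  then show ?thesis
    using ex_maximizer[OF fin, of card] by (auto simp: maximum_matching_in_def)
qed

text \<open>Gallai's argument: if all maximum matchings cover at least one of \<open>u\<close> and \<open>t\<close> and at least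
  one of \<open>t\<close> and \<open>v\<close>, a maximum matching missing \<open>t\<close> that agrees as much as possible with one
  missing \<open>u\<close> and \<open>v\<close> can be exchanged to agree even more.\<close>

lemma missed_together_trans:
  assumes E: "finite E" "\<And>e. e \<in> E \<Longrightarrow> card e = 2"
    and t: "maximum_matching_in E N0" "t \<notin> \<Union>N0"
    and ut: "\<And>M. maximum_matching_in E M \<Longrightarrow> u \<in> \<Union>M \<or> t \<in> \<Union>M"
    and tv: "\<And>M. maximum_matching_in E M \<Longrightarrow> t \<in> \<Union>M \<or> v \<in> \<Union>M"
    and M: "maximum_matching_in E M" and "u \<noteq> v"
  shows "u \<in> \<Union>M \<or> v \<in> \<Union>M"
proof (rule ccontr)
  assume "\<not> (u \<in> \<Union>M \<or> v \<in> \<Union>M)"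
  then have uM: "u \<notin> \<Union>M" and vM: "v \<notin> \<Union>M" by auto
  define Ns where "Ns = {N. maximum_matching_in E N \<and> t \<notin> \<Union>N}"
  have finNs: "finite Ns"
    by (rule finite_subset[of _ "Pow E"])
      (use E(1) in \<open>auto simp: Ns_def maximum_matching_in_def matching_in_def\<close>)
  have "N0 \<in> Ns" using t by (simp add: Ns_def)
  then obtain N where N: "N \<in> Ns" and best: "\<And>N'. N' \<in> Ns \<Longrightarrow> card (M \<inter> N') \<le> card (M \<inter> N)"
    using ex_maximizer[OF finNs, of "\<lambda>N. card (M \<inter> N)"] by blast
  have maxN: "maximum_matching_in E N" and tN: "t \<notin> \<Union>N" using N by (auto simp: Ns_def)
  have mM: "matching_in E M" and mN: "matching_in E N"
    using M maxN by (auto simp: maximum_matching_in_def)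
  have fin: "finite M" "finite N" using mM mN E(1) finite_subset by (auto simp: matching_in_def)
  have fe: "finite e" if "e \<in> E" for e using E(2)[OF that] by (simp add: card_ge_0_finite)
  then have finU: "finite (\<Union>M)" "finite (\<Union>N)" using fin mM mN by (auto simp: matching_in_def)
  have "card M = card N" using M maxN by (auto simp: maximum_matching_in_def intro: antisym)
  then have "card (\<Union>M) = card (\<Union>N)"
    using card_Union_matching[OF mM E(2) fin(1)] card_Union_matching[OF mN E(2) fin(2)] by simp
  then have "card (\<Union>N - \<Union>M) = card (\<Union>M - \<Union>N)"
    using finU by (simp add: card_Diff_subset_Int Int_commute)
  moreover have "{u, v} \<subseteq> \<Union>N - \<Union>M" using ut[OF maxN] tv[OF maxN] tN uM vM by auto
  then have "card {u, v} \<le> card (\<Union>N - \<Union>M)" using finU by (intro card_mono) auto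
  \<comment> \<open>\<open>N\<close> misses \<open>t\<close>, so it covers \<open>u\<close> and
    \<open>v\<close>, which \<open>M\<close> misses. As \<open>M\<close> and \<open>N\<close> cover
    equally many vertices, \<open>M\<close> covers two vertices that \<open>N\<close> misses, and
    one of them is not \<open>t\<close>.\<close>
  ultimately have "2 \<le> card (\<Union>M - \<Union>N)" using \<open>u \<noteq> v\<close> by simp
  then have "\<not> \<Union>M - \<Union>N \<subseteq> {t}" using card_mono[of "{t}" "\<Union>M - \<Union>N"] by auto
  then obtain x where x: "x \<in> \<Union>M" "x \<notin> \<Union>N" "x \<noteq> t" by blast
  then obtain e where e: "e \<in> M" "x \<in> e" by blast
  then have "card e = 2" "e \<in> E" using mM E(2) by (auto simp: matching_in_def)
  then obtain y where y: "e = {x, y}" "x \<noteq> y" using e(2)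
    by (metis card_2_iff doubleton_eq_iff insertE singletonD)
  have eN: "e \<notin> N" using x(2) e(2) by blast
  have disjN: "disjoint N" and disjM: "disjoint M" using mM mN by (auto simp: matching_in_def)
  show False
  proof (cases "y \<in> \<Union>N")
    case False
    then have "matching_in E (insert e N)"
      using mN \<open>e \<in> E\<close> x(2) y(1) by (auto simp: matching_in_def disjoint_def)
    then have "card (insert e N) \<le> card N" using maxN by (simp add: maximum_matching_in_def)
    then show False using eN fin by simp
  next
    case True
    then obtain g where g: "g \<in> N" "y \<in> g" by blast
    have gM: "g \<notin> M"
    proof
      assume "g \<in> M"
      then have "g = e" using disjointD[OF disjM _ e(1)] g(2) y(1) by blast
      then show False using g(1) eN by simp
    qed
    \<comment> \<open>Exchanging \<open>g\<close> for \<open>e\<close> keeps the size and still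
      misses \<open>t\<close>, because \<open>x\<close> is not \<open>t\<close> and \<open>y\<close>
      is covered by \<open>N\<close>. It gains an edge of \<open>M\<close> and loses none, against
      the choice of \<open>N\<close>.\<close>
    define N' where "N' = insert e (N - {g})"
    have "y \<notin> \<Union>(N - {g})" using disjointD[OF disjN _ g(1)] g(2) by blast
    then have "matching_in E N'"
      using mN \<open>e \<in> E\<close> x(2) y(1) by (auto simp: N'_def matching_in_def disjoint_def)
    moreover have "card N' = card N" unfolding N'_def
      by (subst card_insert_disjoint) (use fin eN card_Suc_Diff1[OF fin(2) g(1)] in auto)
    ultimately have "maximum_matching_in E N'" using maxN by (simp add: maximum_matching_in_def)
    moreover have "t \<notin> \<Union>N'" using tN x(3) y True by (auto simp: N'_def)
    ultimately have "card (M \<inter> N') \<le> card (M \<inter> N)" by (intro best) (simp add: Ns_def)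
    moreover have "M \<inter> N' = insert e (M \<inter> N)" using e(1) gM by (auto simp: N'_def)
    ultimately show False using fin eN by simp
  qed
qed

text \<open>The family \<open>C\<close> plays the role of the odd components of the graph without \<open>S\<close>.\<close>

lemma tutte_berge:
  fixes V :: "'v set"
  assumes "finite V" "\<And>e. e \<in> E \<Longrightarrow> card e = 2" "\<And>e. e \<in> E \<Longrightarrow> e \<subseteq> V" "maximum_matching_in E M"
  shows "\<exists>S C. S \<subseteq> V \<and> disjoint C \<and> (\<forall>K\<in>C. K \<subseteq> V - S \<and> odd (card K) \<and>
      (\<forall>e\<in>E. e \<inter> K \<noteq> {} \<longrightarrow> e \<subseteq> K \<union> S)) \<and> card V - 2 * card M + card S \<le> card C"
  using assms
proof (induction "card V" arbitrary: V E M rule: less_induct)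
  case less
  note finV = less.prems(1) and E2 = less.prems(2) and EV = less.prems(3) and maxM = less.prems(4)
  have finE: "finite E" by (rule finite_subset[of E "Pow V"]) (use EV finV in auto)
  have finM: "finite M" if "maximum_matching_in E M" for M
    using that finE finite_subset by (auto simp: maximum_matching_in_def matching_in_def)
  have cU: "card (\<Union>M) = 2 * card M" if "maximum_matching_in E M" for M
    using that finM[OF that] E2
      by (intro card_Union_matching[of E]) (auto simp: maximum_matching_in_def)
  have UV: "\<Union>M \<subseteq> V" if "maximum_matching_in E M" for M
    using that EV by (auto simp: maximum_matching_in_def matching_in_def)
  show ?case
  proof (cases "\<forall>v\<in>V. \<exists>N. maximum_matching_in E N \<and> v \<notin> \<Union>N")
    case True
    \<comment> \<open>Gallai's lemma: the classes are closed under edges, and a maximum matching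
      misses at most one vertex of each class. Hence there are at least as many classes as missed
      vertices, and \<open>S\<close> can be empty.\<close>
    define r where "r = {(u, v). u \<in> V \<and> v \<in> V \<and>
      (u = v \<or> (\<forall>N. maximum_matching_in E N \<longrightarrow> u \<in> \<Union>N \<or> v \<in> \<Union>N))}"
    have r: "equiv V r"
    proof (rule equivI)
      show "r \<subseteq> V \<times> V" by (auto simp: r_def)
      show "refl_on V r" by (auto simp: refl_on_def r_def)
      show "sym r" by (auto simp: sym_def r_def)
      show "trans r"
      proof (rule transI)
        fix u t v assume ut: "(u, t) \<in> r" and tv: "(t, v) \<in> r"
        obtain N0 where N0: "maximum_matching_in E N0" "t \<notin> \<Union>N0"
          using True ut by (auto simp: r_def)
        show "(u, v) \<in> r"
        proof (cases "u = v \<or> u = t \<or> t = v")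
          case True
          then show ?thesis using ut tv by (auto simp: r_def)
        next
          case False
          then have "u \<in> \<Union>N \<or> v \<in> \<Union>N" if "maximum_matching_in E N" for N
            using missed_together_trans[OF finE E2 N0 _ _ that] ut tv by (auto simp: r_def)
          then show ?thesis using ut tv by (auto simp: r_def)
        qed
      qed
    qed
    have adj: "(u, v) \<in> r" if uv: "{u, v} \<in> E" for u v
    proof (rule ccontr)
      assume "(u, v) \<notin> r"
      then obtain N where N: "maximum_matching_in E N" "u \<notin> \<Union>N" "v \<notin> \<Union>N"
        using EV[OF uv] by (auto simp: r_def)
      then have "matching_in E (insert {u, v} N)"
        using uv by (auto simp: maximum_matching_in_def matching_in_def disjoint_def)
      then have "card (insert {u, v} N) \<le> card N" using N(1) by (simp add: maximum_matching_in_def)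
      moreover have "{u, v} \<notin> N" using N(2) by blast
      ultimately show False using finM[OF N(1)] by simp
    qed
    have closed: "e \<subseteq> K" if K: "K \<in> V // r" and e: "e \<in> E" and meet: "e \<inter> K \<noteq> {}" for K e
    proof -
      obtain u v where uv: "e = {u, v}" using E2[OF e] by (auto simp: card_2_iff)
      have "(u, v) \<in> r" "(v, u) \<in> r" using adj e uv by (auto simp: insert_commute)
      then show ?thesis using meet uv in_quotient_imp_closed[OF r K] by auto
    qed
    have near: "K \<inter> \<Union>N = K - {v}" if K: "K \<in> V // r" and N: "maximum_matching_in E N"
      and v: "v \<in> K" "v \<notin> \<Union>N" for K N v
    proof -
      have "u \<in> \<Union>N" if "u \<in> K" "u \<noteq> v" for u
      proof -
        have "(u, v) \<in> r" using in_quotient_imp_in_rel[OF r K] that v by blast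
        then show ?thesis using that N v by (auto simp: r_def)
      qed
      then show ?thesis using v by blast
    qed
    have even: "even (card (K \<inter> \<Union>N))" if K: "K \<in> V // r" and N: "maximum_matching_in E N" for K N
    proof -
      let ?N = "{e \<in> N. e \<inter> K \<noteq> {}}"
      have NE: "N \<subseteq> E" and "disjoint N" using N
        by (auto simp: maximum_matching_in_def matching_in_def)
      then have "K \<inter> \<Union>N = \<Union>?N" using closed[OF K] by auto
      moreover have "card (\<Union>?N) = 2 * card ?N"
        using NE \<open>disjoint N\<close> finM[OF N] E2
        by (intro card_Union_matching[of E]) (auto simp: matching_in_def disjoint_def)
      ultimately show ?thesis by simp
    qed
    have finK: "finite K" if "K \<in> V // r" for K
      using that finV r by (meson finite_equiv_class[OF finV] equiv_def equiv_type)
    \<comment> \<open>A maximum matching that misses \<open>v\<close> covers the rest of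
      \<open>K\<close>, and it does so by edges inside \<open>K\<close>.\<close>
    have odd: "odd (card K)" if K: "K \<in> V // r" for K
    proof -
      obtain v where v: "v \<in> K" "v \<in> V"
        using in_quotient_imp_non_empty[OF r K] in_quotient_imp_subset[OF r K] by blast
      then obtain N where N: "maximum_matching_in E N" "v \<notin> \<Union>N" using True by blast
      have "even (card (K - {v}))" using even[OF K N(1)] near[OF K N(1) v(1) N(2)] by simp
      then show ?thesis using card.remove[OF finK[OF K] v(1)] by simp
    qed
    have "card (V - \<Union>M) \<le> card (V // r)"
    proof (rule card_inj_on_le)
      show "(\<lambda>v. r `` {v}) ` (V - \<Union>M) \<subseteq> V // r" by (auto intro: quotientI)
      show "inj_on (\<lambda>v. r `` {v}) (V - \<Union>M)"
      proof (rule inj_onI)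
        fix u v assume u: "u \<in> V - \<Union>M" and v: "v \<in> V - \<Union>M" and "r `` {u} = r `` {v}"
        then have "(u, v) \<in> r" using eq_equiv_class[OF _ r] by blast
        then show "u = v" using u v maxM by (auto simp: r_def)
      qed
      show "finite (V // r)" using finV r by (simp add: finite_quotient equiv_type)
    qed
    moreover have "card (V - \<Union>M) = card V - 2 * card M"
      using UV[OF maxM] finV cU[OF maxM] by (simp add: card_Diff_subset finite_subset)
    ultimately have "card V - 2 * card M + card ({} :: 'v set) \<le> card (V // r)" by simp
    moreover have "disjoint (V // r)"
      using quotient_disj[OF r] by (auto simp: disjoint_def)
    moreover have "\<forall>K\<in>V // r. K \<subseteq> V - {} \<and> odd (card K) \<and> (\<forall>e\<in>E. e \<inter> K \<noteq> {} \<longrightarrow> e \<subseteq> K \<union> {})"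
      using odd closed in_quotient_imp_subset[OF r] by simp
    ultimately show ?thesis by blast
  next
    case False
    then obtain v where v: "v \<in> V" and cov: "\<And>N. maximum_matching_in E N \<Longrightarrow> v \<in> \<Union>N" by blast
    \<comment> \<open>A vertex covered by all maximum matchings goes into \<open>S\<close>. Deleting
      it lowers the matching number, so the deficiency of the rest is larger by at least one, which
      pays for the larger \<open>S\<close>.\<close>
    define E' where "E' = {e \<in> E. v \<notin> e}"
    obtain M' where M': "maximum_matching_in E' M'"
      using ex_maximum_matching[of E'] finE by (auto simp: E'_def)
    then have mM': "matching_in E M'" "v \<notin> \<Union>M'"
      by (auto simp: maximum_matching_in_def matching_in_def E'_def)
    then have "card M' \<le> card M" using maxM by (simp add: maximum_matching_in_def)
    moreover have "card M' \<noteq> card M"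
      using cov[of M'] mM' maxM by (auto simp: maximum_matching_in_def)
    ultimately have less': "card M' < card M" by simp
    have "card (V - {v}) < card V" using v finV by (intro card_Diff1_less)
    moreover have "finite (V - {v})" "\<And>e. e \<in> E' \<Longrightarrow> card e = 2" "\<And>e. e \<in> E' \<Longrightarrow> e \<subseteq> V - {v}"
      using finV E2 EV by (auto simp: E'_def)
    ultimately obtain S C where SC: "S \<subseteq> V - {v}" "disjoint C"
      "\<forall>K\<in>C. K \<subseteq> V - {v} - S \<and> odd (card K) \<and> (\<forall>e\<in>E'. e \<inter> K \<noteq> {} \<longrightarrow> e \<subseteq> K \<union> S)"
      "card (V - {v}) - 2 * card M' + card S \<le> card C"
      using less.hyps[of "V - {v}" E' M'] M' by metis
    \<comment> \<open>Subtraction of naturals truncates at zero; this bound ensures that the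
      deficiency of \<open>V\<close> is the true difference.\<close>
    have "2 * card M \<le> card V" using cU[OF maxM] card_mono[OF finV UV[OF maxM]] by simp
    then have "card V - 2 * card M + card (insert v S) \<le> card C"
      using SC(1,4) less' v finV finite_subset[OF SC(1)]
      by (subst card_insert_disjoint) (auto simp: card_Diff_singleton)
    moreover have "e \<subseteq> K \<union> insert v S" if Ke: "K \<in> C" "e \<in> E" "e \<inter> K \<noteq> {}" for K e
    proof (cases "v \<in> e")
      case True
      then obtain w where "e = {v, w}" using E2[OF Ke(2)]
        by (metis card_2_iff insertE singletonD insert_commute)
      then show ?thesis using Ke SC(3) by auto
    next
      case False
      then show ?thesis using Ke SC(3) by (auto simp: E'_def)
    qed
    ultimately show ?thesis
      using SC v by (intro exI[of _ "insert v S"] exI[of _ C]) auto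
  qed
qed

section \<open>Blocks of edges\<close>

definition four_one :: "'c multiset \<Rightarrow> bool" where
  "four_one M \<longleftrightarrow> (\<exists>a b. a \<noteq> b \<and> M = {#a, a, a, a, b#})"

text \<open>What a coloring of the completed graph tells about a block: merged edges share a color;
  a loop at a block of size 3 takes two of the four equal entries and leaves two equal and one
  different; two loops at a block of size 1 leave its color arbitrary.\<close>

definition block_ok :: "'c multiset \<Rightarrow> bool" where
  "block_ok M \<longleftrightarrow> (size M = 2 \<longrightarrow> (\<exists>a. M = {#a, a#})) \<and>
     (size M = 3 \<longrightarrow> (\<exists>a b. a \<noteq> b \<and> M = {#a, a, b#})) \<and> (size M = 5 \<longrightarrow> four_one M)"

text \<open>The five disjuncts say which entry is the odd one. For concrete stars this leaves only
  equations between colors, which simplification decides.\<close>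

lemma four_one_iff:
  "four_one {#a, b, c, d, e#} \<longleftrightarrow>
     (a = b \<and> a = c \<and> a = d \<and> a \<noteq> e) \<or> (a = b \<and> a = c \<and> a = e \<and> a \<noteq> d) \<or>
     (a = b \<and> a = d \<and> a = e \<and> a \<noteq> c) \<or> (a = c \<and> a = d \<and> a = e \<and> a \<noteq> b) \<or>
     (b = c \<and> b = d \<and> b = e \<and> b \<noteq> a)"
  (is "?L = ?R")
proof
  assume ?R
  then show ?L
  proof (elim disjE conjE)
    assume "a = b" "a = c" "a = d" "a \<noteq> e"
    then show ?L by (auto simp: four_one_def)
  next
    assume h: "a = b" "a = c" "a = e" "a \<noteq> d"
    then have "{#a, b, c, d, e#} = {#a, a, a, a, d#}" by simp
    then show ?L using h(4) unfolding four_one_def by blast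
  next
    assume h: "a = b" "a = d" "a = e" "a \<noteq> c"
    then have "{#a, b, c, d, e#} = {#a, a, a, a, c#}" by simp
    then show ?L using h(4) unfolding four_one_def by blast
  next
    assume h: "a = c" "a = d" "a = e" "a \<noteq> b"
    then have "{#a, b, c, d, e#} = {#a, a, a, a, b#}" by simp
    then show ?L using h(4) unfolding four_one_def by blast
  next
    assume h: "b = c" "b = d" "b = e" "b \<noteq> a"
    then have "{#a, b, c, d, e#} = {#b, b, b, b, a#}" by simp
    then show ?L using h(4) unfolding four_one_def by blast
  qed
next
  assume ?L
  then obtain x y where xy: "x \<noteq> y" "{#a, b, c, d, e#} = {#x, x, x, x, y#}"
    by (auto simp: four_one_def)
  have "y \<in># {#a, b, c, d, e#}" using xy by simp
  then consider "y = a" | "y = b" | "y = c" | "y = d" | "y = e" by auto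
  then show ?R
  proof cases
    case 1
    then have "{#b, c, d, e#} = {#x, x, x, x#}" using xy(2) by (simp add: add_mset_commute)
    then have "set_mset {#b, c, d, e#} = set_mset {#x, x, x, x#}" by (rule arg_cong)
    then show ?thesis using 1 xy(1) by auto
  next
    case 2
    then have "{#a, c, d, e#} = {#x, x, x, x#}" using xy(2) by (simp add: add_mset_commute)
    then have "set_mset {#a, c, d, e#} = set_mset {#x, x, x, x#}" by (rule arg_cong)
    then show ?thesis using 2 xy(1) by auto
  next
    case 3
    then have "{#a, b, d, e#} = {#x, x, x, x#}" using xy(2) by (simp add: add_mset_commute)
    then have "set_mset {#a, b, d, e#} = set_mset {#x, x, x, x#}" by (rule arg_cong)
    then show ?thesis using 3 xy(1) by auto
  next
    case 4
    then have "{#a, b, c, e#} = {#x, x, x, x#}" using xy(2) by (simp add: add_mset_commute)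
    then have "set_mset {#a, b, c, e#} = set_mset {#x, x, x, x#}" by (rule arg_cong)
    then show ?thesis using 4 xy(1) by auto
  next
    case 5
    then have "{#a, b, c, d#} = {#x, x, x, x#}" using xy(2) by (simp add: add_mset_commute)
    then have "set_mset {#a, b, c, d#} = set_mset {#x, x, x, x#}" by (rule arg_cong)
    then show ?thesis using 5 xy(1) by auto
  qed
qed

lemma size_eq_Suc_D: "size M = Suc n \<Longrightarrow> \<exists>a N. M = add_mset a N \<and> size N = n"
  using size_eq_Suc_imp_eq_union[of M n] by fastforce

lemma size_2_D: "size M = 2 \<Longrightarrow> \<exists>a b. M = {#a, b#}"
  using size_eq_Suc_D[of M 1] size_eq_Suc_D[of _ 0] by (fastforce simp: numeral_2_eq_2)

text \<open>The color of the loop occurs at least twice, so it is the fourfold one, and two of its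
  copies can be cancelled.\<close>

lemma four_one_loop:
  assumes "four_one (M + {#x, x#})"
  shows "\<exists>a b. a \<noteq> b \<and> M = {#a, a, b#}"
proof -
  obtain a b where ab: "a \<noteq> b" "M + {#x, x#} = {#a, a, a, a, b#}"
    using assms by (auto simp: four_one_def)
  have "count (M + {#x, x#}) x \<ge> 2" by simp
  then have "count {#a, a, a, a, b#} x \<ge> 2" using ab(2) by metis
  then have "x = a" using ab(1) by (auto split: if_splits)
  then have "M + {#a, a#} = {#a, a, b#} + {#a, a#}" using ab(2) by (simp add: add_mset_commute)
  then have "M = {#a, a, b#}" by (metis add_right_cancel)
  then show ?thesis using ab(1) by blast
qed

lemma four_one_image_inj:
  assumes "inj f" "four_one M"
  shows "four_one (image_mset f M)"
proof -
  obtain a b where "a \<noteq> b" "M = {#a, a, a, a, b#}" using assms(2) by (auto simp: four_one_def)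
  moreover have "f a \<noteq> f b" using \<open>a \<noteq> b\<close> assms(1) by (simp add: inj_eq)
  ultimately show ?thesis by (simp add: four_one_iff)
qed

text \<open>A pseudograph is encoded as the multiset of its stars, called blocks, in which every edge occurs
  twice. Blocks of size 2 are suppressed by merging their two edges; blocks of size 1 or 3 are
  completed by loops.\<close>

lemma blocks_coloring:
  fixes N :: "nat multiset multiset"
  assumes min: "\<And>N :: nat multiset multiset. \<lbrakk>N \<noteq> {#}; \<And>s. s \<in># N \<Longrightarrow> size s = 5;
      \<And>e. count (\<Sum>\<^sub># N) e \<in> {0, 2}; size N < n\<rbrakk>
      \<Longrightarrow> \<exists>c :: nat \<Rightarrow> nat. \<forall>s\<in>#N. four_one (image_mset c s)"
    and "\<And>s. s \<in># N \<Longrightarrow> size s \<in> {1, 2, 3, 5}"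
    and "\<And>e. count (\<Sum>\<^sub># N) e \<in> {0, 2}"
    and "size (filter_mset (\<lambda>s. size s \<noteq> 2) N) < n"
  shows "\<exists>c :: nat \<Rightarrow> nat. \<forall>s\<in>#N. block_ok (image_mset c s)"
  using assms(2-4)
\<comment> \<open>The measure drops in each round: a loop raises the size of a block by 2, and a
  suppressed block takes its deficit 3 away. The number of blocks of size other than 2, which
  becomes the number of vertices, stays the same.\<close>
proof (induction "\<Sum>s\<in>#N. 5 - size s" arbitrary: N rule: less_induct)
  case (less N)
  note sizes = less.prems(1) and cnt = less.prems(2) and few = less.prems(3)
  consider "N = {#}" | "N \<noteq> {#}" "\<And>s. s \<in># N \<Longrightarrow> size s = 5"
    | s where "s \<in># N" "size s = 1 \<or> size s = 3" | s where "s \<in># N" "size s = 2"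
    using sizes by blast
  then show ?case
  proof cases
    case 1
    then show ?thesis by simp
  next
    case 2
    then have "filter_mset (\<lambda>s. size s \<noteq> 2) N = N"
      by (simp add: filter_mset_eq_conv)
    then have "size N < n" using few by simp
    then obtain c :: "nat \<Rightarrow> nat" where "\<forall>s\<in>#N. four_one (image_mset c s)"
      using min[OF 2(1) _ cnt] 2(2) by blast
    then show ?thesis using 2(2) by (auto simp: block_ok_def)
  next
    case (3 s)
    then obtain N' where N: "N = add_mset s N'" by (metis insert_DiffM)
    obtain x where x: "x \<notin># \<Sum>\<^sub># N"
      using ex_new_if_finite[of "set_mset (\<Sum>\<^sub># N)"] infinite_UNIV_nat by auto
    then have x': "count (\<Sum>\<^sub># N) x = 0" by (simp only: not_in_iff)
    \<comment> \<open>A new name occurring twice in one block is a loop. A block of size 1 becomes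
      one of size 3 and gets its second loop in a later round.\<close>
    define N2 where "N2 = add_mset (s + {#x, x#}) N'"
    have "(\<Sum>s\<in>#N2. 5 - size s) < (\<Sum>s\<in>#N. 5 - size s)"
      using 3(2) by (auto simp: N2_def N)
    moreover have "size t \<in> {1, 2, 3, 5}" if "t \<in># N2" for t
      using that 3(2) sizes by (auto simp: N2_def N)
    moreover have "count (\<Sum>\<^sub># N2) e \<in> {0, 2}" for e
      using cnt[of e] x' by (cases "e = x") (auto simp: N2_def N)
    moreover have "size (filter_mset (\<lambda>s. size s \<noteq> 2) N2) < n"
      using few 3(2) by (auto simp: N2_def N)
    ultimately obtain c :: "nat \<Rightarrow> nat" where c: "\<forall>s\<in>#N2. block_ok (image_mset c s)"
      using less.hyps[of N2] by blast
    then have "block_ok (image_mset c (s + {#x, x#}))" by (simp add: N2_def)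
    then have "size s = 3 \<Longrightarrow> four_one (image_mset c s + {#c x, c x#})"
      by (simp add: block_ok_def)
    then have "block_ok (image_mset c s)"
      using 3(2) four_one_loop[of "image_mset c s" "c x"] by (auto simp: block_ok_def)
    then show ?thesis using c by (intro exI[of _ c]) (simp add: N2_def N)
  next
    case (4 s)
    then obtain N' where N: "N = add_mset s N'" by (metis insert_DiffM)
    obtain e1 e2 where s: "s = {#e1, e2#}" using size_2_D[OF 4(2)] by blast
    \<comment> \<open>Merging renames \<open>e2\<close> to \<open>e1\<close>, and a coloring of the
      result is pulled back along \<open>f\<close>. If \<open>e1 = e2\<close>, the block is a closed
      curve that simply disappears.\<close>
    define f where "f = (\<lambda>e. if e = e2 then e1 else e)"
    define N2 where "N2 = image_mset (image_mset f) N'"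
    have sum: "\<Sum>\<^sub># N2 = image_mset f (\<Sum>\<^sub># N')"
      unfolding N2_def by (induction N') auto
    have "(\<Sum>s\<in>#N2. 5 - size s) < (\<Sum>s\<in>#N. 5 - size s)"
      using 4(2) by (simp add: N2_def N multiset.map_comp comp_def)
    moreover have "size t \<in> {1, 2, 3, 5}" if t: "t \<in># N2" for t
    proof -
      obtain x where "x \<in># N" "t = image_mset f x" using t by (auto simp: N2_def N)
      then show ?thesis using sizes[of x] by simp
    qed
    moreover have "count (\<Sum>\<^sub># N2) e \<in> {0, 2}" for e
    proof (cases "e1 = e2")
      case True
      then have "f = (\<lambda>e. e)" unfolding f_def by (intro ext) simp
      then have eq: "\<Sum>\<^sub># N2 = \<Sum>\<^sub># N'" by (simp add: sum)
      have "count (\<Sum>\<^sub># N) e = count (\<Sum>\<^sub># N') e + (if e = e2 then 2 else 0)"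
        using True by (simp add: N s)
      then show ?thesis using cnt[of e] unfolding eq by (simp split: if_splits)
    next
      case False
      have cf: "count (image_mset f M) e =
          (if e = e2 then 0 else if e = e1 then count M e1 + count M e2 else count M e)" for M
        using False by (induction M) (auto simp: f_def)
      have S: "count (\<Sum>\<^sub># N) d =
          count (\<Sum>\<^sub># N') d + (if d = e1 then 1 else if d = e2 then 1 else 0)" for d
        using False by (simp add: N s)
      have "count (\<Sum>\<^sub># N') e1 = 1" "count (\<Sum>\<^sub># N') e2 = 1"
        using cnt[of e1] cnt[of e2] False unfolding S by auto
      then show ?thesis
        using cnt[of e] unfolding sum cf S by (simp split: if_splits)
    qed
    moreover have "size (filter_mset (\<lambda>s. size s \<noteq> 2) N2) < n"
      using few 4(2) by (simp add: N2_def N filter_mset_image_mset)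
    ultimately obtain c :: "nat \<Rightarrow> nat" where c: "\<forall>s\<in>#N2. block_ok (image_mset c s)"
      using less.hyps[of N2] by blast
    have "block_ok (image_mset (c \<circ> f) t)" if "t \<in># N'" for t
    proof -
      have "image_mset f t \<in># N2" using that by (simp add: N2_def)
      then have "block_ok (image_mset c (image_mset f t))" using c by blast
      then show ?thesis by (simp only: multiset.map_comp)
    qed
    moreover have "block_ok (image_mset (c \<circ> f) s)"
      by (auto simp: s f_def block_ok_def)
    ultimately show ?thesis by (intro exI[of _ "c \<circ> f"]) (auto simp: N)
  qed
qed

section \<open>Stars of a pseudograph\<close>

definition incidence :: "'v uprod \<Rightarrow> 'v \<Rightarrow> nat" where
  "incidence p v = (if v \<in> set_uprod p then 1 else 0) + (if p = Upair v v then 1 else 0)"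

definition star :: "('v, 'e) pgraph \<Rightarrow> 'v \<Rightarrow> 'e multiset" where
  "star G v = (\<Sum>e\<in>edges G. replicate_mset (incidence (ends G e) v) e)"

lemma count_star:
  assumes "finite (edges G)"
  shows "count (star G v) e = (if e \<in> edges G then incidence (ends G e) v else 0)"
  using assms by (simp add: star_def count_sum if_distrib sum.delta cong: if_cong)

lemma in_star:
  assumes "finite (edges G)"
  shows "e \<in># star G v \<longleftrightarrow> e \<in> edges G \<and> v \<in> set_uprod (ends G e)"
  using assms by (subst count_greater_zero_iff[symmetric]) (auto simp: count_star incidence_def)

lemma size_star:
  assumes "finite (edges G)"
  shows "size (star G v) = degree G v"
proof -
  have "size (star G v) = (\<Sum>e\<in>edges G. incidence (ends G e) v)"
    by (simp add: star_def size_multiset_sum)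
  also have "\<dots> = degree G v"
    using assms
    by (simp add: incidence_def degree_def edges_between_def sum.distrib sum.If_cases Int_def)
  finally show ?thesis .
qed

text \<open>A total of 2 comes from one vertex counted twice, which is a loop, or from two vertices
  counted once.\<close>

lemma incidence_eq_sum_two:
  fixes f :: "'v \<Rightarrow> nat"
  assumes "finite A" "sum f A = 2"
  shows "\<exists>p. set_uprod p \<subseteq> A \<and> (\<forall>v\<in>A. incidence p v = f v)"
proof -
  obtain a where a: "a \<in> A" "f a \<noteq> 0"
    using assms by (metis sum.neutral zero_neq_numeral)
  have sum: "f a + sum f (A - {a}) = 2" using assms a by (simp add: sum.remove)
  show ?thesis
  proof (cases "sum f (A - {a}) = 0")
    case True
    then have "\<forall>v\<in>A - {a}. f v = 0" using assms(1) by simp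
    then show ?thesis
      using True sum a(1) by (intro exI[of _ "Upair a a"]) (auto simp: incidence_def)
  next
    case False
    then have "sum f (A - {a}) = 1" and fa: "f a = 1" using sum a(2) by auto
    then obtain b where "b \<in> A - {a}" "f b = 1" "\<forall>v\<in>A - {a}. b \<noteq> v \<longrightarrow> f v = 0"
      using assms(1) sum_eq_1_iff[of "A - {a}" f] by auto
    then show ?thesis
      using fa a(1) by (intro exI[of _ "Upair a b"]) (auto simp: incidence_def)
  qed
qed

lemma sum_incidence:
  assumes "finite A" "set_uprod p \<subseteq> A"
  shows "sum (incidence p) A = 2"
proof (cases p)
  case (Upair a b)
  then have ab: "a \<in> A" "b \<in> A" using assms by auto
  have "sum (incidence p) A = sum (incidence p) {a, b}"
    using assms ab by (intro sum.mono_neutral_right) (auto simp: incidence_def Upair)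
  then show ?thesis by (cases "a = b") (auto simp: incidence_def Upair)
qed

lemma count_sum_star:
  assumes "pseudograph G"
  shows "count (\<Sum>v\<in>verts G. star G v) e = (if e \<in> edges G then 2 else 0)"
  using assms by (simp add: pseudograph_def count_sum count_star sum_incidence)

lemma count_image_mset_filter: "count (image_mset c M) a = size (filter_mset (\<lambda>e. c e = a) M)"
  by (induction M) auto

lemma color_degree_star:
  assumes "finite (edges G)"
  shows "color_degree G c a v = count (image_mset c (star G v)) a"
proof -
  have "star (G\<lparr>edges := {e \<in> edges G. c e = a}\<rparr>) v = filter_mset (\<lambda>e. c e = a) (star G v)"
    using assms by (intro multiset_eqI) (simp add: count_star)
  then show ?thesis
    using assms by (simp add: color_degree_def count_image_mset_filter flip: size_star)
qed

lemma four_one_iff_count: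
  assumes "size M = 5"
  shows "four_one M \<longleftrightarrow> (\<exists>a b. a \<noteq> b \<and> count M a = 4 \<and> count M b = 1)"
proof
  assume "\<exists>a b. a \<noteq> b \<and> count M a = 4 \<and> count M b = 1"
  then obtain a b where ab: "a \<noteq> b" "count M a = 4" "count M b = 1" by blast
  then have "{#a, a, a, a, b#} \<subseteq># M" by (auto simp: subseteq_mset_def intro!: count_inI)
  then have "{#a, a, a, a, b#} = M"
    using assms mset_subset_size[of "{#a, a, a, a, b#}" M] by (auto simp: subset_mset.le_less)
  then show "four_one M" using ab(1) by (auto simp: four_one_def)
qed (force simp: four_one_def)

text \<open>A graph has a vertex, and the star of that vertex exhibits the two colors that a
  coloring must use; the remaining condition is a count within stars of size 5.\<close>

lemma coloring_4_1_iff_star: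
  assumes "regular 5 G"
  shows "coloring_4_1 G c \<longleftrightarrow> (\<forall>v\<in>verts G. four_one (image_mset c (star G v)))"
proof -
  have fin: "finite (edges G)" and "verts G \<noteq> {}"
    using assms by (auto simp: regular_def pseudograph_def)
  then obtain v where v: "v \<in> verts G" by blast
  have iff: "four_one (image_mset c (star G v)) \<longleftrightarrow>
      (\<exists>a b. a \<noteq> b \<and> color_degree G c a v = 4 \<and> color_degree G c b v = 1)" if "v \<in> verts G" for v
    using that assms fin
    by (subst four_one_iff_count) (auto simp: size_star regular_def color_degree_star)
  have "2 \<le> card (c ` edges G)"
    if "color_degree G c a v = 4" "color_degree G c b v = 1" "a \<noteq> b" for a b
  proof -
    have "a \<in># image_mset c (star G v)" "b \<in># image_mset c (star G v)"
      using that fin by (auto simp only: color_degree_star intro!: count_inI)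
    then have "{a, b} \<subseteq> c ` edges G"
      using fin by (auto simp: in_star)
    then have "card {a, b} \<le> card (c ` edges G)" using fin by (intro card_mono) auto
    then show ?thesis using that by simp
  qed
  then show ?thesis using v unfolding coloring_4_1_def by (auto simp: iff)
qed

text \<open>The vertices are positions in a list of the blocks, since different vertices can have
  equal stars, as with five parallel edges. The ends of an edge are recovered from its two
  occurrences.\<close>

lemma ex_graph_of_blocks:
  fixes N :: "'e multiset multiset"
  assumes "N \<noteq> {#}" "\<And>s. s \<in># N \<Longrightarrow> size s = 5" "\<And>e. count (\<Sum>\<^sub># N) e \<in> {0, 2}"
  shows "\<exists>G :: (nat, 'e) pgraph. regular 5 G \<and> card (verts G) = size N \<and>
    (\<forall>s. s \<in># N \<longleftrightarrow> s \<in> star G ` verts G)"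
proof -
  obtain xs where xs: "mset xs = N" using ex_mset by blast
  define A where "A = {..<length xs}"
  have sum: "(\<Sum>i\<in>A. count (xs ! i) e) = count (\<Sum>\<^sub># N) e" for e
  proof -
    have "\<Sum>\<^sub># N = (\<Sum>i\<in>A. xs ! i)"
      unfolding xs[symmetric] A_def sum_mset_sum_list
        by (simp add: sum_list_sum_nth atLeast0LessThan)
    then show ?thesis by (simp add: count_sum)
  qed
  have "\<exists>p. set_uprod p \<subseteq> A \<and> (\<forall>i\<in>A. incidence p i = count (xs ! i) e)"
    if "e \<in># \<Sum>\<^sub># N" for e
  proof (rule incidence_eq_sum_two)
    have "count (\<Sum>\<^sub># N) e \<noteq> 0" using that by (simp only: count_eq_zero_iff) simp
    then show "(\<Sum>i\<in>A. count (xs ! i) e) = 2" unfolding sum using assms(3)[of e]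
      by (metis empty_iff insert_iff)
  qed (simp add: A_def)
  then obtain p where p: "\<And>e. e \<in># \<Sum>\<^sub># N \<Longrightarrow>
      set_uprod (p e) \<subseteq> A \<and> (\<forall>i\<in>A. incidence (p e) i = count (xs ! i) e)"
    by metis
  define G where "G = \<lparr>verts = A, edges = set_mset (\<Sum>\<^sub># N), ends = p\<rparr>"
  have "star G i = xs ! i" if i: "i \<in> A" for i
  proof (rule multiset_eqI)
    fix e
    have "xs ! i \<in># N" using i xs by (auto simp: A_def)
    then have sub: "e \<in># \<Sum>\<^sub># N" if "e \<in># xs ! i" using that by (auto simp: in_Union_mset_iff)
    show "count (star G i) e = count (xs ! i) e"
    proof (cases "e \<in># \<Sum>\<^sub># N")
      case True
      then show ?thesis using p[OF True] i by (subst count_star) (auto simp: G_def)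
    next
      case False
      then have "count (xs ! i) e = 0" using sub not_in_iff by metis
      then show ?thesis using False by (subst count_star) (auto simp: G_def)
    qed
  qed
  then have star: "\<forall>i\<in>A. star G i = xs ! i" by blast
  have "A \<noteq> {}" using assms(1) xs by (auto simp: A_def lessThan_empty_iff)
  then have "pseudograph G" using p by (auto simp: pseudograph_def G_def A_def)
  moreover have "degree G i = 5" if "i \<in> A" for i
  proof -
    have "degree G i = size (xs ! i)" using star that by (simp add: G_def flip: size_star)
    then show ?thesis using that assms(2) xs by (auto simp: A_def)
  qed
  ultimately have "regular 5 G" by (simp add: regular_def G_def)
  moreover have "star G ` verts G = set_mset N"
    using star xs by (force simp: G_def A_def in_set_conv_nth)
  moreover have "card (verts G) = size N" using xs by (auto simp: G_def A_def)
  ultimately show ?thesis by blast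
qed

text \<open>The reductions handle stars only, so the graph is left behind; that every edge has two
  ends becomes the condition on counts. Minimality is stated for edge names in \<open>nat\<close>,
  because an assumption cannot range over types.\<close>

locale minimal_star_system =
  fixes V :: "'v set" and st :: "'v \<Rightarrow> 'e multiset"
  assumes finite_V: "finite V"
    and size_st: "\<And>v. v \<in> V \<Longrightarrow> size (st v) = 5"
    and count_sum_st: "\<And>e. count (\<Sum>v\<in>V. st v) e \<in> {0, 2}"
    and no_coloring: "\<And>c :: 'e \<Rightarrow> nat. \<exists>v\<in>V. \<not> four_one (image_mset c (st v))"
    and minimal: "\<And>N :: nat multiset multiset. \<lbrakk>N \<noteq> {#}; \<And>s. s \<in># N \<Longrightarrow> size s = 5;
      \<And>e. count (\<Sum>\<^sub># N) e \<in> {0, 2}; size N < card V\<rbrakk>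
      \<Longrightarrow> \<exists>c :: nat \<Rightarrow> nat. \<forall>s\<in>#N. four_one (image_mset c s)"
begin

lemma count_image_inj_on:
  "inj_on f (set_mset M) \<Longrightarrow> x \<in># M \<Longrightarrow> count (image_mset f M) (f x) = count M x"
proof -
  assume h: "inj_on f (set_mset M)" "x \<in># M"
  then have "filter_mset (\<lambda>y. f y = f x) M = filter_mset (\<lambda>y. y = x) M"
    by (intro filter_mset_cong) (auto dest: inj_onD)
  then show ?thesis by (simp add: count_image_mset_filter filter_eq_replicate_mset)
qed

text \<open>The dangling edges of \<open>X\<close> are regrouped into the blocks \<open>P\<close>,
  and the even multiset \<open>R\<close> collects the edges that disappear with both ends. Blocks of
  size 2 get suppressed, so only the others count as vertices replacing \<open>X\<close>.\<close>

lemma surgery: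
  assumes X: "X \<subseteq> V" and split: "(\<Sum>v\<in>X. st v) = \<Sum>\<^sub># P + R" and R: "\<And>e. even (count R e)"
    and sizes: "\<And>s. s \<in># P \<Longrightarrow> size s \<in> {1, 2, 3, 5}"
    and few: "size (filter_mset (\<lambda>s. size s \<noteq> 2) P) < card X"
  shows "\<exists>c :: 'e \<Rightarrow> nat. (\<forall>v\<in>V - X. four_one (image_mset c (st v))) \<and>
    (\<forall>s\<in>#P. block_ok (image_mset c s))"
proof -
  define N where "N = image_mset st (mset_set (V - X)) + P"
  have finX: "finite X" "finite (V - X)" using X finite_V by (auto intro: finite_subset)
  have sumN: "\<Sum>\<^sub># N = (\<Sum>v\<in>V - X. st v) + \<Sum>\<^sub># P"
    by (simp add: N_def sum_unfold_sum_mset)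
  have cnt: "count (\<Sum>\<^sub># N) e \<in> {0, 2}" for e
  proof -
    have "(\<Sum>v\<in>V. st v) = \<Sum>\<^sub># N + R"
      unfolding sumN using sum.subset_diff[OF X finite_V, of st] split by simp
    then have "count (\<Sum>\<^sub># N) e + count R e \<in> {0, 2}" using count_sum_st[of e] by simp
    then show ?thesis using R[of e] by (auto elim!: evenE) presburger+
  qed
  \<comment> \<open>Minimality speaks about names in \<open>nat\<close>: the finitely many edges are
    renamed injectively and the coloring is pulled back.\<close>
  obtain f :: "'e \<Rightarrow> nat" where f: "inj_on f (set_mset (\<Sum>\<^sub># N))"
    using finite_imp_inj_to_nat_seg[of "set_mset (\<Sum>\<^sub># N)"] by auto
  define N' where "N' = image_mset (image_mset f) N"
  have sumN': "\<Sum>\<^sub># N' = image_mset f (\<Sum>\<^sub># N)"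
    unfolding N'_def by (induction N) auto
  have "count (\<Sum>\<^sub># N') e \<in> {0, 2}" for e
  proof (cases "e \<in> f ` set_mset (\<Sum>\<^sub># N)")
    case True
    then obtain d where d: "d \<in># \<Sum>\<^sub># N" "e = f d" by blast
    then have "count (\<Sum>\<^sub># N') e = count (\<Sum>\<^sub># N) d"
      unfolding sumN' using count_image_inj_on[OF f d(1)] by simp
    then show ?thesis using cnt[of d] by simp
  next
    case False
    then have "e \<notin># image_mset f (\<Sum>\<^sub># N)" by simp
    then have "count (\<Sum>\<^sub># N') e = 0" unfolding sumN' by (simp only: not_in_iff)
    then show ?thesis by simp
  qed
  moreover have "size s \<in> {1, 2, 3, 5}" if s: "s \<in># N'" for s
  proof -
    obtain t where t: "t \<in># N" "s = image_mset f t" using s by (auto simp: N'_def)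
    then show ?thesis using sizes size_st finX by (auto simp: N_def)
  qed
  moreover have "size (filter_mset (\<lambda>s. size s \<noteq> 2) N') < card V"
  proof -
    have "size (filter_mset (\<lambda>s. size s \<noteq> 2) N') = size (filter_mset (\<lambda>s. size s \<noteq> 2) N)"
      by (simp add: N'_def filter_mset_image_mset)
    also have "\<dots> \<le> size (image_mset st (mset_set (V - X))) + size (filter_mset (\<lambda>s. size s \<noteq> 2) P)"
      unfolding N_def filter_union_mset size_union
        by (intro add_mono size_filter_mset_lesseq order_refl)
    also have "\<dots> < card (V - X) + card X" using few by simp
    also have "\<dots> = card V" using X finite_V card_mono[OF finite_V X]
      by (simp add: card_Diff_subset finX)
    finally show ?thesis .
  qed
  ultimately have "\<exists>c :: nat \<Rightarrow> nat. \<forall>s\<in>#N'. block_ok (image_mset c s)"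
    by (intro blocks_coloring[of "card V" N', OF minimal])
  then obtain c :: "nat \<Rightarrow> nat" where c: "\<forall>s\<in>#N'. block_ok (image_mset c s)" ..
  have ok: "block_ok (image_mset (c \<circ> f) s)" if "s \<in># N" for s
    using c that by (auto simp: N'_def simp flip: multiset.map_comp)
  show ?thesis
  proof (intro exI[of _ "c \<circ> f"] conjI ballI)
    fix v assume v: "v \<in> V - X"
    then have "block_ok (image_mset (c \<circ> f) (st v))"
      using finX by (intro ok) (simp add: N_def)
    then show "four_one (image_mset (c \<circ> f) (st v))"
      using v size_st by (simp add: block_ok_def)
  qed (simp add: ok N_def)
qed

lemma count_le_2:
  assumes "X \<subseteq> V"
  shows "count (\<Sum>v\<in>X. st v) e \<le> 2"
proof -
  have "(\<Sum>v\<in>X. count (st v) e) \<le> (\<Sum>v\<in>V. count (st v) e)"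
    using finite_V assms by (intro sum_mono2) auto
  then show ?thesis using count_sum_st[of e] by (auto simp: count_sum)
qed

text \<open>A positive even count is at least 2, and an edge has only two ends, so \<open>R\<close>
  uses up both ends of a removed edge inside \<open>X\<close>.\<close>

lemma removed_notin:
  assumes X: "X \<subseteq> V" and split: "(\<Sum>v\<in>X. st v) = Q + R" and R: "\<And>e. even (count R e)"
    and e: "e \<in># R"
  shows "e \<notin># Q" "v \<in> V - X \<Longrightarrow> e \<notin># st v"
proof -
  have "count R e \<noteq> 0" using e by (simp only: count_eq_zero_iff) simp
  then have R2: "count R e \<ge> 2" using R[of e] by presburger
  have X2: "count (\<Sum>v\<in>X. st v) e \<le> 2" using count_le_2[OF X] .
  then have "count Q e = 0" using R2 unfolding split by simp
  then show "e \<notin># Q" by (simp only: count_eq_zero_iff) simp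
  assume v: "v \<in> V - X"
  have finX: "finite X" using X finite_V by (auto intro: finite_subset)
  have "count (\<Sum>v\<in>insert v X. st v) e \<le> 2" using v X by (intro count_le_2) auto
  then have "count (st v) e = 0" using v R2 finX split by simp
  then show "e \<notin># st v" by (simp only: count_eq_zero_iff) simp
qed

text \<open>Removed edges do not meet the outside of \<open>X\<close>, so recoloring them keeps the
  stars there correct; only the stars of \<open>X\<close> have to be repaired.\<close>

lemma no_reduction:
  assumes X: "X \<subseteq> V" and split: "(\<Sum>v\<in>X. st v) = \<Sum>\<^sub># P + R" and R: "\<And>e. even (count R e)"
    and sizes: "\<And>s. s \<in># P \<Longrightarrow> size s \<in> {1, 2, 3, 5}"
    and few: "size (filter_mset (\<lambda>s. size s \<noteq> 2) P) < card X"
    and extend: "\<And>c :: 'e \<Rightarrow> nat. (\<And>s. s \<in># P \<Longrightarrow> block_ok (image_mset c s)) \<Longrightarrow>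
      \<exists>c'. (\<forall>e. e \<notin># R \<longrightarrow> c' e = c e) \<and> (\<forall>v\<in>X. four_one (image_mset c' (st v)))"
  shows False
proof -
  obtain c :: "'e \<Rightarrow> nat" where c: "\<forall>v\<in>V - X. four_one (image_mset c (st v))"
    "\<And>s. s \<in># P \<Longrightarrow> block_ok (image_mset c s)"
    using surgery[OF X split R sizes few] by blast
  obtain c' where c': "\<forall>e. e \<notin># R \<longrightarrow> c' e = c e" "\<forall>v\<in>X. four_one (image_mset c' (st v))"
    using extend[OF c(2)] by blast
  have "four_one (image_mset c' (st v))" if v: "v \<in> V - X" for v
  proof -
    have "image_mset c' (st v) = image_mset c (st v)"
      using c'(1) removed_notin(2)[OF X split R _ v] by (intro image_mset_cong) blast
    then show ?thesis using c(1) v by simp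
  qed
  then show False using no_coloring[of c'] c'(2) by blast
qed

end

section \<open>Reductions by pairing dangling edges\<close>

lemma block_ok_pair: "block_ok {#a, b#} \<longleftrightarrow> a = b"
proof
  assume "block_ok {#a, b#}"
  then obtain x where "{#a, b#} = {#x, x#}" by (auto simp: block_ok_def)
  then have "set_mset {#a, b#} = set_mset {#x, x#}" by (rule arg_cong)
  then show "a = b" by auto
qed (auto simp: block_ok_def)

lemma ex_fresh_nat:
  fixes A :: "nat set"
  assumes "finite A"
  obtains d where "d \<notin> A"
  using ex_new_if_finite[OF infinite_UNIV_nat assms] by blast

context minimal_star_system
begin

lemma no_reduction_list:
  assumes X: "X \<subseteq> V" and split: "(\<Sum>v\<in>X. st v) = \<Sum>\<^sub># P + (mset rs + mset rs)"
    and sizes: "\<And>s. s \<in># P \<Longrightarrow> size s \<in> {1, 2, 3, 5}"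
    and few: "size (filter_mset (\<lambda>s. size s \<noteq> 2) P) < card X"
    and extend: "\<And>c :: 'e \<Rightarrow> nat. \<lbrakk>\<And>s. s \<in># P \<Longrightarrow> block_ok (image_mset c s); distinct rs;
        \<And>e. e \<in> set rs \<Longrightarrow> e \<notin># \<Sum>\<^sub># P\<rbrakk> \<Longrightarrow>
      \<exists>c'. (\<forall>e. e \<notin> set rs \<longrightarrow> c' e = c e) \<and> (\<forall>v\<in>X. four_one (image_mset c' (st v)))"
  shows False
proof (rule no_reduction[OF X split _ sizes few])
  show even: "even (count (mset rs + mset rs) e)" for e by simp
  \<comment> \<open>Every entry of \<open>rs\<close> enters the sum of stars twice, while each edge
    has total count at most 2.\<close>
  have "count (mset rs) e \<le> 1" for e
    using count_le_2[OF X, of e] by (simp add: split)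
  then have "distinct rs"
    by (metis One_nat_def count_mset_0_iff distinct_count_atmost_1 le_Suc_eq le_zero_eq)
  moreover have "e \<notin># \<Sum>\<^sub># P" if "e \<in> set rs" for e
    using removed_notin(1)[OF X split even] that by simp
  ultimately show "\<exists>c'. (\<forall>e. e \<notin># mset rs + mset rs \<longrightarrow> c' e = c e) \<and>
      (\<forall>v\<in>X. four_one (image_mset c' (st v)))"
    if "\<And>s. s \<in># P \<Longrightarrow> block_ok (image_mset c s)" for c :: "'e \<Rightarrow> nat"
    using extend[of c] that by auto
qed

text \<open>Removing \<open>X\<close> with its internal edges \<open>rs\<close> and joining the dangling edges in the given pairs
  leaves a smaller graph.\<close>

lemma no_pairing:
  assumes X: "X \<subseteq> V" "X \<noteq> {}"
    and split: "(\<Sum>v\<in>X. st v) = (\<Sum>(x, y)\<leftarrow>ps. {#x, y#}) + (mset rs + mset rs)"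
    and extend: "\<And>c :: 'e \<Rightarrow> nat. \<lbrakk>\<And>x y. (x, y) \<in> set ps \<Longrightarrow> c y = c x; distinct rs;
        \<And>x y. (x, y) \<in> set ps \<Longrightarrow> x \<notin> set rs \<and> y \<notin> set rs\<rbrakk> \<Longrightarrow>
      \<exists>c'. (\<forall>e. e \<notin> set rs \<longrightarrow> c' e = c e) \<and> (\<forall>v\<in>X. four_one (image_mset c' (st v)))"
  shows False
proof (rule no_reduction_list[OF X(1), of "mset (map (\<lambda>(x, y). {#x, y#}) ps)" rs])
  let ?P = "mset (map (\<lambda>(x, y). {#x, y#}) ps)"
  show "(\<Sum>v\<in>X. st v) = \<Sum>\<^sub># ?P + (mset rs + mset rs)"
    by (simp only: split sum_mset_sum_list)
  show "size s \<in> {1, 2, 3, 5}" if "s \<in># ?P" for s using that by auto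
  \<comment> \<open>Merged pairs contribute no vertices, so deleting a single vertex already makes
    the graph smaller.\<close>
  have "filter_mset (\<lambda>s. size s \<noteq> 2) ?P = {#}" by (induction ps) auto
  then have "size (filter_mset (\<lambda>s. size s \<noteq> 2) ?P) = 0" by (simp only: size_empty)
  moreover have "card X > 0" using X finite_V finite_subset by (auto simp: card_gt_0_iff)
  ultimately show "size (filter_mset (\<lambda>s. size s \<noteq> 2) ?P) < card X" by (simp only:)
  fix c :: "'e \<Rightarrow> nat"
  assume ok: "\<And>s. s \<in># ?P \<Longrightarrow> block_ok (image_mset c s)" and "distinct rs"
    and disj: "\<And>e. e \<in> set rs \<Longrightarrow> e \<notin># \<Sum>\<^sub># ?P"
  show "\<exists>c'. (\<forall>e. e \<notin> set rs \<longrightarrow> c' e = c e) \<and> (\<forall>v\<in>X. four_one (image_mset c' (st v)))"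
  proof (rule extend[OF _ \<open>distinct rs\<close>])
    fix x y assume xy: "(x, y) \<in> set ps"
    then have "{#x, y#} \<in># ?P" by force
    then show "c y = c x" using ok[of "{#x, y#}"] by (simp add: block_ok_pair)
    have "x \<in># \<Sum>\<^sub># ?P" "y \<in># \<Sum>\<^sub># ?P" using xy by force+
    then show "x \<notin> set rs \<and> y \<notin> set rs" using disj by blast
  qed
qed

text \<open>Joining \<open>x\<close> with \<open>y\<close> and \<open>x'\<close> with
  \<open>y'\<close> shows both vertices the same outside colors, so one coloring of the three
  parallel edges serves both.\<close>

lemma no_triple_edge_star:
  assumes V: "{u, v} \<subseteq> V" "distinct [u, v]"
    and st: "st u = {#f1, f2, f3, x, x'#}"
      "st v = {#f1, f2, f3, y, y'#}"
  shows False
proof -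
  let ?ps = "[(x, y), (x', y')]"
  let ?rs = "[f1, f2, f3]"
  show False
  proof (rule no_pairing[OF V(1), of ?ps ?rs])
    show "(\<Sum>v\<in>{u, v}. st v) = (\<Sum>(g, h)\<leftarrow>?ps. {#g, h#}) + (mset ?rs + mset ?rs)"
      using V(2) by (simp add: st add_mset_commute)
    fix col :: "'e \<Rightarrow> nat"
    assume eq: "\<And>g h. (g, h) \<in> set ?ps \<Longrightarrow> col h = col g"
      and dist: "distinct ?rs"
      and new: "\<And>g h. (g, h) \<in> set ?ps \<Longrightarrow> g \<notin> set ?rs \<and> h \<notin> set ?rs"
    have eq': "col y = col x" "col y' = col x'" by (simp_all add: eq)
    note new' = new[of x y] new[of x' y']
    obtain fresh where fresh: "fresh \<notin> {col x, col x'}"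
      by (rule ex_fresh_nat[of "{col x, col x'}"]) simp
    show "\<exists>c'. (\<forall>e. e \<notin> set ?rs \<longrightarrow> c' e = col e) \<and>
        (\<forall>v\<in>{u, v}. four_one (image_mset c' (st v)))"
    proof (cases "col x = col x'")
      case True
      then show ?thesis
        using eq' dist new' fresh
        by (intro exI[of _ "col(f1 := col x, f2 := col x, f3 := fresh)"])
          (simp add: st four_one_iff)
    next
      case False
      then show ?thesis
        using eq' dist new'
        by (intro exI[of _ "col(f1 := col x, f2 := col x, f3 := col x)"])
          (simp add: st four_one_iff)
    qed
  qed simp
qed

text \<open>Joining \<open>y2\<close> and \<open>y3\<close> makes their color occur twice at
  \<open>v\<close>. If \<open>e\<close> and \<open>y1\<close> have another color, they are the odd
  edges at \<open>u\<close> and \<open>v\<close>; otherwise \<open>f2\<close> becomes odd at both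
  ends.\<close>

lemma no_double_edge_at_loop_star:
  assumes V: "{u, v} \<subseteq> V" "distinct [u, v]"
    and st: "st u = {#l, l, f1, f2, e#}"
      "st v = {#f1, f2, y1, y2, y3#}"
  shows False
proof -
  let ?ps = "[(e, y1), (y2, y3)]"
  let ?rs = "[l, f1, f2]"
  show False
  proof (rule no_pairing[OF V(1), of ?ps ?rs])
    show "(\<Sum>v\<in>{u, v}. st v) = (\<Sum>(g, h)\<leftarrow>?ps. {#g, h#}) + (mset ?rs + mset ?rs)"
      using V(2) by (simp add: st add_mset_commute)
    fix col :: "'e \<Rightarrow> nat"
    assume eq: "\<And>g h. (g, h) \<in> set ?ps \<Longrightarrow> col h = col g"
      and dist: "distinct ?rs"
      and new: "\<And>g h. (g, h) \<in> set ?ps \<Longrightarrow> g \<notin> set ?rs \<and> h \<notin> set ?rs"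
    have eq': "col y1 = col e" "col y3 = col y2" by (simp_all add: eq)
    note new' = new[of e y1] new[of y2 y3]
    obtain fresh where fresh: "fresh \<notin> {col e, col y2}"
      by (rule ex_fresh_nat[of "{col e, col y2}"]) simp
    show "\<exists>c'. (\<forall>e. e \<notin> set ?rs \<longrightarrow> c' e = col e) \<and>
        (\<forall>v\<in>{u, v}. four_one (image_mset c' (st v)))"
    proof (cases "col e = col y2")
      case True
      then show ?thesis
        using eq' dist new' fresh
        by (intro exI[of _ "col(l := col e, f1 := col e, f2 := fresh)"])
          (simp add: st four_one_iff)
    next
      case False
      then show ?thesis
        using eq' dist new'
        by (intro exI[of _ "col(l := col y2, f1 := col y2, f2 := col y2)"])
          (simp add: st four_one_iff)
    qed
  qed simp
qed

text \<open>Each vertex has its two outer edges joined to each other, its loop continues their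
  color, and the edge \<open>f\<close> in a fresh color is odd at both ends.\<close>

lemma no_adjacent_loops_star:
  assumes V: "{u, v} \<subseteq> V" "distinct [u, v]"
    and st: "st u = {#l, l, f, x, x'#}"
      "st v = {#m, m, f, y, y'#}"
  shows False
proof -
  let ?ps = "[(x, x'), (y, y')]"
  let ?rs = "[l, f, m]"
  show False
  proof (rule no_pairing[OF V(1), of ?ps ?rs])
    show "(\<Sum>v\<in>{u, v}. st v) = (\<Sum>(g, h)\<leftarrow>?ps. {#g, h#}) + (mset ?rs + mset ?rs)"
      using V(2) by (simp add: st add_mset_commute)
    fix col :: "'e \<Rightarrow> nat"
    assume eq: "\<And>g h. (g, h) \<in> set ?ps \<Longrightarrow> col h = col g"
      and dist: "distinct ?rs"
      and new: "\<And>g h. (g, h) \<in> set ?ps \<Longrightarrow> g \<notin> set ?rs \<and> h \<notin> set ?rs"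
    have eq': "col x' = col x" "col y' = col y" by (simp_all add: eq)
    note new' = new[of x x'] new[of y y']
    obtain fresh where fresh: "fresh \<notin> {col x, col y}"
      by (rule ex_fresh_nat[of "{col x, col y}"]) simp
    show "\<exists>c'. (\<forall>e. e \<notin> set ?rs \<longrightarrow> c' e = col e) \<and>
        (\<forall>v\<in>{u, v}. four_one (image_mset c' (st v)))"
      using eq' dist new' fresh
      by (intro exI[of _ "col(l := col x, f := fresh, m := col y)"])
        (simp add: st four_one_iff)
  qed simp
qed

text \<open>At \<open>v1\<close>, \<open>v2\<close>, \<open>v3\<close> the joined outer edges double
  a color, so exactly two of the three inner edges must repeat it. At \<open>u1\<close>,
  \<open>u2\<close>, \<open>u3\<close> exactly two inner edges must agree, and the loop takes their
  color. The cases give 3 by 3 arrays with these row and column conditions, one for each pattern of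
  equal outside colors.\<close>

lemma no_K33_star:
  assumes V: "{u1, u2, u3, v1, v2, v3} \<subseteq> V" "distinct [u1, u2, u3, v1, v2, v3]"
    and st: "st u1 = {#l1, l1, f11, f12, f13#}"
      "st u2 = {#l2, l2, f21, f22, f23#}"
      "st u3 = {#l3, l3, f31, f32, f33#}"
      "st v1 = {#f11, f21, f31, y1, z1#}"
      "st v2 = {#f12, f22, f32, y2, z2#}"
      "st v3 = {#f13, f23, f33, y3, z3#}"
  shows False
proof -
  let ?ps = "[(y1, z1), (y2, z2), (y3, z3)]"
  let ?rs = "[l1, f11, f12, f13, l2, f21, f22, f23, l3, f31, f32, f33]"
  show False
  proof (rule no_pairing[OF V(1), of ?ps ?rs])
    show "(\<Sum>v\<in>{u1, u2, u3, v1, v2, v3}. st v) = (\<Sum>(g, h)\<leftarrow>?ps. {#g, h#}) + (mset ?rs + mset ?rs)"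
      using V(2) by (simp add: st add_mset_commute)
    fix col :: "'e \<Rightarrow> nat"
    assume eq: "\<And>g h. (g, h) \<in> set ?ps \<Longrightarrow> col h = col g"
      and dist: "distinct ?rs"
      and new: "\<And>g h. (g, h) \<in> set ?ps \<Longrightarrow> g \<notin> set ?rs \<and> h \<notin> set ?rs"
    have eq': "col z1 = col y1" "col z2 = col y2" "col z3 = col y3" by (simp_all add: eq)
    note new' = new[of y1 z1] new[of y2 z2] new[of y3 z3]
    obtain fresh where fresh: "fresh \<notin> {col y1, col y2, col y3}"
      by (rule ex_fresh_nat[of "{col y1, col y2, col y3}"]) simp
    consider "col y1 = col y2" "col y2 = col y3"
      | "col y1 = col y2" "col y2 \<noteq> col y3"
      | "col y1 = col y3" "col y2 \<noteq> col y3"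
      | "col y2 = col y3" "col y1 \<noteq> col y3"
      | "col y1 \<noteq> col y2" "col y1 \<noteq> col y3" "col y2 \<noteq> col y3"
      by metis
    then show "\<exists>c'. (\<forall>e. e \<notin> set ?rs \<longrightarrow> c' e = col e) \<and>
        (\<forall>v\<in>{u1, u2, u3, v1, v2, v3}. four_one (image_mset c' (st v)))"
    proof cases
      case 1
      then show ?thesis
        using eq' dist new' fresh
        by (intro exI[of _ "col(l1 := col y1, f11 := fresh, f12 := col y1, f13 := col y1, l2 := col y1,
            f21 := col y1, f22 := fresh, f23 := col y1, l3 := col y1,
            f31 := col y1, f32 := col y1, f33 := fresh)"])
          (simp add: st four_one_iff)
    next
      case 2
      then show ?thesis
        using eq' dist new' fresh
        by (intro exI[of _ "col(l1 := col y3, f11 := col y3, f12 := col y1, f13 := col y3,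
            l2 := col y3, f21 := col y1, f22 := col y3, f23 := col y3,
            l3 := col y1, f31 := col y1, f32 := col y1, f33 := fresh)"])
          (simp add: st four_one_iff)
    next
      case 3
      then show ?thesis
        using eq' dist new' fresh
        by (intro exI[of _ "col(l1 := col y2, f11 := col y2, f12 := col y2, f13 := col y1,
            l2 := col y1, f21 := col y1, f22 := fresh, f23 := col y1, l3 := col y2,
            f31 := col y1, f32 := col y2, f33 := col y2)"])
          (simp add: st four_one_iff)
    next
      case 4
      then show ?thesis
        using eq' dist new' fresh
        by (intro exI[of _ "col(l1 := col y1, f11 := col y1, f12 := col y2, f13 := col y1,
            l2 := col y1, f21 := col y1, f22 := col y1, f23 := col y2,
            l3 := col y2, f31 := fresh, f32 := col y2, f33 := col y2)"])
          (simp add: st four_one_iff)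
    next
      case 5
      then show ?thesis
        using eq' dist new'
        by (intro exI[of _ "col(l1 := col y2, f11 := col y2, f12 := col y2, f13 := col y3,
            l2 := col y1, f21 := col y1, f22 := col y1, f23 := col y3,
            l3 := col y1, f31 := col y1, f32 := col y2, f33 := col y1)"])
          (simp add: st four_one_iff)
    qed
  qed simp
qed

text \<open>The lemmas \<open>no_dense4\<close> cover the four-vertex configurations with eight edges that survive
  the other reductions: A without loops, B1 and B2 with a vertex having two loops, C1 to C4 with a
  vertex having one loop, and E1 and E2 with two vertices having loops.\<close>

lemma no_dense4_A:
  assumes V: "{a, b, c, d} \<subseteq> V" "distinct [a, b, c, d]"
    and st: "st a = {#k1, k2, p, q, x#}"
      "st b = {#k1, k2, m1, m2, r#}"
      "st c = {#m1, m2, p, s, y#}"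
      "st d = {#q, r, s, z, z'#}"
  shows False
proof -
  let ?ps = "[(x, z), (y, z')]"
  let ?rs = "[k1, k2, p, q, m1, m2, r, s]"
  show False
  proof (rule no_pairing[OF V(1), of ?ps ?rs])
    show "(\<Sum>v\<in>{a, b, c, d}. st v) = (\<Sum>(g, h)\<leftarrow>?ps. {#g, h#}) + (mset ?rs + mset ?rs)"
      using V(2) by (simp add: st add_mset_commute)
    fix col :: "'e \<Rightarrow> nat"
    assume eq: "\<And>g h. (g, h) \<in> set ?ps \<Longrightarrow> col h = col g"
      and dist: "distinct ?rs"
      and new: "\<And>g h. (g, h) \<in> set ?ps \<Longrightarrow> g \<notin> set ?rs \<and> h \<notin> set ?rs"
    have eq': "col z = col x" "col z' = col y" by (simp_all add: eq)
    note new' = new[of x z] new[of y z']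
    obtain fresh where fresh: "fresh \<notin> {col x, col y}"
      by (rule ex_fresh_nat[of "{col x, col y}"]) simp
    show "\<exists>c'. (\<forall>e. e \<notin> set ?rs \<longrightarrow> c' e = col e) \<and>
        (\<forall>v\<in>{a, b, c, d}. four_one (image_mset c' (st v)))"
    proof (cases "col x = col y")
      \<comment> \<open>With equal outside colors the fresh color goes on a perfect matching of the
        four vertices, here \<open>k1\<close> and \<open>s\<close>, and all other inner edges
        continue the outside color. The later configurations of this group do the same.\<close>
      case True
      then show ?thesis
        using eq' dist new' fresh
        by (intro exI[of _ "col(k1 := fresh, k2 := col x, p := col x, q := col x, m1 := col x,
            m2 := col x, r := col x, s := fresh)"])
          (simp add: st four_one_iff)
    next
      \<comment> \<open>With \<open>col x\<close> on all inner edges only \<open>a\<close> and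
        \<open>b\<close> would lack an odd edge, so the edge \<open>k1\<close> between them gets
        another color. B1 to C3 follow this pattern: the single edge in the fresh color joins the
        two vertices that would otherwise see one color only.\<close>
      case False
      then show ?thesis
        using eq' dist new'
        by (intro exI[of _ "col(k1 := col y, k2 := col x, p := col x, q := col x, m1 := col x,
            m2 := col x, r := col x, s := col x)"])
          (simp add: st four_one_iff)
    qed
  qed simp
qed

lemma no_dense4_B1:
  assumes V: "{p, a, b, c} \<subseteq> V" "distinct [p, a, b, c]"
    and st: "st p = {#l, l, l', l', t#}"
      "st a = {#k1, k2, s, x, x'#}"
      "st b = {#k1, k2, m1, m2, t#}"
      "st c = {#m1, m2, s, y, y'#}"
  shows False
proof -
  let ?ps = "[(x, y), (x', y')]"
  let ?rs = "[l, l', t, k1, k2, s, m1, m2]"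
  show False
  proof (rule no_pairing[OF V(1), of ?ps ?rs])
    show "(\<Sum>v\<in>{p, a, b, c}. st v) = (\<Sum>(g, h)\<leftarrow>?ps. {#g, h#}) + (mset ?rs + mset ?rs)"
      using V(2) by (simp add: st add_mset_commute)
    fix col :: "'e \<Rightarrow> nat"
    assume eq: "\<And>g h. (g, h) \<in> set ?ps \<Longrightarrow> col h = col g"
      and dist: "distinct ?rs"
      and new: "\<And>g h. (g, h) \<in> set ?ps \<Longrightarrow> g \<notin> set ?rs \<and> h \<notin> set ?rs"
    have eq': "col y = col x" "col y' = col x'" by (simp_all add: eq)
    note new' = new[of x y] new[of x' y']
    obtain fresh where fresh: "fresh \<notin> {col x, col x'}"
      by (rule ex_fresh_nat[of "{col x, col x'}"]) simp
    show "\<exists>c'. (\<forall>e. e \<notin> set ?rs \<longrightarrow> c' e = col e) \<and>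
        (\<forall>v\<in>{p, a, b, c}. four_one (image_mset c' (st v)))"
    proof (cases "col x = col x'")
      case True
      then show ?thesis
        using eq' dist new' fresh
        by (intro exI[of _ "col(l := col x, l' := col x, t := fresh, k1 := col x, k2 := col x,
            s := fresh, m1 := col x, m2 := col x)"])
          (simp add: st four_one_iff)
    next
      case False
      then show ?thesis
        using eq' dist new' fresh
        by (intro exI[of _ "col(l := col x, l' := col x, t := fresh, k1 := col x, k2 := col x,
            s := col x, m1 := col x, m2 := col x)"])
          (simp add: st four_one_iff)
    qed
  qed simp
qed

lemma no_dense4_B2:
  assumes V: "{p, a, b, c} \<subseteq> V" "distinct [p, a, b, c]"
    and st: "st p = {#l, l, l', l', t#}"
      "st a = {#t, k1, k2, s, x#}"
      "st b = {#k1, k2, m1, m2, y#}"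
      "st c = {#m1, m2, s, z, z'#}"
  shows False
proof -
  let ?ps = "[(x, z), (y, z')]"
  let ?rs = "[l, l', t, k1, k2, s, m1, m2]"
  show False
  proof (rule no_pairing[OF V(1), of ?ps ?rs])
    show "(\<Sum>v\<in>{p, a, b, c}. st v) = (\<Sum>(g, h)\<leftarrow>?ps. {#g, h#}) + (mset ?rs + mset ?rs)"
      using V(2) by (simp add: st add_mset_commute)
    fix col :: "'e \<Rightarrow> nat"
    assume eq: "\<And>g h. (g, h) \<in> set ?ps \<Longrightarrow> col h = col g"
      and dist: "distinct ?rs"
      and new: "\<And>g h. (g, h) \<in> set ?ps \<Longrightarrow> g \<notin> set ?rs \<and> h \<notin> set ?rs"
    have eq': "col z = col x" "col z' = col y" by (simp_all add: eq)
    note new' = new[of x z] new[of y z']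
    obtain fresh where fresh: "fresh \<notin> {col x, col y}"
      by (rule ex_fresh_nat[of "{col x, col y}"]) simp
    show "\<exists>c'. (\<forall>e. e \<notin> set ?rs \<longrightarrow> c' e = col e) \<and>
        (\<forall>v\<in>{p, a, b, c}. four_one (image_mset c' (st v)))"
    proof (cases "col x = col y")
      case True
      then show ?thesis
        using eq' dist new' fresh
        by (intro exI[of _ "col(l := col x, l' := col x, t := fresh, k1 := col x, k2 := col x,
            s := col x, m1 := fresh, m2 := col x)"])
          (simp add: st four_one_iff)
    next
      case False
      then show ?thesis
        using eq' dist new' fresh
        by (intro exI[of _ "col(l := col x, l' := col x, t := fresh, k1 := col x, k2 := col x,
            s := col x, m1 := col x, m2 := col x)"])
          (simp add: st four_one_iff)
    qed
  qed simp
qed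

lemma no_dense4_C1:
  assumes V: "{p, a, b, c} \<subseteq> V" "distinct [p, a, b, c]"
    and st: "st p = {#l, l, t1, t2, t3#}"
      "st a = {#t1, k1, k2, s, x#}"
      "st b = {#t2, k1, k2, r, y#}"
      "st c = {#t3, r, s, z, z'#}"
  shows False
proof -
  let ?ps = "[(x, z), (y, z')]"
  let ?rs = "[l, t1, t2, t3, k1, k2, s, r]"
  show False
  proof (rule no_pairing[OF V(1), of ?ps ?rs])
    show "(\<Sum>v\<in>{p, a, b, c}. st v) = (\<Sum>(g, h)\<leftarrow>?ps. {#g, h#}) + (mset ?rs + mset ?rs)"
      using V(2) by (simp add: st add_mset_commute)
    fix col :: "'e \<Rightarrow> nat"
    assume eq: "\<And>g h. (g, h) \<in> set ?ps \<Longrightarrow> col h = col g"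
      and dist: "distinct ?rs"
      and new: "\<And>g h. (g, h) \<in> set ?ps \<Longrightarrow> g \<notin> set ?rs \<and> h \<notin> set ?rs"
    have eq': "col z = col x" "col z' = col y" by (simp_all add: eq)
    note new' = new[of x z] new[of y z']
    obtain fresh where fresh: "fresh \<notin> {col x, col y}"
      by (rule ex_fresh_nat[of "{col x, col y}"]) simp
    show "\<exists>c'. (\<forall>e. e \<notin> set ?rs \<longrightarrow> c' e = col e) \<and>
        (\<forall>v\<in>{p, a, b, c}. four_one (image_mset c' (st v)))"
    proof (cases "col x = col y")
      case True
      then show ?thesis
        using eq' dist new' fresh
        by (intro exI[of _ "col(l := col x, t1 := col x, t2 := col x, t3 := fresh, k1 := fresh,
            k2 := col x, s := col x, r := col x)"])
          (simp add: st four_one_iff)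
    next
      case False
      then show ?thesis
        using eq' dist new' fresh
        by (intro exI[of _ "col(l := col x, t1 := fresh, t2 := col x, t3 := col x, k1 := col x,
            k2 := col x, s := col x, r := col x)"])
          (simp add: st four_one_iff)
    qed
  qed simp
qed

lemma no_dense4_C2:
  assumes V: "{p, a, b, c} \<subseteq> V" "distinct [p, a, b, c]"
    and st: "st p = {#l, l, t1, t2, t3#}"
      "st a = {#t1, k1, k2, x, x'#}"
      "st b = {#t2, k1, k2, m1, m2#}"
      "st c = {#t3, m1, m2, y, y'#}"
  shows False
proof -
  let ?ps = "[(x, y), (x', y')]"
  let ?rs = "[l, t1, t2, t3, k1, k2, m1, m2]"
  show False
  proof (rule no_pairing[OF V(1), of ?ps ?rs])
    show "(\<Sum>v\<in>{p, a, b, c}. st v) = (\<Sum>(g, h)\<leftarrow>?ps. {#g, h#}) + (mset ?rs + mset ?rs)"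
      using V(2) by (simp add: st add_mset_commute)
    fix col :: "'e \<Rightarrow> nat"
    assume eq: "\<And>g h. (g, h) \<in> set ?ps \<Longrightarrow> col h = col g"
      and dist: "distinct ?rs"
      and new: "\<And>g h. (g, h) \<in> set ?ps \<Longrightarrow> g \<notin> set ?rs \<and> h \<notin> set ?rs"
    have eq': "col y = col x" "col y' = col x'" by (simp_all add: eq)
    note new' = new[of x y] new[of x' y']
    obtain fresh where fresh: "fresh \<notin> {col x, col x'}"
      by (rule ex_fresh_nat[of "{col x, col x'}"]) simp
    show "\<exists>c'. (\<forall>e. e \<notin> set ?rs \<longrightarrow> c' e = col e) \<and>
        (\<forall>v\<in>{p, a, b, c}. four_one (image_mset c' (st v)))"
    proof (cases "col x = col x'")
      case True
      then show ?thesis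
        using eq' dist new' fresh
        by (intro exI[of _ "col(l := col x, t1 := fresh, t2 := col x, t3 := col x, k1 := col x,
            k2 := col x, m1 := fresh, m2 := col x)"])
          (simp add: st four_one_iff)
    next
      case False
      then show ?thesis
        using eq' dist new' fresh
        by (intro exI[of _ "col(l := col x, t1 := col x, t2 := fresh, t3 := col x, k1 := col x,
            k2 := col x, m1 := col x, m2 := col x)"])
          (simp add: st four_one_iff)
    qed
  qed simp
qed

lemma no_dense4_C3:
  assumes V: "{p, a, b, c} \<subseteq> V" "distinct [p, a, b, c]"
    and st: "st p = {#l, l, t1, t2, e#}"
      "st a = {#t1, k1, k2, s, x#}"
      "st b = {#t2, k1, k2, m1, m2#}"
      "st c = {#m1, m2, s, y, y'#}"
  shows False
proof -
  let ?ps = "[(e, y), (x, y')]"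
  let ?rs = "[l, t1, t2, k1, k2, s, m1, m2]"
  show False
  proof (rule no_pairing[OF V(1), of ?ps ?rs])
    show "(\<Sum>v\<in>{p, a, b, c}. st v) = (\<Sum>(g, h)\<leftarrow>?ps. {#g, h#}) + (mset ?rs + mset ?rs)"
      using V(2) by (simp add: st add_mset_commute)
    fix col :: "'e \<Rightarrow> nat"
    assume eq: "\<And>g h. (g, h) \<in> set ?ps \<Longrightarrow> col h = col g"
      and dist: "distinct ?rs"
      and new: "\<And>g h. (g, h) \<in> set ?ps \<Longrightarrow> g \<notin> set ?rs \<and> h \<notin> set ?rs"
    have eq': "col y = col e" "col y' = col x" by (simp_all add: eq)
    note new' = new[of e y] new[of x y']
    obtain fresh where fresh: "fresh \<notin> {col e, col x}"
      by (rule ex_fresh_nat[of "{col e, col x}"]) simp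
    show "\<exists>c'. (\<forall>e. e \<notin> set ?rs \<longrightarrow> c' e = col e) \<and>
        (\<forall>v\<in>{p, a, b, c}. four_one (image_mset c' (st v)))"
    proof (cases "col e = col x")
      case True
      then show ?thesis
        using eq' dist new' fresh
        by (intro exI[of _ "col(l := col e, t1 := fresh, t2 := col e, k1 := col e, k2 := col e,
            s := col e, m1 := fresh, m2 := col e)"])
          (simp add: st four_one_iff)
    next
      case False
      then show ?thesis
        using eq' dist new' fresh
        by (intro exI[of _ "col(l := col e, t1 := col e, t2 := fresh, k1 := col e, k2 := col e,
            s := col e, m1 := col e, m2 := col e)"])
          (simp add: st four_one_iff)
    qed
  qed simp
qed

lemma no_dense4_C4:
  assumes V: "{p, a, b, c} \<subseteq> V" "distinct [p, a, b, c]"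
    and st: "st p = {#l, l, t1, t3, e#}"
      "st a = {#t1, k1, k2, s, x#}"
      "st b = {#k1, k2, m1, m2, y#}"
      "st c = {#t3, m1, m2, s, z#}"
  shows False
proof -
  let ?ps = "[(e, y), (x, z)]"
  let ?rs = "[l, t1, t3, k1, k2, s, m1, m2]"
  show False
  proof (rule no_pairing[OF V(1), of ?ps ?rs])
    show "(\<Sum>v\<in>{p, a, b, c}. st v) = (\<Sum>(g, h)\<leftarrow>?ps. {#g, h#}) + (mset ?rs + mset ?rs)"
      using V(2) by (simp add: st add_mset_commute)
    fix col :: "'e \<Rightarrow> nat"
    assume eq: "\<And>g h. (g, h) \<in> set ?ps \<Longrightarrow> col h = col g"
      and dist: "distinct ?rs"
      and new: "\<And>g h. (g, h) \<in> set ?ps \<Longrightarrow> g \<notin> set ?rs \<and> h \<notin> set ?rs"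
    have eq': "col y = col e" "col z = col x" by (simp_all add: eq)
    note new' = new[of e y] new[of x z]
    obtain fresh where fresh: "fresh \<notin> {col e, col x}"
      by (rule ex_fresh_nat[of "{col e, col x}"]) simp
    show "\<exists>c'. (\<forall>e. e \<notin> set ?rs \<longrightarrow> c' e = col e) \<and>
        (\<forall>v\<in>{p, a, b, c}. four_one (image_mset c' (st v)))"
    proof (cases "col e = col x")
      case True
      then show ?thesis
        using eq' dist new' fresh
        by (intro exI[of _ "col(l := col e, t1 := fresh, t3 := col e, k1 := col e, k2 := col e,
            s := col e, m1 := fresh, m2 := col e)"])
          (simp add: st four_one_iff)
    next
      \<comment> \<open>\<open>p\<close> follows \<open>col e\<close>, and the other three vertices
        follow \<open>col x\<close>. The odd edges are \<open>t3\<close> at both of its ends,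
        \<open>t1\<close> at \<open>a\<close> and \<open>y\<close> at \<open>b\<close>.\<close>
      case False
      then show ?thesis
        using eq' dist new' fresh
        by (intro exI[of _ "col(l := col e, t1 := col e, t3 := fresh, k1 := col x, k2 := col x,
            s := col x, m1 := col x, m2 := col x)"])
          (simp add: st four_one_iff)
    qed
  qed simp
qed

lemma no_dense4_E1:
  assumes V: "{p, q, a, b} \<subseteq> V" "distinct [p, q, a, b]"
    and st: "st p = {#l, l, t1, t2, e#}"
      "st q = {#l', l', r1, r2, e'#}"
      "st a = {#t1, r1, k1, k2, x#}"
      "st b = {#t2, r2, k1, k2, y#}"
  shows False
proof -
  let ?ps = "[(e, e'), (x, y)]"
  let ?rs = "[l, t1, t2, l', r1, r2, k1, k2]"
  show False
  proof (rule no_pairing[OF V(1), of ?ps ?rs])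
    show "(\<Sum>v\<in>{p, q, a, b}. st v) = (\<Sum>(g, h)\<leftarrow>?ps. {#g, h#}) + (mset ?rs + mset ?rs)"
      using V(2) by (simp add: st add_mset_commute)
    fix col :: "'e \<Rightarrow> nat"
    assume eq: "\<And>g h. (g, h) \<in> set ?ps \<Longrightarrow> col h = col g"
      and dist: "distinct ?rs"
      and new: "\<And>g h. (g, h) \<in> set ?ps \<Longrightarrow> g \<notin> set ?rs \<and> h \<notin> set ?rs"
    have eq': "col e' = col e" "col y = col x" by (simp_all add: eq)
    note new' = new[of e e'] new[of x y]
    obtain fresh where fresh: "fresh \<notin> {col e, col x}"
      by (rule ex_fresh_nat[of "{col e, col x}"]) simp
    show "\<exists>c'. (\<forall>e. e \<notin> set ?rs \<longrightarrow> c' e = col e) \<and>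
        (\<forall>v\<in>{p, q, a, b}. four_one (image_mset c' (st v)))"
    proof (cases "col e = col x")
      case True
      then show ?thesis
        using eq' dist new' fresh
        by (intro exI[of _ "col(l := col e, t1 := fresh, t2 := col e, l' := col e, r1 := col e,
            r2 := fresh, k1 := col e, k2 := col e)"])
          (simp add: st four_one_iff)
    next
      \<comment> \<open>\<open>p\<close> and \<open>q\<close> follow \<open>col e\<close>, while
        \<open>a\<close> and \<open>b\<close> follow \<open>col x\<close>. The four edges between
        these pairs split into two perfect matchings, one in each color, so each vertex gets one odd
        edge.\<close>
      case False
      then show ?thesis
        using eq' dist new'
        by (intro exI[of _ "col(l := col e, t1 := col e, t2 := col x, l' := col e, r1 := col x,
            r2 := col e, k1 := col x, k2 := col x)"])
          (simp add: st four_one_iff)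
    qed
  qed simp
qed

lemma no_dense4_E2:
  assumes V: "{p, q, a, b} \<subseteq> V" "distinct [p, q, a, b]"
    and st: "st p = {#l, l, l', l', t#}"
      "st q = {#m, m, r1, r2, e#}"
      "st a = {#t, r1, k1, k2, x#}"
      "st b = {#r2, k1, k2, y, y'#}"
  shows False
proof -
  let ?ps = "[(e, y), (x, y')]"
  let ?rs = "[l, l', t, m, r1, r2, k1, k2]"
  show False
  proof (rule no_pairing[OF V(1), of ?ps ?rs])
    show "(\<Sum>v\<in>{p, q, a, b}. st v) = (\<Sum>(g, h)\<leftarrow>?ps. {#g, h#}) + (mset ?rs + mset ?rs)"
      using V(2) by (simp add: st add_mset_commute)
    fix col :: "'e \<Rightarrow> nat"
    assume eq: "\<And>g h. (g, h) \<in> set ?ps \<Longrightarrow> col h = col g"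
      and dist: "distinct ?rs"
      and new: "\<And>g h. (g, h) \<in> set ?ps \<Longrightarrow> g \<notin> set ?rs \<and> h \<notin> set ?rs"
    have eq': "col y = col e" "col y' = col x" by (simp_all add: eq)
    note new' = new[of e y] new[of x y']
    obtain fresh where fresh: "fresh \<notin> {col e, col x}"
      by (rule ex_fresh_nat[of "{col e, col x}"]) simp
    show "\<exists>c'. (\<forall>e. e \<notin> set ?rs \<longrightarrow> c' e = col e) \<and>
        (\<forall>v\<in>{p, q, a, b}. four_one (image_mset c' (st v)))"
    proof (cases "col e = col x")
      case True
      then show ?thesis
        using eq' dist new' fresh
        by (intro exI[of _ "col(l := col e, l' := col e, t := fresh, m := col e, r1 := col e,
            r2 := fresh, k1 := col e, k2 := col e)"])
          (simp add: st four_one_iff)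
    next
      \<comment> \<open>\<open>t\<close> takes \<open>col x\<close> as the odd edge at
        \<open>p\<close>, whose loops are then free to be fresh. \<open>q\<close> follows
        \<open>col e\<close>, while \<open>a\<close> and \<open>b\<close> follow
        \<open>col x\<close>.\<close>
      case False
      then show ?thesis
        using eq' dist new' fresh
        by (intro exI[of _ "col(l := fresh, l' := fresh, t := col x, m := col e, r1 := col e,
            r2 := col x, k1 := col x, k2 := col x)"])
          (simp add: st four_one_iff)
    qed
  qed simp
qed

text \<open>Two loops are a 4-regular graph at one vertex. With the loops in a fresh color the outer
  edge is odd, whatever its color.\<close>

lemma no_two_double_loops_star:
  assumes V: "{p, q} \<subseteq> V" "distinct [p, q]"
    and st: "st p = {#l, l, l', l', x#}"
      "st q = {#m, m, m', m', y#}"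
  shows False
proof -
  let ?ps = "[(x, y)]"
  let ?rs = "[l, l', m, m']"
  show False
  proof (rule no_pairing[OF V(1), of ?ps ?rs])
    show "(\<Sum>v\<in>{p, q}. st v) = (\<Sum>(g, h)\<leftarrow>?ps. {#g, h#}) + (mset ?rs + mset ?rs)"
      using V(2) by (simp add: st add_mset_commute)
    fix col :: "'e \<Rightarrow> nat"
    assume eq: "\<And>g h. (g, h) \<in> set ?ps \<Longrightarrow> col h = col g"
      and dist: "distinct ?rs"
      and new: "\<And>g h. (g, h) \<in> set ?ps \<Longrightarrow> g \<notin> set ?rs \<and> h \<notin> set ?rs"
    have eq': "col y = col x" by (simp_all add: eq)
    note new' = new[of x y]
    obtain fresh where fresh: "fresh \<notin> {col x}" by (rule ex_fresh_nat[of "{col x}"]) simp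
    show "\<exists>c'. (\<forall>e. e \<notin> set ?rs \<longrightarrow> c' e = col e) \<and>
        (\<forall>v\<in>{p, q}. four_one (image_mset c' (st v)))"
      using eq' dist new' fresh
      by (intro exI[of _ "col(l := fresh, l' := fresh, m := fresh, m' := fresh)"])
        (simp add: st four_one_iff)
  qed simp
qed

text \<open>The inner edges form a 4-regular graph on four vertices, so one fresh color on all of
  them suffices.\<close>

lemma no_doubled_K4_star:
  assumes V: "{a, b, c, d} \<subseteq> V" "distinct [a, b, c, d]"
    and st: "st a = {#k1, k2, p, q, x#}"
      "st b = {#k1, k2, r, s, y#}"
      "st c = {#n1, n2, p, r, z#}"
      "st d = {#n1, n2, q, s, w#}"
  shows False
proof -
  let ?ps = "[(x, y), (z, w)]"
  let ?rs = "[k1, k2, p, q, r, s, n1, n2]"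
  show False
  proof (rule no_pairing[OF V(1), of ?ps ?rs])
    show "(\<Sum>v\<in>{a, b, c, d}. st v) = (\<Sum>(g, h)\<leftarrow>?ps. {#g, h#}) + (mset ?rs + mset ?rs)"
      using V(2) by (simp add: st add_mset_commute)
    fix col :: "'e \<Rightarrow> nat"
    assume eq: "\<And>g h. (g, h) \<in> set ?ps \<Longrightarrow> col h = col g"
      and dist: "distinct ?rs"
      and new: "\<And>g h. (g, h) \<in> set ?ps \<Longrightarrow> g \<notin> set ?rs \<and> h \<notin> set ?rs"
    have eq': "col y = col x" "col w = col z" by (simp_all add: eq)
    note new' = new[of x y] new[of z w]
    obtain fresh where fresh: "fresh \<notin> {col x, col z}"
      by (rule ex_fresh_nat[of "{col x, col z}"]) simp
    show "\<exists>c'. (\<forall>e. e \<notin> set ?rs \<longrightarrow> c' e = col e) \<and>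
        (\<forall>v\<in>{a, b, c, d}. four_one (image_mset c' (st v)))"
      using eq' dist new' fresh
      by (intro exI[of _ "col(k1 := fresh, k2 := fresh, p := fresh, q := fresh, r := fresh,
            s := fresh, n1 := fresh, n2 := fresh)"])
        (simp add: st four_one_iff)
  qed simp
qed

end

text \<open>Of two different colors in a star one is the odd color and the other the fourfold one.
  The odd one can be replaced by \<open>g\<close>, which differs from both.\<close>

lemma four_one_recolor:
  assumes "four_one ({#a, b#} + M)" "a \<noteq> b" "g \<notin> {a, b}"
  shows "\<exists>x y. four_one ({#x, y#} + M) \<and> (x = g) \<noteq> (y = g)"
proof -
  obtain x y where "{#a, b#} + M = {#x, x, x, x, y#}" using assms(1) by (auto simp: four_one_def)
  then have "size ({#a, b#} + M) = size {#x, x, x, x, y#}" by (rule arg_cong)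
  then have "size M = 3" by simp
  then obtain p N where "M = add_mset p N" "size N = 2"
    using size_eq_Suc_D[of M 2] by auto
  then obtain q r where "M = {#p, q, r#}" using size_2_D by blast
  then have "four_one ({#a, g#} + M) \<or> four_one ({#g, b#} + M)"
    using assms by (auto simp: four_one_iff)
  then show ?thesis
  proof
    assume "four_one ({#a, g#} + M)"
    then show ?thesis using assms(3) by (intro exI[of _ a] exI[of _ g]) auto
  next
    assume "four_one ({#g, b#} + M)"
    then show ?thesis using assms(3) by (intro exI[of _ g] exI[of _ b]) auto
  qed
qed

lemma in_sum_multiset:
  "finite A \<Longrightarrow> e \<in># sum f A \<longleftrightarrow> (\<exists>x\<in>A. e \<in># f x)"
  by (induction A rule: finite_induct) auto

lemma ex_pair_partition:
  fixes M :: "'a multiset"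
  shows "\<exists>P. \<Sum>\<^sub># P = M \<and> (\<forall>s\<in>#P. size s \<in> {1, 2}) \<and> size (filter_mset (\<lambda>s. size s \<noteq> 2) P) \<le> 1"
proof (induction "size M" arbitrary: M rule: less_induct)
  case less
  consider "size M = 0" | "size M = 1" | n where "size M = Suc (Suc n)"
    by (metis One_nat_def not0_implies_Suc)
  then show ?case
  proof cases
    case 1
    then show ?thesis by (intro exI[of _ "{#}"]) simp
  next
    case 2
    then show ?thesis by (intro exI[of _ "{#M#}"]) simp
  next
    case (3 n)
    then obtain a N where N: "M = add_mset a N" "size N = Suc n" using size_eq_Suc_D by blast
    then obtain b L where L: "N = add_mset b L" "size L = n" using size_eq_Suc_D by blast
    then obtain P where P: "\<Sum>\<^sub># P = L" "\<forall>s\<in>#P. size s \<in> {1, 2}"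
        "size (filter_mset (\<lambda>s. size s \<noteq> 2) P) \<le> 1"
      using less[of L] N by auto
    then show ?thesis using N L by (intro exI[of _ "add_mset {#a, b#} P"]) simp
  qed
qed

section \<open>Reductions with an odd dangling edge or with recolored outer edges\<close>

context minimal_star_system
begin

text \<open>Every vertex of \<open>X\<close> keeps one further edge. These edges are paired
  arbitrarily, at most one remaining for a vertex with two loops, which is still a reduction because
  \<open>X\<close> has two vertices. A fresh color on the 4-regular part makes the further edges
  odd.\<close>

lemma no_4_regular_part:
  assumes X: "X \<subseteq> V" "2 \<le> card X"
    and h: "\<And>v. v \<in> X \<Longrightarrow> h v \<subseteq># st v" "\<And>v. v \<in> X \<Longrightarrow> size (h v) = 4"
    and even: "\<And>e. even (count (\<Sum>v\<in>X. h v) e)"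
  shows False
proof -
  have "\<exists>a. st v = add_mset a (h v)" if v: "v \<in> X" for v
  proof -
    have "size (st v - h v) = 1" using h[OF v] size_st X(1) v by (subst size_Diff_submset) auto
    then obtain a where "st v - h v = {#a#}" using size_1_singleton_mset by blast
    then have "st v = add_mset a (h v)" using h(1)[OF v]
      by (metis add_mset_add_single subset_mset.diff_add union_commute)
    then show ?thesis by blast
  qed
  then obtain a where a: "\<And>v. v \<in> X \<Longrightarrow> st v = add_mset (a v) (h v)" by metis
  obtain P where P: "\<Sum>\<^sub># P = (\<Sum>v\<in>X. {#a v#})" "\<forall>s\<in>#P. size s \<in> {1, 2}"
      "size (filter_mset (\<lambda>s. size s \<noteq> 2) P) \<le> 1"
    using ex_pair_partition by blast
  have finX: "finite X" using X finite_V finite_subset by blast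
  let ?R = "\<Sum>v\<in>X. h v"
  have split: "(\<Sum>v\<in>X. st v) = \<Sum>\<^sub># P + ?R" by (simp add: P(1) a sum.distrib[symmetric])
  show False
  proof (rule no_reduction[OF X(1) split even])
    show "size s \<in> {1, 2, 3, 5}" if "s \<in># P" for s using P(2) that by auto
    show "size (filter_mset (\<lambda>s. size s \<noteq> 2) P) < card X" using P(3) X(2) by simp
    fix c :: "'e \<Rightarrow> nat"
    obtain d where d: "d \<notin> (c \<circ> a) ` X" using ex_fresh_nat[of "(c \<circ> a) ` X"] finX by blast
    define c' where "c' e = (if e \<in># ?R then d else c e)" for e
    have "four_one (image_mset c' (st v))" if v: "v \<in> X" for v
    proof -
      have "a v \<in># \<Sum>\<^sub># P" unfolding P(1) using v finX by (auto simp: in_sum_multiset)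
      then have "a v \<notin># ?R" using removed_notin(1)[OF X(1) split even] by blast
      moreover have "image_mset c' (h v) = image_mset (\<lambda>_. d) (h v)"
        using v finX by (intro image_mset_cong) (auto simp: c'_def in_sum_multiset)
      then have "image_mset c' (h v) = {#d, d, d, d#}"
        by (simp add: image_mset_const_eq h(2)[OF v] numeral_eq_Suc)
      moreover have "d \<noteq> c (a v)" using d v by auto
      ultimately show ?thesis using v by (simp add: a c'_def four_one_iff)
    qed
    then show "\<exists>c'. (\<forall>e. e \<notin># ?R \<longrightarrow> c' e = c e) \<and> (\<forall>v\<in>X. four_one (image_mset c' (st v)))"
      by (intro exI[of _ c']) (simp add: c'_def)
  qed
qed

text \<open>A doubled triangle is 4-regular; this instance is recorded for the analysis of four
  vertices.\<close>

lemma no_double_triangle_star: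
  assumes V: "{a, b, c} \<subseteq> V" "distinct [a, b, c]"
    and st: "st a = {#k1, k2, s1, s2, x#}" "st b = {#k1, k2, m1, m2, y#}" "st c = {#m1, m2, s1, s2, z#}"
  shows False
proof -
  let ?h = "\<lambda>v. if v = a then {#k1, k2, s1, s2#} else if v = b then {#k1, k2, m1, m2#} else {#m1, m2, s1, s2#}"
  have sum: "(\<Sum>v\<in>{a, b, c}. ?h v) = mset [k1, k2, s1, s2, m1, m2] + mset [k1, k2, s1, s2, m1, m2]"
    using V(2) by (auto simp: add_mset_commute)
  show False
  proof (rule no_4_regular_part[of "{a, b, c}" ?h])
    show "even (count (\<Sum>v\<in>{a, b, c}. ?h v) e)" for e unfolding sum count_union by simp
    show "?h v \<subseteq># st v" if "v \<in> {a, b, c}" for v using that V(2) by (auto simp: st)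
  qed (use V in auto)
qed

text \<open>The unpaired edge \<open>e\<close> costs one vertex against five deleted ones. The four
  edges from \<open>v\<close> to the loop vertices get one fresh color: they are the fourfold color
  at \<open>v\<close> and odd at the loop vertices, where the loop continues the color of the joined
  outer edges.\<close>

lemma no_4_loops_around_star:
  assumes V: "{v, u1, u2, u3, u4} \<subseteq> V" "distinct [v, u1, u2, u3, u4]"
    and st: "st v = {#f1, f2, f3, f4, e#}"
      "st u1 = {#l1, l1, f1, x1, z1#}" "st u2 = {#l2, l2, f2, x2, z2#}"
      "st u3 = {#l3, l3, f3, x3, z3#}" "st u4 = {#l4, l4, f4, x4, z4#}"
  shows False
proof -
  let ?P = "{#{#e#}, {#x1, z1#}, {#x2, z2#}, {#x3, z3#}, {#x4, z4#}#}"
  let ?rs = "[f1, f2, f3, f4, l1, l2, l3, l4]"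
  show False
  proof (rule no_reduction_list[OF V(1), of ?P ?rs])
    show "(\<Sum>v\<in>{v, u1, u2, u3, u4}. st v) = \<Sum>\<^sub># ?P + (mset ?rs + mset ?rs)"
      using V(2) by (simp add: st add_mset_commute)
    show "size (filter_mset (\<lambda>s. size s \<noteq> 2) ?P) < card {v, u1, u2, u3, u4}" using V(2) by simp
    fix c :: "'e \<Rightarrow> nat"
    assume ok: "\<And>s. s \<in># ?P \<Longrightarrow> block_ok (image_mset c s)" and dist: "distinct ?rs"
      and new: "\<And>g. g \<in> set ?rs \<Longrightarrow> g \<notin># \<Sum>\<^sub># ?P"
    have eq: "c z1 = c x1" "c z2 = c x2" "c z3 = c x3" "c z4 = c x4"
      using ok[of "{#x1, z1#}"] ok[of "{#x2, z2#}"] ok[of "{#x3, z3#}"] ok[of "{#x4, z4#}"]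
      by (simp_all add: block_ok_pair)
    have "g \<notin> set ?rs" if "g \<in> {e, x1, z1, x2, z2, x3, z3, x4, z4}" for g
      using new[of g] that by auto
    then have new': "e \<notin> set ?rs" "x1 \<notin> set ?rs" "z1 \<notin> set ?rs" "x2 \<notin> set ?rs" "z2 \<notin> set ?rs"
      "x3 \<notin> set ?rs" "z3 \<notin> set ?rs" "x4 \<notin> set ?rs" "z4 \<notin> set ?rs" by blast+
    obtain d where d: "d \<notin> {c e, c x1, c x2, c x3, c x4}"
      by (rule ex_fresh_nat[of "{c e, c x1, c x2, c x3, c x4}"]) simp
    show "\<exists>c'. (\<forall>e. e \<notin> set ?rs \<longrightarrow> c' e = c e) \<and>
        (\<forall>w\<in>{v, u1, u2, u3, u4}. four_one (image_mset c' (st w)))"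
      using eq dist new' d
      by (intro exI[of _ "c(f1 := d, f2 := d, f3 := d, f4 := d,
          l1 := c x1, l2 := c x2, l3 := c x3, l4 := c x4)"]) (simp add: st four_one_iff)
  qed auto
qed

text \<open>Only \<open>v2\<close> and \<open>v3\<close> are deleted, and \<open>f1\<close>,
  \<open>f2\<close> are joined with \<open>h1\<close>, \<open>h2\<close>, so \<open>v1\<close> and
  \<open>v4\<close> survive and see the same two colors. If these two and the color of
  \<open>e2\<close> are all different, no colors of \<open>g1\<close> and \<open>g2\<close> fit, and
  edges at \<open>v1\<close> and \<open>v4\<close> must change as well. As
  \<open>no_reduction\<close> changes removed edges only, the argument starts from
  \<open>surgery\<close>.\<close>

lemma no_double_path_star:
  assumes V: "{v1, v2, v3, v4} \<subseteq> V" "distinct [v1, v2, v3, v4]"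
    and st: "st v1 = {#f1, f2#} + M" "st v2 = {#f1, f2, g1, g2, e2#}"
      "st v3 = {#g1, g2, h1, h2, e3#}" "st v4 = {#h1, h2#} + N"
  shows False
proof -
  let ?P = "{#{#f1, h1#}, {#f2, h2#}, {#e2, e3#}#}"
  have le2: "count (\<Sum>v\<in>X. st v) e \<le> 2" if "X \<subseteq> {v1, v2, v3, v4}" for X e
    using count_le_2[of X e] V(1) that by blast
  have dist: "distinct [f1, f2, g1, g2, h1, h2]"
    using le2[of "{v1, v2, v3, v4}" f1] le2[of "{v1, v2, v3, v4}" f2] le2[of "{v1, v2, v3, v4}" g1]
      le2[of "{v1, v2, v3, v4}" g2] le2[of "{v1, v2, v3, v4}" h1] le2[of "{v1, v2, v3, v4}" h2] V(2)
    by (auto simp: st split: if_splits)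
  have "e \<notin># M \<and> e \<notin># N \<and> e \<noteq> e2 \<and> e \<noteq> e3" if "e \<in> {f1, f2, g1, g2, h1, h2}" for e
    using le2[of "{v1, v2, v3, v4}" e] V(2) dist that
    by (auto simp: st count_eq_zero_iff[symmetric] split: if_splits)
  then have new: "\<And>e. e \<in># M + N \<Longrightarrow> e \<notin> {f1, f2, g1, g2, h1, h2}"
    "{e2, e3} \<inter> {f1, f2, g1, g2, h1, h2} = {}" by auto
  have other: "{f1, f2, g1, g2, h1, h2} \<inter> set_mset (st v) = {}" if v: "v \<in> V - {v1, v2, v3, v4}" for v
  proof -
    have "e \<notin># st v" if e: "e \<in> {f1, f2, g1, g2, h1, h2}" for e
    proof -
      have "count (\<Sum>w\<in>{v, v1, v2, v3, v4}. st w) e \<le> 2"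
        using v V(1) by (intro count_le_2) auto
      then have "count (st v) e = 0" using e dist v V(2) by (auto simp: st split: if_splits)
      then show ?thesis by (simp add: count_eq_zero_iff)
    qed
    then show ?thesis by blast
  qed
  have "{v2, v3} \<subseteq> V" using V(1) by simp
  moreover have "(\<Sum>v\<in>{v2, v3}. st v) = \<Sum>\<^sub># ?P + {#g1, g1, g2, g2#}"
    using V(2) by (simp add: st add_mset_commute)
  moreover have "even (count {#g1, g1, g2, g2#} e)" for e by simp
  moreover have "size s \<in> {1, 2, 3, 5}" if "s \<in># ?P" for s using that by auto
  moreover have "size (filter_mset (\<lambda>s. size s \<noteq> 2) ?P) < card {v2, v3}" using V(2) by simp
  ultimately obtain c :: "'e \<Rightarrow> nat" where c: "\<forall>v\<in>V - {v2, v3}. four_one (image_mset c (st v))"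
    "\<forall>s\<in>#?P. block_ok (image_mset c s)"
    using surgery[of "{v2, v3}" ?P "{#g1, g1, g2, g2#}"] by blast
  have eq: "c h1 = c f1" "c h2 = c f2" "c e3 = c e2"
    using c(2) by (simp_all add: block_ok_pair)
  have bad: False if "\<forall>e. e \<notin> {f1, f2, g1, g2, h1, h2} \<longrightarrow> c' e = c e"
    "\<forall>v\<in>{v1, v2, v3, v4}. four_one (image_mset c' (st v))" for c'
  proof -
    have "four_one (image_mset c' (st v))" if v: "v \<in> V - {v1, v2, v3, v4}" for v
    proof -
      have "image_mset c' (st v) = image_mset c (st v)"
        using other[OF v] \<open>\<forall>e. e \<notin> {f1, f2, g1, g2, h1, h2} \<longrightarrow> c' e = c e\<close>
        by (intro image_mset_cong) blast
      then show ?thesis using c(1) v by simp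
    qed
    then show False using no_coloring[of c'] that(2) by blast
  qed
  have v14: "four_one ({#c f1, c f2#} + image_mset c M)" "four_one ({#c f1, c f2#} + image_mset c N)"
    using c(1) V by (auto simp: st eq dest: bspec[of _ _ v1] bspec[of _ _ v4])
  define upd where "upd x1 x2 y1 y2 z1 z2 =
    c(f1 := x1, f2 := x2, g1 := y1, g2 := y2, h1 := z1, h2 := z2)" for x1 x2 y1 y2 z1 z2
  have MN: "image_mset (upd x1 x2 y1 y2 z1 z2) M = image_mset c M"
    "image_mset (upd x1 x2 y1 y2 z1 z2) N = image_mset c N" for x1 x2 y1 y2 z1 z2
    using new(1) by (auto simp: upd_def intro!: image_mset_cong)
  have val: "upd x1 x2 y1 y2 z1 z2 f1 = x1" "upd x1 x2 y1 y2 z1 z2 f2 = x2"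
    "upd x1 x2 y1 y2 z1 z2 g1 = y1" "upd x1 x2 y1 y2 z1 z2 g2 = y2"
    "upd x1 x2 y1 y2 z1 z2 h1 = z1" "upd x1 x2 y1 y2 z1 z2 h2 = z2"
    "upd x1 x2 y1 y2 z1 z2 e2 = c e2" "upd x1 x2 y1 y2 z1 z2 e3 = c e2" for x1 x2 y1 y2 z1 z2
    using dist new(2) by (auto simp: upd_def eq)
  have bad': False if "four_one ({#x1, x2#} + image_mset c M)" "four_one ({#z1, z2#} + image_mset c N)"
    "four_one {#x1, x2, y1, y2, c e2#}" "four_one {#y1, y2, z1, z2, c e2#}" for x1 x2 y1 y2 z1 z2
  proof (rule bad[of "upd x1 x2 y1 y2 z1 z2"])
    show "\<forall>v\<in>{v1, v2, v3, v4}. four_one (image_mset (upd x1 x2 y1 y2 z1 z2) (st v))"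
      using that by (simp add: st MN val)
  qed (simp add: upd_def)
  obtain d where d: "d \<notin> {c f1}" by (rule ex_fresh_nat[of "{c f1}"]) simp
  consider "c f1 = c f2" "c e2 = c f1" | "c f1 = c f2" "c e2 \<noteq> c f1"
    | "c f1 \<noteq> c f2" "c e2 \<in> {c f1, c f2}" | "c f1 \<noteq> c f2" "c e2 \<notin> {c f1, c f2}" by blast
  then show False
  proof cases
    case 1
    then show False using bad'[OF v14, of "c f1" d] d by (simp add: four_one_iff)
  next
    case 2
    then show False using bad'[OF v14, of "c f1" "c f1"] by (simp add: four_one_iff)
  next
    case 3
    then show False using bad'[OF v14, of "c e2" "c e2"] by (auto simp: four_one_iff)
  next
    \<comment> \<open>At \<open>v1\<close> and at \<open>v4\<close> the odd one of the two colors
      becomes \<open>c e2\<close>. The two changes may differ, since the joined edges are separate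
      again. Then \<open>c e2\<close> is fourfold at \<open>v2\<close> and
      \<open>v3\<close>.\<close>
    case 4
    obtain x1 x2 where x: "four_one ({#x1, x2#} + image_mset c M)" "(x1 = c e2) \<noteq> (x2 = c e2)"
      using four_one_recolor[OF v14(1) 4] by blast
    obtain z1 z2 where z: "four_one ({#z1, z2#} + image_mset c N)" "(z1 = c e2) \<noteq> (z2 = c e2)"
      using four_one_recolor[OF v14(2) 4] by blast
    show False using bad'[OF x(1) z(1), of "c e2" "c e2"] x(2) z(2) by (auto simp: four_one_iff)
  qed
qed

end

section \<open>Edge cuts and the number of loops\<close>

lemma even_size_if_even_counts:
  assumes "\<And>e. even (count M e)"
  shows "even (size M)"
  using assms by (simp add: size_multiset_overloaded_eq dvd_sum)

lemma card_set_mset_le_size: "card (set_mset M) \<le> size M"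
  by (induction M) (auto simp: card_insert_if)

context minimal_star_system
begin

text \<open>The edge cut around \<open>X\<close>: edges inside \<open>X\<close>, loops included,
  have count 2.\<close>

definition boundary :: "'v set \<Rightarrow> 'e set" where
  "boundary X = {e. count (\<Sum>v\<in>X. st v) e = 1}"

lemma finite_boundary: "finite (boundary X)"
proof -
  have "boundary X \<subseteq> set_mset (\<Sum>v\<in>X. st v)" by (auto simp: boundary_def intro: count_inI)
  then show ?thesis by (rule finite_subset) simp
qed

lemma count_sum_Diff:
  assumes "X \<subseteq> V"
  shows "count (\<Sum>v\<in>X. st v) e + count (\<Sum>v\<in>V - X. st v) e = 0 \<or>
    count (\<Sum>v\<in>X. st v) e + count (\<Sum>v\<in>V - X. st v) e = 2"
  using sum.subset_diff[OF assms finite_V, of st] count_sum_st[of e]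
  by (simp only: count_union add.commute insert_iff empty_iff simp_thms)

lemma boundary_Diff:
  assumes "X \<subseteq> V"
  shows "boundary (V - X) = boundary X"
proof (rule set_eqI)
  show "e \<in> boundary (V - X) \<longleftrightarrow> e \<in> boundary X" for e
    using count_sum_Diff[OF assms, of e] unfolding boundary_def mem_Collect_eq by arith
qed

lemma boundary_split:
  assumes "X \<subseteq> V"
  shows "\<exists>R. (\<Sum>v\<in>X. st v) = mset_set (boundary X) + R \<and> (\<forall>e. even (count R e))"
proof -
  let ?T = "\<Sum>v\<in>X. st v"
  have sub: "mset_set (boundary X) \<subseteq># ?T"
    by (simp add: subseteq_mset_def count_mset_set' boundary_def)
  have "even (count (?T - mset_set (boundary X)) e)" for e
  proof -
    have "count ?T e = 0 \<or> count ?T e = 1 \<or> count ?T e = 2"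
      using count_le_2[OF assms, of e] by arith
    then show ?thesis
      using finite_boundary[of X] by (elim disjE) (simp_all add: count_mset_set' boundary_def)
  qed
  then show ?thesis using sub by (intro exI[of _ "?T - mset_set (boundary X)"]) simp
qed

lemma size_sum_st:
  assumes "X \<subseteq> V"
  shows "size (\<Sum>v\<in>X. st v) = 5 * card X"
  using assms size_st by (simp add: size_multiset_sum subset_iff)

text \<open>The degree sum \<open>5 * card X\<close> is the size of the cut plus an even
  contribution of inner edges.\<close>

lemma parity_boundary:
  assumes "X \<subseteq> V"
  shows "even (card (boundary X)) \<longleftrightarrow> even (card X)"
proof -
  obtain R where R: "(\<Sum>v\<in>X. st v) = mset_set (boundary X) + R" "\<forall>e. even (count R e)"
    using boundary_split[OF assms] by blast
  have "5 * card X = card (boundary X) + size R"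
    unfolding size_sum_st[OF assms, symmetric] R(1) by simp
  moreover have "even (size R)" using R(2) even_size_if_even_counts by blast
  ultimately show ?thesis by (metis even_add even_mult_iff odd_numeral)
qed

text \<open>Stars depend only on which colors are equal. If both colorings induce the same partition
  of the cut, an injective renaming of the first makes them agree on the cut.\<close>

lemma no_gluing:
  fixes c1 c2 :: "'e \<Rightarrow> nat"
  assumes X: "X \<subseteq> V"
    and c1: "\<forall>v\<in>X. four_one (image_mset c1 (st v))"
    and c2: "\<forall>v\<in>V - X. four_one (image_mset c2 (st v))"
    and kernel: "\<forall>e\<in>boundary X. \<forall>f\<in>boundary X. c1 e = c1 f \<longleftrightarrow> c2 e = c2 f"
  shows False
proof -
  let ?B = "boundary X"
  obtain K where K: "\<And>e. e \<in> ?B \<Longrightarrow> c2 e < K"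
    using finite_boundary[of X] finite_nat_set_iff_bounded[of "c2 ` ?B"] by auto
  \<comment> \<open>Colors on the cut are sent to those of \<open>c2\<close>; all others are shifted
    beyond these by \<open>K\<close>, which keeps the renaming injective.\<close>
  define s where "s n = (if n \<in> c1 ` ?B then c2 (inv_into ?B c1 n) else n + K)" for n
  have s: "s (c1 e) = c2 e" if "e \<in> ?B" for e
    using kernel inv_into_into[of "c1 e" c1 ?B] f_inv_into_f[of "c1 e" c1 ?B] that
    by (auto simp: s_def)
  have "inj s"
  proof (rule injI)
    fix m n assume eq: "s m = s n"
    have lt: "s k < K" if "k \<in> c1 ` ?B" for k using that s K by auto
    have ge: "s k \<ge> K" if "k \<notin> c1 ` ?B" for k using that by (simp add: s_def)
    show "m = n"
    proof (cases "m \<in> c1 ` ?B")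
      case True
      then have "n \<in> c1 ` ?B" using lt[OF True] ge[of n] eq by force
      then obtain e f where "e \<in> ?B" "m = c1 e" "f \<in> ?B" "n = c1 f" using True by blast
      then show ?thesis using eq s kernel by metis
    next
      case False
      then have "n \<notin> c1 ` ?B" using ge[OF False] lt[of n] eq by force
      then show ?thesis using False eq by (simp add: s_def)
    qed
  qed
  define c where "c e = (if e \<in># (\<Sum>v\<in>X. st v) then s (c1 e) else c2 e)" for e
  have finX: "finite X" using X finite_V finite_subset by blast
  have "four_one (image_mset c (st v))" if v: "v \<in> V" for v
  proof (cases "v \<in> X")
    case True
    then have "image_mset c (st v) = image_mset s (image_mset c1 (st v))"
      unfolding multiset.map_comp using finX
        by (intro image_mset_cong) (auto simp: c_def in_sum_multiset)
    then show ?thesis using four_one_image_inj[OF \<open>inj s\<close>] c1 True by simp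
  next
    case False
    \<comment> \<open>An edge that also meets \<open>X\<close> lies in the cut, where the renamed
      \<open>c1\<close> equals \<open>c2\<close>.\<close>
    have "c e = c2 e" if e: "e \<in># st v" for e
    proof (cases "e \<in># (\<Sum>v\<in>X. st v)")
      case True
      have "e \<in># (\<Sum>v\<in>V - X. st v)" using e v False finite_V by (auto simp: in_sum_multiset)
      then have "count (\<Sum>v\<in>V - X. st v) e \<noteq> 0" "count (\<Sum>v\<in>X. st v) e \<noteq> 0"
        using True by (simp_all only: count_eq_zero_iff not_not simp_thms)
      then have "e \<in> ?B"
        using count_sum_Diff[OF X, of e] unfolding boundary_def mem_Collect_eq by arith
      then show ?thesis using True s by (simp add: c_def)
    qed (simp add: c_def)
    then have "image_mset c (st v) = image_mset c2 (st v)" by (intro image_mset_cong)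
    then show ?thesis using c2 False v by simp
  qed
  then show False using no_coloring[of c] by blast
qed

text \<open>\<open>X\<close> is shrunk to at most one vertex, hence to fewer than it has, and its
  inner edges are dropped.\<close>

lemma color_around_boundary:
  assumes X: "X \<subseteq> V" "2 \<le> card X" and P: "\<Sum>\<^sub># P = mset_set (boundary X)"
    "size (filter_mset (\<lambda>s. size s \<noteq> 2) P) \<le> 1" "\<And>s. s \<in># P \<Longrightarrow> size s \<in> {1, 2, 3, 5}"
  shows "\<exists>c :: 'e \<Rightarrow> nat. (\<forall>v\<in>V - X. four_one (image_mset c (st v))) \<and>
    (\<forall>s\<in>#P. block_ok (image_mset c s))"
proof -
  obtain R where R: "(\<Sum>v\<in>X. st v) = \<Sum>\<^sub># P + R" "\<And>e. even (count R e)"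
    using boundary_split[OF X(1)] P(1) by auto
  show ?thesis
    by (rule surgery[OF X(1) R P(3)]) (use P(2) X(2) in auto)
qed

text \<open>If no coloring of one side gives a 3-edge cut a single color, then every edge of the cut is
  singled out by some coloring of that side. Hence the two sides always have colorings that agree on
  the cut up to renaming colors.\<close>

definition single_color :: "('e \<Rightarrow> nat) \<Rightarrow> 'e set \<Rightarrow> bool" where
  "single_color c B \<longleftrightarrow> (\<forall>f\<in>B. \<forall>g\<in>B. c f = c g)"

definition odd_one :: "('e \<Rightarrow> nat) \<Rightarrow> 'e set \<Rightarrow> 'e \<Rightarrow> bool" where
  "odd_one c B e \<longleftrightarrow> (\<forall>f\<in>B. \<forall>g\<in>B. c f = c g \<longleftrightarrow> (f = e \<longleftrightarrow> g = e))"

text \<open>For the first claim \<open>X\<close> becomes a vertex with one loop, which forces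
  exactly two of the three cut edges to agree. For the second the two edges other than
  \<open>e\<close> are joined and \<open>e\<close> ends at a vertex with two loops.\<close>

lemma color_around_3_cut:
  assumes X: "X \<subseteq> V" "2 \<le> card X" "card (boundary X) = 3"
  defines "C \<equiv> {c :: 'e \<Rightarrow> nat. \<forall>v\<in>V - X. four_one (image_mset c (st v))}"
  shows "\<exists>c\<in>C. \<exists>e\<in>boundary X. odd_one c (boundary X) e"
    and "e \<in> boundary X \<Longrightarrow> \<exists>c\<in>C. single_color c (boundary X) \<or> odd_one c (boundary X) e"
proof -
  obtain x y z where B: "boundary X = {x, y, z}" "x \<noteq> y" "x \<noteq> z" "y \<noteq> z"
    using X(3) by (auto simp: card_3_iff)
  show "\<exists>c\<in>C. \<exists>e\<in>boundary X. odd_one c (boundary X) e"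
  proof -
    obtain c :: "'e \<Rightarrow> nat" where c: "\<forall>v\<in>V - X. four_one (image_mset c (st v))"
      "\<forall>s\<in>#{#mset_set (boundary X)#}. block_ok (image_mset c s)"
      using color_around_boundary[OF X(1,2), of "{#mset_set (boundary X)#}"] X(3) by auto
    then obtain a b where ab: "a \<noteq> b" "{#c x, c y, c z#} = {#a, a, b#}"
      using B by (auto simp: block_ok_def)
    then have "b \<in># {#c x, c y, c z#}" by simp
    then consider "b = c x" | "b = c y" | "b = c z" by auto
    then have "\<exists>e\<in>boundary X. odd_one c (boundary X) e"
    proof cases
      case 1
      then have "{#c y, c z#} = {#a, a#}" using ab(2) by (simp add: add_mset_commute)
      then have "set_mset {#c y, c z#} = set_mset {#a, a#}" by (rule arg_cong)
      then have "odd_one c (boundary X) x" using 1 ab(1) B by (auto simp: odd_one_def)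
      then show ?thesis using B by blast
    next
      case 2
      then have "{#c x, c z#} = {#a, a#}" using ab(2) by (simp add: add_mset_commute)
      then have "set_mset {#c x, c z#} = set_mset {#a, a#}" by (rule arg_cong)
      then have "odd_one c (boundary X) y" using 2 ab(1) B by (auto simp: odd_one_def)
      then show ?thesis using B by blast
    next
      case 3
      then have "{#c x, c y#} = {#a, a#}" using ab(2) by (simp add: add_mset_commute)
      then have "set_mset {#c x, c y#} = set_mset {#a, a#}" by (rule arg_cong)
      then have "odd_one c (boundary X) z" using 3 ab(1) B by (auto simp: odd_one_def)
      then show ?thesis using B by blast
    qed
    then show ?thesis using c(1) by (auto simp: C_def)
  qed
  assume e: "e \<in> boundary X"
  then have "card (boundary X - {e}) = 2" using X(3) by simp
  then obtain f g where fg: "boundary X - {e} = {f, g}" "f \<noteq> g" by (auto simp: card_2_iff)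
  then have B: "boundary X = {e, f, g}" "e \<noteq> f" "e \<noteq> g" "f \<noteq> g" using e by blast+
  let ?P = "{#{#e#}, {#f, g#}#}"
  have P: "\<Sum>\<^sub># ?P = mset_set (boundary X)" "size (filter_mset (\<lambda>s. size s \<noteq> 2) ?P) \<le> 1"
    "\<And>s. s \<in># ?P \<Longrightarrow> size s \<in> {1, 2, 3, 5}"
    using B by auto
  obtain c :: "'e \<Rightarrow> nat" where c: "\<forall>v\<in>V - X. four_one (image_mset c (st v))"
    "\<forall>s\<in>#?P. block_ok (image_mset c s)"
    using color_around_boundary[OF X(1,2) P] by blast
  then have "c g = c f" by (simp add: block_ok_pair)
  then have "single_color c (boundary X) \<or> odd_one c (boundary X) e"
    using B by (auto simp: single_color_def odd_one_def)
  then show "\<exists>c\<in>C. single_color c (boundary X) \<or> odd_one c (boundary X) e"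
    using c(1) by (auto simp: C_def)
qed

lemma no_small_cut:
  assumes X: "X \<subseteq> V" "2 \<le> card X" "2 \<le> card (V - X)"
  shows "card (boundary X) \<notin> {1, 3}"
proof
  assume "card (boundary X) \<in> {1, 3}"
  then consider "card (boundary X) = 1" | "card (boundary X) = 3" by blast
  then show False
  proof cases
    case 1
    let ?P = "{#mset_set (boundary X)#}"
    obtain c2 :: "'e \<Rightarrow> nat" where c2: "\<forall>v\<in>V - X. four_one (image_mset c2 (st v))"
      using color_around_boundary[OF X(1,2), of ?P] 1 by auto
    obtain c1 :: "'e \<Rightarrow> nat" where "\<forall>v\<in>V - (V - X). four_one (image_mset c1 (st v))"
      using color_around_boundary[of "V - X" ?P] X(3) boundary_Diff[OF X(1)] 1 by auto
    then have c1: "\<forall>v\<in>X. four_one (image_mset c1 (st v))" using X(1) by blast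
    obtain e where "boundary X = {e}" using 1 by (auto simp: card_1_singleton_iff)
    then show False using no_gluing[OF X(1) c1 c2] by simp
  next
    case 3: 2
    let ?B = "boundary X"
    note right = color_around_3_cut[OF X(1,2) 3]
    have VX: "V - (V - X) = X" using X(1) by blast
    have "card (boundary (V - X)) = 3" using 3 boundary_Diff[OF X(1)] by simp
    note left = color_around_3_cut[OF Diff_subset X(3) this, unfolded VX boundary_Diff[OF X(1)]]
    have no_odd: "\<not> (odd_one c1 ?B e \<and> odd_one c2 ?B e)"
      and no_single: "\<not> (single_color c1 ?B \<and> single_color c2 ?B)"
      if "\<forall>v\<in>X. four_one (image_mset c1 (st v))" "\<forall>v\<in>V - X. four_one (image_mset c2 (st v))"
      for c1 c2 e
      using no_gluing[OF X(1) that] by (auto simp: odd_one_def single_color_def)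
    show False
    \<comment> \<open>If the side \<open>X\<close> can give the cut a single color, the other side
      cannot, so the other side can single out any edge, in particular one that \<open>X\<close>
      singles out. Otherwise the roles are exchanged.\<close>
    proof (cases "\<exists>c. (\<forall>v\<in>X. four_one (image_mset c (st v))) \<and> single_color c ?B")
      case True
      then show False using left(1) right(2) no_odd no_single by blast
    next
      case False
      then show False using right(1) left(2) no_odd by blast
    qed
  qed
qed

section \<open>Odd sets, perfect matchings and the count of loops\<close>

definition loop_edges :: "'v set \<Rightarrow> 'e set" where
  "loop_edges X = {e. \<exists>v\<in>X. count (st v) e = 2}"

lemma finite_loop_edges:
  assumes "X \<subseteq> V"
  shows "finite (loop_edges X)"
proof -
  have "loop_edges X \<subseteq> (\<Union>v\<in>X. set_mset (st v))"
    by (auto simp: loop_edges_def intro!: bexI count_inI)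
  then show ?thesis using assms finite_V finite_subset by (metis finite_UN finite_set_mset)
qed

text \<open>For a single vertex this is the degree 5. For larger sets the cut is odd by parity and
  has neither 1 nor 3 edges.\<close>

lemma odd_set_boundary_loops:
  assumes X: "X \<subseteq> V" "odd (card X)" "2 \<le> card (V - X)"
  shows "5 \<le> card (boundary X) + 2 * card (loop_edges X)"
proof (cases "card X = 1")
  case True
  then obtain v where v: "X = {v}" by (auto simp: card_1_singleton_iff)
  then have "v \<in> V" using X(1) by simp
  have count: "count (st v) e = 0 \<or> count (st v) e = 1 \<or> count (st v) e = 2" for e
  proof -
    have "count (st v) e \<le> 2" using count_le_2[OF X(1), of e] v by simp
    then show ?thesis by arith
  qed
  have fin: "finite (boundary X)" "finite (loop_edges X)"
    using finite_boundary finite_loop_edges[OF X(1)] by auto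
  have "st v = mset_set (boundary X) + (mset_set (loop_edges X) + mset_set (loop_edges X))"
  proof (rule multiset_eqI)
    fix e
    show "count (st v) e =
        count (mset_set (boundary X) + (mset_set (loop_edges X) + mset_set (loop_edges X))) e"
      using count[of e] fin
      by (elim disjE) (simp_all add: count_mset_set' boundary_def loop_edges_def v)
  qed
  then have "size (st v) = card (boundary X) + (card (loop_edges X) + card (loop_edges X))"
    by (metis size_mset_set size_union)
  then show ?thesis using size_st[OF \<open>v \<in> V\<close>] by simp
next
  case False
  then have "2 \<le> card X" using X(2) by (cases "card X") auto
  then have "card (boundary X) \<notin> {1, 3}" using no_small_cut X by blast
  moreover have "odd (card (boundary X))" using parity_boundary[OF X(1)] X(2) by simp
  ultimately have "5 \<le> card (boundary X)" by (auto elim!: oddE)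
  then show ?thesis by simp
qed

lemma three_ends:
  assumes "{x, y, z} \<subseteq> V" "distinct [x, y, z]" "e \<in># st x" "e \<in># st y" "e \<in># st z"
  shows False
proof -
  have "count (\<Sum>v\<in>{x, y, z}. st v) e \<le> 2" using assms(1) by (rule count_le_2)
  moreover have "count (st x) e \<ge> 1" "count (st y) e \<ge> 1" "count (st z) e \<ge> 1"
    using assms(3-5) by (simp_all only: Suc_le_eq One_nat_def count_greater_zero_iff)
  moreover have "count (\<Sum>v\<in>{x, y, z}. st v) e = count (st x) e + count (st y) e + count (st z) e"
    using assms(2) by simp
  ultimately show False by linarith
qed

text \<open>Matching edges get color 1 and all others color 0. A second occurrence of a matching
  edge at a vertex would produce an edge with three ends.\<close>

lemma no_perfect_matching:
  assumes M: "disjoint M" "\<Union>M = V"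
    and edge: "\<And>m. m \<in> M \<Longrightarrow> \<exists>x y e. x \<noteq> y \<and> m = {x, y} \<and> e \<in># st x \<and> e \<in># st y"
  shows False
proof -
  obtain f where f: "\<And>m. m \<in> M \<Longrightarrow> \<exists>x y. x \<noteq> y \<and> m = {x, y} \<and> f m \<in># st x \<and> f m \<in># st y"
    using edge by metis
  define c where "c e = (if e \<in> f ` M then 1 else 0 :: nat)" for e
  have "four_one (image_mset c (st v))" if v: "v \<in> V" for v
  proof -
    obtain m where m: "m \<in> M" "v \<in> m" using v M(2) by blast
    then obtain w where w: "m = {v, w}" "v \<noteq> w" "f m \<in># st v" "f m \<in># st w"
      using f[OF m(1)] by (metis doubleton_eq_iff insertE singletonD)
    have wV: "w \<in> V" using m w M(2) by blast
    obtain N where N: "st v = add_mset (f m) N" using w(3) by (metis insert_DiffM)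
    have "f m' \<notin># N" if m': "m' \<in> M" for m'
    proof
      assume mN: "f m' \<in># N"
      show False
      proof (cases "m' = m")
        case True
        have "count (\<Sum>u\<in>{v, w}. st u) (f m) \<le> 2" using v wV by (intro count_le_2) simp
        moreover have "count N (f m) \<ge> 1" "count (st w) (f m) \<ge> 1"
          using mN True w(4) by (simp_all only: Suc_le_eq One_nat_def count_greater_zero_iff)
        ultimately show False using w(2) N by simp
      next
        case False
        then have disj: "m \<inter> m' = {}" using disjointD[OF M(1) m(1) m'] by blast
        obtain x y where xy: "x \<noteq> y" "m' = {x, y}" "f m' \<in># st x" "f m' \<in># st y"
          using f[OF m'] by blast
        have "x \<in> V" "y \<in> V" using m' M(2) xy(2) by auto
        then show False
          using three_ends[of v x y "f m'"] v xy disj m(2) mN N by auto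
      qed
    qed
    then have "image_mset c N = image_mset (\<lambda>_. 0) N"
      by (intro image_mset_cong) (auto simp: c_def)
    moreover have "size N = 4" using size_st[OF v] N by simp
    ultimately have "image_mset c (st v) = {#1, 0, 0, 0, 0#}"
      using m(1) by (simp add: N c_def image_mset_const_eq numeral_eq_Suc)
    then show ?thesis by (simp add: four_one_iff)
  qed
  then show False using no_coloring[of c] by blast
qed

lemma five_loops: "5 \<le> card (loop_edges V)"
proof -
  \<comment> \<open>The underlying simple graph, since \<open>tutte_berge\<close> speaks about sets
    of two vertices.\<close>
  define E where "E = {m. \<exists>x y e. x \<in> V \<and> y \<in> V \<and> x \<noteq> y \<and> m = {x, y} \<and> e \<in># st x \<and> e \<in># st y}"
  have E: "\<And>e. e \<in> E \<Longrightarrow> card e = 2" "\<And>e. e \<in> E \<Longrightarrow> e \<subseteq> V" by (auto simp: E_def)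
  have "finite E" by (rule finite_subset[of E "Pow V"]) (use E(2) finite_V in auto)
  then obtain M where M: "maximum_matching_in E M" using ex_maximum_matching by blast
  then have mM: "M \<subseteq> E" "disjoint M" "matching_in E M"
    by (auto simp: maximum_matching_in_def matching_in_def)
  have finM: "finite M" using mM(1) \<open>finite E\<close> finite_subset by blast
  have UM: "card (\<Union>M) = 2 * card M" by (rule card_Union_matching[OF mM(3) E(1) finM])
  have UV: "\<Union>M \<subseteq> V" using mM(1) E(2) by blast
  have "\<Union>M \<noteq> V"
  proof
    assume "\<Union>M = V"
    then show False
      by (rule no_perfect_matching[OF mM(2)]) (use mM(1) in \<open>force simp: E_def\<close>)
  qed
  then have "2 * card M < card V" using UM UV finite_V by (metis psubset_card_mono psubsetI)
  moreover have "even (card V)"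
  proof -
    have "even (size (\<Sum>v\<in>V. st v))"
    proof (rule even_size_if_even_counts)
      show "even (count (\<Sum>v\<in>V. st v) e)" for e using count_sum_st[of e] by auto
    qed
    then show ?thesis using size_sum_st[of V] by simp
  qed
  \<comment> \<open>The deficiency is positive as there is no perfect matching, and it is even
    because the degree sum \<open>5 * card V\<close> is even.\<close>
  ultimately have deficiency: "2 \<le> card V - 2 * card M" by presburger
  obtain S C where S: "S \<subseteq> V" and C: "disjoint C"
    "\<forall>K\<in>C. K \<subseteq> V - S \<and> odd (card K) \<and> (\<forall>e\<in>E. e \<inter> K \<noteq> {} \<longrightarrow> e \<subseteq> K \<union> S)"
    "card V - 2 * card M + card S \<le> card C"
    using tutte_berge[of V E M] finite_V E M by metis
  have finC: "finite C" by (rule finite_subset[of C "Pow V"]) (use C(2) finite_V in auto)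
  have finS: "finite S" using S finite_V finite_subset by blast
  have KS: "K \<subseteq> V - S" and Kodd: "odd (card K)" if "K \<in> C" for K
    using bspec[OF C(2) that] by simp_all
  have closed: "e \<subseteq> K \<union> S" if "K \<in> C" "e \<in> E" "e \<inter> K \<noteq> {}" for K e
    using bspec[OF C(2) that(1)] that(2,3) by simp
  have KV: "K \<subseteq> V" and Kne: "K \<noteq> {}" if "K \<in> C" for K
    using KS[OF that] Kodd[OF that] by auto
  have finK: "finite K" if "K \<in> C" for K using KV[OF that] finite_V finite_subset by blast
  have ends: "\<exists>x s. x \<in> K \<and> s \<in> S \<and> e \<in># st x \<and> e \<in># st s"
    if K: "K \<in> C" and e: "e \<in> boundary K" for K e
  proof -
    have cnt: "count (\<Sum>v\<in>K. st v) e = 1" "count (\<Sum>v\<in>V - K. st v) e = 1"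
      using e boundary_Diff[OF KV[OF K]] by (auto simp: boundary_def)
    then have "e \<in># (\<Sum>v\<in>K. st v)" "e \<in># (\<Sum>v\<in>V - K. st v)" by (auto intro!: count_inI)
    then obtain x y where xy: "x \<in> K" "e \<in># st x" "y \<in> V - K" "e \<in># st y"
      using finK[OF K] finite_V by (auto simp: in_sum_multiset)
    then have "x \<in> V" "y \<in> V" "x \<noteq> y" using KV[OF K] by auto
    then have "{x, y} \<in> E" unfolding E_def using xy by blast
    moreover have "{x, y} \<inter> K \<noteq> {}" using xy by blast
    ultimately have "{x, y} \<subseteq> K \<union> S" by (rule closed[OF K])
    then have "y \<in> S" using xy by blast
    then show ?thesis using xy by blast
  qed
  have "card C \<ge> 2" using C(3) deficiency by linarith
  \<comment> \<open>An odd \<open>K\<close> has an odd, hence nonempty, cut, which yields a vertex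
    of \<open>S\<close>; a second set of the family \<open>C\<close> yields another vertex outside
    \<open>K\<close>.\<close>
  have big: "2 \<le> card (V - K)" if K: "K \<in> C" for K
  proof -
    have "boundary K \<noteq> {}" using parity_boundary[OF KV[OF K]] Kodd[OF K] by auto
    then obtain s where s: "s \<in> S" using ends[OF K] by blast
    have "\<not> C \<subseteq> {K}" using \<open>card C \<ge> 2\<close> card_mono[of "{K}" C] by auto
    then obtain K' where K': "K' \<in> C" "K' \<noteq> K" by blast
    then obtain x where x: "x \<in> K'" using Kne by blast
    have "x \<notin> K" using disjointD[OF C(1) K'(1) K K'(2)] x by blast
    moreover have "x \<in> V - S" "K \<subseteq> V - S" using KS[OF K] KS[OF K'(1)] x by auto
    ultimately have "{s, x} \<subseteq> V - K" "s \<noteq> x" using s S by auto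
    then show ?thesis using finite_V card_mono[of "V - K" "{s, x}"] by simp
  qed
  have "5 * card C = (\<Sum>K\<in>C. 5)" by simp
  also have "\<dots> \<le> (\<Sum>K\<in>C. card (boundary K) + 2 * card (loop_edges K))"
    using odd_set_boundary_loops KV Kodd big by (intro sum_mono) auto
  also have "\<dots> = (\<Sum>K\<in>C. card (boundary K)) + 2 * (\<Sum>K\<in>C. card (loop_edges K))"
    by (simp add: sum.distrib sum_distrib_left)
  finally have total: "5 * card C \<le>
    (\<Sum>K\<in>C. card (boundary K)) + 2 * (\<Sum>K\<in>C. card (loop_edges K))" .
  \<comment> \<open>An edge of two of the cuts would have ends in two sets of \<open>C\<close> and a
    third end in \<open>S\<close>.\<close>
  have "(\<Sum>K\<in>C. card (boundary K)) = card (\<Union>(boundary ` C))"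
  proof (rule card_UN_disjoint[symmetric, OF finC])
    show "\<forall>K\<in>C. \<forall>L\<in>C. K \<noteq> L \<longrightarrow> boundary K \<inter> boundary L = {}"
    proof (intro ballI impI)
      fix K L assume KL: "K \<in> C" "L \<in> C" "K \<noteq> L"
      show "boundary K \<inter> boundary L = {}"
      proof (rule ccontr)
        assume "boundary K \<inter> boundary L \<noteq> {}"
        then obtain e where e: "e \<in> boundary K" "e \<in> boundary L" by blast
        obtain x s where x: "x \<in> K" "s \<in> S" "e \<in># st x" "e \<in># st s"
          using ends[OF KL(1) e(1)] by blast
        obtain y where y: "y \<in> L" "e \<in># st y" using ends[OF KL(2) e(2)] by blast
        have "K \<subseteq> V - S" "L \<subseteq> V - S" "K \<inter> L = {}"
          using KS[OF KL(1)] KS[OF KL(2)] disjointD[OF C(1) KL] by auto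
        then show False using three_ends[of x y s e] x y S by auto
      qed
    qed
  qed (simp add: finite_boundary)
  also have "\<dots> \<le> card (\<Union>s\<in>S. set_mset (st s))"
    using finS ends by (intro card_mono) blast+
  also have "\<dots> \<le> (\<Sum>s\<in>S. card (set_mset (st s)))" by (rule card_UN_le[OF finS])
  also have "\<dots> \<le> (\<Sum>s\<in>S. 5)"
  proof (rule sum_mono)
    fix s assume "s \<in> S"
    then have "size (st s) = 5" using size_st S by blast
    then show "card (set_mset (st s)) \<le> 5" using card_set_mset_le_size[of "st s"] by simp
  qed
  finally have bd: "(\<Sum>K\<in>C. card (boundary K)) \<le> 5 * card S" by simp
  have "(\<Sum>K\<in>C. card (loop_edges K)) = card (\<Union>(loop_edges ` C))"
  proof (rule card_UN_disjoint[symmetric, OF finC])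
    show "\<forall>K\<in>C. finite (loop_edges K)" using finite_loop_edges KV by blast
    show "\<forall>K\<in>C. \<forall>L\<in>C. K \<noteq> L \<longrightarrow> loop_edges K \<inter> loop_edges L = {}"
    proof (intro ballI impI)
      fix K L assume KL: "K \<in> C" "L \<in> C" "K \<noteq> L"
      show "loop_edges K \<inter> loop_edges L = {}"
      proof (rule ccontr)
        assume "loop_edges K \<inter> loop_edges L \<noteq> {}"
        then obtain e x y where xy: "x \<in> K" "y \<in> L" "count (st x) e = 2" "count (st y) e = 2"
          by (auto simp: loop_edges_def)
        have "x \<noteq> y" using disjointD[OF C(1) KL] xy by blast
        moreover have "count (\<Sum>v\<in>{x, y}. st v) e \<le> 2" using xy KV KL by (intro count_le_2) blast
        ultimately show False using xy by simp
      qed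
    qed
  qed
  also have "\<dots> \<le> card (loop_edges V)"
    using KV by (intro card_mono finite_loop_edges) (auto simp: loop_edges_def)
  finally have "(\<Sum>K\<in>C. card (loop_edges K)) \<le> card (loop_edges V)" .
  \<comment> \<open>\<open>card C\<close> is at least \<open>card S + 2\<close>, so the cuts cover
    at most \<open>5 * card S\<close> of the required \<open>5 * card S + 10\<close>; the missing 10
    must be twice the number of loops.\<close>
  then show ?thesis using total bd C(3) deficiency by linarith
qed

end

section \<open>Forbidden configurations\<close>

locale minimal_uncolorable =
  fixes G :: "('v, 'e) pgraph"
  assumes regular: "regular 5 G"
    and uncolorable: "\<not> has_coloring_4_1 G"
    and smaller_colorable: "\<And>H :: (nat, nat) pgraph.
      regular 5 H \<Longrightarrow> card (verts H) < card (verts G) \<Longrightarrow> has_coloring_4_1 H"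
begin

lemma pseudograph: "pseudograph G" and finite_edges: "finite (edges G)"
  using regular by (auto simp: regular_def pseudograph_def)

sublocale minimal_star_system "verts G" "star G"
proof
  show "finite (verts G)" using pseudograph by (simp add: pseudograph_def)
  show "size (star G v) = 5" if "v \<in> verts G" for v
    using regular that finite_edges by (simp add: regular_def size_star)
  show "count (\<Sum>v\<in>verts G. star G v) e \<in> {0, 2}" for e
    by (simp add: count_sum_star[OF pseudograph])
  show "\<exists>v\<in>verts G. \<not> four_one (image_mset c (star G v))" for c :: "'e \<Rightarrow> nat"
    using uncolorable coloring_4_1_iff_star[OF regular, of c] by (auto simp: has_coloring_4_1_def)
  fix N :: "nat multiset multiset"
  assume N: "N \<noteq> {#}" "\<And>s. s \<in># N \<Longrightarrow> size s = 5" "\<And>e. count (\<Sum>\<^sub># N) e \<in> {0, 2}"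
    and less: "size N < card (verts G)"
  obtain H :: "(nat, nat) pgraph" where H: "regular 5 H" "card (verts H) = size N"
    "\<forall>s. s \<in># N \<longleftrightarrow> s \<in> star H ` verts H"
    using ex_graph_of_blocks[OF N] by blast
  then obtain c where "coloring_4_1 H c"
    using smaller_colorable[OF H(1)] less by (auto simp: has_coloring_4_1_def)
  then show "\<exists>c :: nat \<Rightarrow> nat. \<forall>s\<in>#N. four_one (image_mset c s)"
    using H coloring_4_1_iff_star[OF H(1), of c] by (intro exI[of _ c]) auto
qed

section \<open>Explicit stars from edge multiplicities\<close>

lemma edges_between_commute: "edges_between G u v = edges_between G v u"
proof -
  have "Upair u v = Upair v u" by simp
  then show ?thesis unfolding edges_between_def by (simp only:)
qed

lemma count_star_loop: "e \<in> edges_between G v v \<Longrightarrow> count (star G v) e = 2"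
  using finite_edges by (simp add: count_star incidence_def edges_between_def)

lemma in_star_between: "e \<in> edges_between G u v \<Longrightarrow> e \<in># star G u"
  using finite_edges by (auto simp: in_star edges_between_def)

lemma edges_between_disjoint:
  "e \<in> edges_between G u v \<Longrightarrow> e \<in> edges_between G u w \<Longrightarrow> v = w"
  by (auto simp: edges_between_def)

lemma edges_between_verts: "e \<in> edges_between G u v \<Longrightarrow> u \<in> verts G \<and> v \<in> verts G"
  using pseudograph by (auto simp: edges_between_def pseudograph_def)

lemma finite_edges_between: "finite (edges_between G u v)"
  using finite_edges by (simp add: edges_between_def)

lemma one_edge:
  assumes "1 \<le> card (edges_between G u v)"
  obtains e where "e \<in> edges_between G u v" "e \<in> edges_between G v u"
proof -
  have "edges_between G u v \<noteq> {}" using assms by auto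
  then show ?thesis using that edges_between_commute by blast
qed

lemma two_edges:
  assumes "2 \<le> card (edges_between G u v)"
  obtains e f where "e \<noteq> f" "e \<in> edges_between G u v" "f \<in> edges_between G u v"
    "e \<in> edges_between G v u" "f \<in> edges_between G v u"
proof -
  obtain T where "T \<subseteq> edges_between G u v" "card T = 2"
    using obtain_subset_with_card_n[OF assms] by blast
  then show ?thesis using that edges_between_commute by (auto simp: card_2_iff)
qed

lemma three_edges:
  assumes "3 \<le> card (edges_between G u v)"
  obtains e f g where "distinct [e, f, g]"
    "e \<in> edges_between G u v" "f \<in> edges_between G u v" "g \<in> edges_between G u v"
    "e \<in> edges_between G v u" "f \<in> edges_between G v u" "g \<in> edges_between G v u"
proof -
  obtain T where "T \<subseteq> edges_between G u v" "card T = 3"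
    using obtain_subset_with_card_n[OF assms] by blast
  then show ?thesis using that edges_between_commute by (auto simp: card_3_iff)
qed

text \<open>Turns known loops and links into an explicit star: links to different neighbors are
  disjoint, a loop fills two of the five places, and the length equation tells how many edges
  \<open>xs\<close> remain unnamed.\<close>

lemma star_shape:
  assumes v: "v \<in> verts G"
    and ls: "distinct ls" "\<forall>e\<in>set ls. e \<in> edges_between G v v"
    and ws: "distinct (map fst ws)" "v \<notin> fst ` set ws"
      "\<forall>(w, es)\<in>set ws. distinct es \<and> set es \<subseteq> edges_between G v w"
  shows "\<exists>xs. star G v = mset (ls @ ls @ concat (map snd ws) @ xs) \<and>
    length xs + 2 * length ls + length (concat (map snd ws)) = 5"
proof -
  let ?es = "concat (map snd ws)"
  have "distinct ?es"
    using ws(1,3)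
  proof (induction ws)
    case (Cons p ws)
    obtain w es where p: "p = (w, es)" by fastforce
    have "e \<notin> set es" if "(u, fs) \<in> set ws" "e \<in> set fs" for u fs e
    proof
      assume "e \<in> set es"
      then have "e \<in> edges_between G v w" using Cons.prems(2) p by auto
      moreover have "e \<in> edges_between G v u"
        using bspec[OF Cons.prems(2), of "(u, fs)"] that by auto
      ultimately have "u = w" by (simp add: edges_between_disjoint)
      then show False using Cons.prems(1) that p by force
    qed
    then show ?case using Cons p by fastforce
  qed simp
  have es: "e \<in># star G v \<and> e \<notin> set ls" if e: "e \<in> set ?es" for e
  proof -
    obtain w es where w: "(w, es) \<in> set ws" "e \<in> set es" using e by auto
    then have "e \<in> edges_between G v w" "w \<noteq> v" using ws(2,3) by force+
    then show ?thesis using in_star_between edges_between_disjoint ls(2) by blast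
  qed
  have "mset (ls @ ls @ ?es) \<subseteq># star G v"
  proof (rule mset_subset_eqI)
    fix e
    have ls_count: "count (mset ls) e = (if e \<in> set ls then 1 else 0)"
      using ls(1) by (simp add: distinct_count_atmost_1)
    have es_count: "count (mset ?es) e = (if e \<in> set ?es then 1 else 0)"
      using \<open>distinct ?es\<close> unfolding distinct_count_atmost_1 by blast
    have "e \<in> set ?es \<Longrightarrow> 1 \<le> count (star G v) e"
      using es by (simp only: Suc_le_eq One_nat_def count_greater_zero_iff)
    moreover have "e \<in> set ls \<Longrightarrow> count (star G v) e = 2" using ls(2) count_star_loop by blast
    ultimately show "count (mset (ls @ ls @ ?es)) e \<le> count (star G v) e"
      using es[of e] unfolding mset_append count_union ls_count es_count
        by (auto simp del: set_concat)
  qed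
  then obtain N where N: "star G v = mset (ls @ ls @ ?es) + N"
    using subset_mset.le_iff_add by blast
  obtain xs where "mset xs = N" using ex_mset by blast
  then have "star G v = mset (ls @ ls @ ?es @ xs)" using N by simp
  moreover from this have "length xs + 2 * length ls + length ?es = 5"
    using size_st[OF v] by (simp del: length_concat)
  ultimately show ?thesis by blast
qed

section \<open>The excluded configurations in terms of multiplicities\<close>

lemma no_triple_edge:
  assumes V: "{u, v} \<subseteq> verts G" "distinct [u, v]"
    and m: "3 \<le> card (edges_between G u v)"
  shows False
proof -
  obtain f1 f2 f3 where E1: "distinct [f1, f2, f3]"
      "f1 \<in> edges_between G u v" "f2 \<in> edges_between G u v" "f3 \<in> edges_between G u v"
      "f1 \<in> edges_between G v u" "f2 \<in> edges_between G v u" "f3 \<in> edges_between G v u"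
    using three_edges[OF m(1)] by blast
  obtain x x' where st_u: "star G u = {#f1, f2, f3, x, x'#}"
    using star_shape[of u "[]" "[(v, [f1, f2, f3])]"] V E1
    by (auto simp: length_Suc_conv numeral_2_eq_2 numeral_3_eq_3 add_mset_commute)
  obtain y y' where st_v: "star G v = {#f1, f2, f3, y, y'#}"
    using star_shape[of v "[]" "[(u, [f1, f2, f3])]"] V E1
    by (auto simp: length_Suc_conv numeral_2_eq_2 numeral_3_eq_3 add_mset_commute)
  show False by (rule no_triple_edge_star[OF V st_u st_v])
qed

lemma no_double_edge_at_loop:
  assumes V: "{u, v} \<subseteq> verts G" "distinct [u, v]"
    and m: "2 \<le> card (edges_between G u v)"
      "1 \<le> card (edges_between G u u)"
  shows False
proof -
  obtain f1 f2 where E1: "f1 \<noteq> f2" "f1 \<in> edges_between G u v" "f2 \<in> edges_between G u v"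
      "f1 \<in> edges_between G v u" "f2 \<in> edges_between G v u"
    using two_edges[OF m(1)] by blast
  obtain l where E2: "l \<in> edges_between G u u"
    using one_edge[OF m(2)] by blast
  obtain e where st_u: "star G u = {#l, l, f1, f2, e#}"
    using star_shape[of u "[l]" "[(v, [f1, f2])]"] V E1 E2
    by (auto simp: length_Suc_conv numeral_2_eq_2 numeral_3_eq_3 add_mset_commute)
  obtain y1 y2 y3 where st_v: "star G v = {#f1, f2, y1, y2, y3#}"
    using star_shape[of v "[]" "[(u, [f1, f2])]"] V E1
    by (auto simp: length_Suc_conv numeral_2_eq_2 numeral_3_eq_3 add_mset_commute)
  show False by (rule no_double_edge_at_loop_star[OF V st_u st_v])
qed

lemma no_adjacent_loops:
  assumes V: "{u, v} \<subseteq> verts G" "distinct [u, v]"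
    and m: "1 \<le> card (edges_between G u v)"
      "1 \<le> card (edges_between G u u)"
      "1 \<le> card (edges_between G v v)"
  shows False
proof -
  obtain f where E1: "f \<in> edges_between G u v" "f \<in> edges_between G v u"
    using one_edge[OF m(1)] by blast
  obtain l where E2: "l \<in> edges_between G u u"
    using one_edge[OF m(2)] by blast
  obtain m where E3: "m \<in> edges_between G v v"
    using one_edge[OF m(3)] by blast
  obtain x x' where st_u: "star G u = {#l, l, f, x, x'#}"
    using star_shape[of u "[l]" "[(v, [f])]"] V E1 E2
    by (auto simp: length_Suc_conv numeral_2_eq_2 numeral_3_eq_3 add_mset_commute)
  obtain y y' where st_v: "star G v = {#m, m, f, y, y'#}"
    using star_shape[of v "[m]" "[(u, [f])]"] V E1 E3
    by (auto simp: length_Suc_conv numeral_2_eq_2 numeral_3_eq_3 add_mset_commute)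
  show False by (rule no_adjacent_loops_star[OF V st_u st_v])
qed

lemma no_double_path:
  assumes V: "{v1, v2, v3, v4} \<subseteq> verts G" "distinct [v1, v2, v3, v4]"
    and m: "2 \<le> card (edges_between G v1 v2)"
      "2 \<le> card (edges_between G v2 v3)"
      "2 \<le> card (edges_between G v3 v4)"
  shows False
proof -
  obtain f1 f2 where E1: "f1 \<noteq> f2" "f1 \<in> edges_between G v1 v2" "f2 \<in> edges_between G v1 v2"
      "f1 \<in> edges_between G v2 v1" "f2 \<in> edges_between G v2 v1"
    using two_edges[OF m(1)] by blast
  obtain g1 g2 where E2: "g1 \<noteq> g2" "g1 \<in> edges_between G v2 v3" "g2 \<in> edges_between G v2 v3"
      "g1 \<in> edges_between G v3 v2" "g2 \<in> edges_between G v3 v2"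
    using two_edges[OF m(2)] by blast
  obtain h1 h2 where E3: "h1 \<noteq> h2" "h1 \<in> edges_between G v3 v4" "h2 \<in> edges_between G v3 v4"
      "h1 \<in> edges_between G v4 v3" "h2 \<in> edges_between G v4 v3"
    using two_edges[OF m(3)] by blast
  obtain M_v1 where st_v1: "star G v1 = {#f1, f2#} + M_v1"
    using star_shape[of v1 "[]" "[(v2, [f1, f2])]"] V E1
    by (auto simp: length_Suc_conv numeral_2_eq_2 numeral_3_eq_3 add_mset_commute)
  obtain e2 where st_v2: "star G v2 = {#f1, f2, g1, g2, e2#}"
    using star_shape[of v2 "[]" "[(v1, [f1, f2]), (v3, [g1, g2])]"] V E1 E2
    by (auto simp: length_Suc_conv numeral_2_eq_2 numeral_3_eq_3 add_mset_commute)
  obtain e3 where st_v3: "star G v3 = {#g1, g2, h1, h2, e3#}"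
    using star_shape[of v3 "[]" "[(v2, [g1, g2]), (v4, [h1, h2])]"] V E2 E3
    by (auto simp: length_Suc_conv numeral_2_eq_2 numeral_3_eq_3 add_mset_commute)
  obtain M_v4 where st_v4: "star G v4 = {#h1, h2#} + M_v4"
    using star_shape[of v4 "[]" "[(v3, [h1, h2])]"] V E3
    by (auto simp: length_Suc_conv numeral_2_eq_2 numeral_3_eq_3 add_mset_commute)
  show False by (rule no_double_path_star[OF V st_v1 st_v2 st_v3 st_v4])
qed

lemma no_4_loops_around:
  assumes V: "{v, u1, u2, u3, u4} \<subseteq> verts G" "distinct [v, u1, u2, u3, u4]"
    and m: "1 \<le> card (edges_between G v u1)"
      "1 \<le> card (edges_between G v u2)"
      "1 \<le> card (edges_between G v u3)"
      "1 \<le> card (edges_between G v u4)"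
      "1 \<le> card (edges_between G u1 u1)"
      "1 \<le> card (edges_between G u2 u2)"
      "1 \<le> card (edges_between G u3 u3)"
      "1 \<le> card (edges_between G u4 u4)"
  shows False
proof -
  obtain f1 where E1: "f1 \<in> edges_between G v u1" "f1 \<in> edges_between G u1 v"
    using one_edge[OF m(1)] by blast
  obtain f2 where E2: "f2 \<in> edges_between G v u2" "f2 \<in> edges_between G u2 v"
    using one_edge[OF m(2)] by blast
  obtain f3 where E3: "f3 \<in> edges_between G v u3" "f3 \<in> edges_between G u3 v"
    using one_edge[OF m(3)] by blast
  obtain f4 where E4: "f4 \<in> edges_between G v u4" "f4 \<in> edges_between G u4 v"
    using one_edge[OF m(4)] by blast
  obtain l1 where E5: "l1 \<in> edges_between G u1 u1"
    using one_edge[OF m(5)] by blast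
  obtain l2 where E6: "l2 \<in> edges_between G u2 u2"
    using one_edge[OF m(6)] by blast
  obtain l3 where E7: "l3 \<in> edges_between G u3 u3"
    using one_edge[OF m(7)] by blast
  obtain l4 where E8: "l4 \<in> edges_between G u4 u4"
    using one_edge[OF m(8)] by blast
  obtain e where st_v: "star G v = {#f1, f2, f3, f4, e#}"
    using star_shape[of v "[]" "[(u1, [f1]), (u2, [f2]), (u3, [f3]), (u4, [f4])]"] V E1 E2 E3 E4
    by (auto simp: length_Suc_conv numeral_2_eq_2 numeral_3_eq_3 add_mset_commute)
  obtain x1 z1 where st_u1: "star G u1 = {#l1, l1, f1, x1, z1#}"
    using star_shape[of u1 "[l1]" "[(v, [f1])]"] V E1 E5
    by (auto simp: length_Suc_conv numeral_2_eq_2 numeral_3_eq_3 add_mset_commute)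
  obtain x2 z2 where st_u2: "star G u2 = {#l2, l2, f2, x2, z2#}"
    using star_shape[of u2 "[l2]" "[(v, [f2])]"] V E2 E6
    by (auto simp: length_Suc_conv numeral_2_eq_2 numeral_3_eq_3 add_mset_commute)
  obtain x3 z3 where st_u3: "star G u3 = {#l3, l3, f3, x3, z3#}"
    using star_shape[of u3 "[l3]" "[(v, [f3])]"] V E3 E7
    by (auto simp: length_Suc_conv numeral_2_eq_2 numeral_3_eq_3 add_mset_commute)
  obtain x4 z4 where st_u4: "star G u4 = {#l4, l4, f4, x4, z4#}"
    using star_shape[of u4 "[l4]" "[(v, [f4])]"] V E4 E8
    by (auto simp: length_Suc_conv numeral_2_eq_2 numeral_3_eq_3 add_mset_commute)
  show False by (rule no_4_loops_around_star[OF V st_v st_u1 st_u2 st_u3 st_u4])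
qed

lemma no_K33:
  assumes V: "{u1, u2, u3, v1, v2, v3} \<subseteq> verts G" "distinct [u1, u2, u3, v1, v2, v3]"
    and m: "1 \<le> card (edges_between G u1 v1)"
      "1 \<le> card (edges_between G u1 v2)"
      "1 \<le> card (edges_between G u1 v3)"
      "1 \<le> card (edges_between G u2 v1)"
      "1 \<le> card (edges_between G u2 v2)"
      "1 \<le> card (edges_between G u2 v3)"
      "1 \<le> card (edges_between G u3 v1)"
      "1 \<le> card (edges_between G u3 v2)"
      "1 \<le> card (edges_between G u3 v3)"
      "1 \<le> card (edges_between G u1 u1)"
      "1 \<le> card (edges_between G u2 u2)"
      "1 \<le> card (edges_between G u3 u3)"
  shows False
proof -
  obtain f11 where E1: "f11 \<in> edges_between G u1 v1" "f11 \<in> edges_between G v1 u1"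
    using one_edge[OF m(1)] by blast
  obtain f12 where E2: "f12 \<in> edges_between G u1 v2" "f12 \<in> edges_between G v2 u1"
    using one_edge[OF m(2)] by blast
  obtain f13 where E3: "f13 \<in> edges_between G u1 v3" "f13 \<in> edges_between G v3 u1"
    using one_edge[OF m(3)] by blast
  obtain f21 where E4: "f21 \<in> edges_between G u2 v1" "f21 \<in> edges_between G v1 u2"
    using one_edge[OF m(4)] by blast
  obtain f22 where E5: "f22 \<in> edges_between G u2 v2" "f22 \<in> edges_between G v2 u2"
    using one_edge[OF m(5)] by blast
  obtain f23 where E6: "f23 \<in> edges_between G u2 v3" "f23 \<in> edges_between G v3 u2"
    using one_edge[OF m(6)] by blast
  obtain f31 where E7: "f31 \<in> edges_between G u3 v1" "f31 \<in> edges_between G v1 u3"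
    using one_edge[OF m(7)] by blast
  obtain f32 where E8: "f32 \<in> edges_between G u3 v2" "f32 \<in> edges_between G v2 u3"
    using one_edge[OF m(8)] by blast
  obtain f33 where E9: "f33 \<in> edges_between G u3 v3" "f33 \<in> edges_between G v3 u3"
    using one_edge[OF m(9)] by blast
  obtain l1 where E10: "l1 \<in> edges_between G u1 u1"
    using one_edge[OF m(10)] by blast
  obtain l2 where E11: "l2 \<in> edges_between G u2 u2"
    using one_edge[OF m(11)] by blast
  obtain l3 where E12: "l3 \<in> edges_between G u3 u3"
    using one_edge[OF m(12)] by blast
  have st_u1: "star G u1 = {#l1, l1, f11, f12, f13#}"
    using star_shape[of u1 "[l1]" "[(v1, [f11]), (v2, [f12]), (v3, [f13])]"] V E1 E2 E3 E10
    by (auto simp: length_Suc_conv numeral_2_eq_2 numeral_3_eq_3 add_mset_commute)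
  have st_u2: "star G u2 = {#l2, l2, f21, f22, f23#}"
    using star_shape[of u2 "[l2]" "[(v1, [f21]), (v2, [f22]), (v3, [f23])]"] V E4 E5 E6 E11
    by (auto simp: length_Suc_conv numeral_2_eq_2 numeral_3_eq_3 add_mset_commute)
  have st_u3: "star G u3 = {#l3, l3, f31, f32, f33#}"
    using star_shape[of u3 "[l3]" "[(v1, [f31]), (v2, [f32]), (v3, [f33])]"] V E7 E8 E9 E12
    by (auto simp: length_Suc_conv numeral_2_eq_2 numeral_3_eq_3 add_mset_commute)
  obtain y1 z1 where st_v1: "star G v1 = {#f11, f21, f31, y1, z1#}"
    using star_shape[of v1 "[]" "[(u1, [f11]), (u2, [f21]), (u3, [f31])]"] V E1 E4 E7
    by (auto simp: length_Suc_conv numeral_2_eq_2 numeral_3_eq_3 add_mset_commute)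
  obtain y2 z2 where st_v2: "star G v2 = {#f12, f22, f32, y2, z2#}"
    using star_shape[of v2 "[]" "[(u1, [f12]), (u2, [f22]), (u3, [f32])]"] V E2 E5 E8
    by (auto simp: length_Suc_conv numeral_2_eq_2 numeral_3_eq_3 add_mset_commute)
  obtain y3 z3 where st_v3: "star G v3 = {#f13, f23, f33, y3, z3#}"
    using star_shape[of v3 "[]" "[(u1, [f13]), (u2, [f23]), (u3, [f33])]"] V E3 E6 E9
    by (auto simp: length_Suc_conv numeral_2_eq_2 numeral_3_eq_3 add_mset_commute)
  show False by (rule no_K33_star[OF V st_u1 st_u2 st_u3 st_v1 st_v2 st_v3])
qed

lemma no_dense4_config_A:
  assumes V: "{a, b, c, d} \<subseteq> verts G" "distinct [a, b, c, d]"
    and m: "2 \<le> card (edges_between G a b)"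
      "2 \<le> card (edges_between G b c)"
      "1 \<le> card (edges_between G a c)"
      "1 \<le> card (edges_between G a d)"
      "1 \<le> card (edges_between G b d)"
      "1 \<le> card (edges_between G c d)"
  shows False
proof -
  obtain k1 k2 where E1: "k1 \<noteq> k2" "k1 \<in> edges_between G a b" "k2 \<in> edges_between G a b"
      "k1 \<in> edges_between G b a" "k2 \<in> edges_between G b a"
    using two_edges[OF m(1)] by blast
  obtain m1 m2 where E2: "m1 \<noteq> m2" "m1 \<in> edges_between G b c" "m2 \<in> edges_between G b c"
      "m1 \<in> edges_between G c b" "m2 \<in> edges_between G c b"
    using two_edges[OF m(2)] by blast
  obtain p where E3: "p \<in> edges_between G a c" "p \<in> edges_between G c a"
    using one_edge[OF m(3)] by blast
  obtain q where E4: "q \<in> edges_between G a d" "q \<in> edges_between G d a"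
    using one_edge[OF m(4)] by blast
  obtain r where E5: "r \<in> edges_between G b d" "r \<in> edges_between G d b"
    using one_edge[OF m(5)] by blast
  obtain s where E6: "s \<in> edges_between G c d" "s \<in> edges_between G d c"
    using one_edge[OF m(6)] by blast
  obtain x where st_a: "star G a = {#k1, k2, p, q, x#}"
    using star_shape[of a "[]" "[(b, [k1, k2]), (c, [p]), (d, [q])]"] V E1 E3 E4
    by (auto simp: length_Suc_conv numeral_2_eq_2 numeral_3_eq_3 add_mset_commute)
  have st_b: "star G b = {#k1, k2, m1, m2, r#}"
    using star_shape[of b "[]" "[(a, [k1, k2]), (c, [m1, m2]), (d, [r])]"] V E1 E2 E5
    by (auto simp: length_Suc_conv numeral_2_eq_2 numeral_3_eq_3 add_mset_commute)
  obtain y where st_c: "star G c = {#m1, m2, p, s, y#}"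
    using star_shape[of c "[]" "[(b, [m1, m2]), (a, [p]), (d, [s])]"] V E2 E3 E6
    by (auto simp: length_Suc_conv numeral_2_eq_2 numeral_3_eq_3 add_mset_commute)
  obtain z z' where st_d: "star G d = {#q, r, s, z, z'#}"
    using star_shape[of d "[]" "[(a, [q]), (b, [r]), (c, [s])]"] V E4 E5 E6
    by (auto simp: length_Suc_conv numeral_2_eq_2 numeral_3_eq_3 add_mset_commute)
  show False by (rule no_dense4_A[OF V st_a st_b st_c st_d])
qed

lemma no_dense4_config_B1:
  assumes V: "{p, a, b, c} \<subseteq> verts G" "distinct [p, a, b, c]"
    and m: "1 \<le> card (edges_between G p b)"
      "2 \<le> card (edges_between G a b)"
      "2 \<le> card (edges_between G b c)"
      "1 \<le> card (edges_between G a c)"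
      "2 \<le> card (edges_between G p p)"
  shows False
proof -
  obtain t where E1: "t \<in> edges_between G p b" "t \<in> edges_between G b p"
    using one_edge[OF m(1)] by blast
  obtain k1 k2 where E2: "k1 \<noteq> k2" "k1 \<in> edges_between G a b" "k2 \<in> edges_between G a b"
      "k1 \<in> edges_between G b a" "k2 \<in> edges_between G b a"
    using two_edges[OF m(2)] by blast
  obtain m1 m2 where E3: "m1 \<noteq> m2" "m1 \<in> edges_between G b c" "m2 \<in> edges_between G b c"
      "m1 \<in> edges_between G c b" "m2 \<in> edges_between G c b"
    using two_edges[OF m(3)] by blast
  obtain s where E4: "s \<in> edges_between G a c" "s \<in> edges_between G c a"
    using one_edge[OF m(4)] by blast
  obtain l l' where E5: "l \<noteq> l'" "l \<in> edges_between G p p" "l' \<in> edges_between G p p"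
    using two_edges[OF m(5)] by blast
  have st_p: "star G p = {#l, l, l', l', t#}"
    using star_shape[of p "[l, l']" "[(b, [t])]"] V E1 E5
    by (auto simp: length_Suc_conv numeral_2_eq_2 numeral_3_eq_3 add_mset_commute)
  obtain x x' where st_a: "star G a = {#k1, k2, s, x, x'#}"
    using star_shape[of a "[]" "[(b, [k1, k2]), (c, [s])]"] V E2 E4
    by (auto simp: length_Suc_conv numeral_2_eq_2 numeral_3_eq_3 add_mset_commute)
  have st_b: "star G b = {#k1, k2, m1, m2, t#}"
    using star_shape[of b "[]" "[(p, [t]), (a, [k1, k2]), (c, [m1, m2])]"] V E1 E2 E3
    by (auto simp: length_Suc_conv numeral_2_eq_2 numeral_3_eq_3 add_mset_commute)
  obtain y y' where st_c: "star G c = {#m1, m2, s, y, y'#}"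
    using star_shape[of c "[]" "[(b, [m1, m2]), (a, [s])]"] V E3 E4
    by (auto simp: length_Suc_conv numeral_2_eq_2 numeral_3_eq_3 add_mset_commute)
  show False by (rule no_dense4_B1[OF V st_p st_a st_b st_c])
qed

lemma no_dense4_config_B2:
  assumes V: "{p, a, b, c} \<subseteq> verts G" "distinct [p, a, b, c]"
    and m: "1 \<le> card (edges_between G p a)"
      "2 \<le> card (edges_between G a b)"
      "2 \<le> card (edges_between G b c)"
      "1 \<le> card (edges_between G a c)"
      "2 \<le> card (edges_between G p p)"
  shows False
proof -
  obtain t where E1: "t \<in> edges_between G p a" "t \<in> edges_between G a p"
    using one_edge[OF m(1)] by blast
  obtain k1 k2 where E2: "k1 \<noteq> k2" "k1 \<in> edges_between G a b" "k2 \<in> edges_between G a b"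
      "k1 \<in> edges_between G b a" "k2 \<in> edges_between G b a"
    using two_edges[OF m(2)] by blast
  obtain m1 m2 where E3: "m1 \<noteq> m2" "m1 \<in> edges_between G b c" "m2 \<in> edges_between G b c"
      "m1 \<in> edges_between G c b" "m2 \<in> edges_between G c b"
    using two_edges[OF m(3)] by blast
  obtain s where E4: "s \<in> edges_between G a c" "s \<in> edges_between G c a"
    using one_edge[OF m(4)] by blast
  obtain l l' where E5: "l \<noteq> l'" "l \<in> edges_between G p p" "l' \<in> edges_between G p p"
    using two_edges[OF m(5)] by blast
  have st_p: "star G p = {#l, l, l', l', t#}"
    using star_shape[of p "[l, l']" "[(a, [t])]"] V E1 E5
    by (auto simp: length_Suc_conv numeral_2_eq_2 numeral_3_eq_3 add_mset_commute)
  obtain x where st_a: "star G a = {#t, k1, k2, s, x#}"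
    using star_shape[of a "[]" "[(p, [t]), (b, [k1, k2]), (c, [s])]"] V E1 E2 E4
    by (auto simp: length_Suc_conv numeral_2_eq_2 numeral_3_eq_3 add_mset_commute)
  obtain y where st_b: "star G b = {#k1, k2, m1, m2, y#}"
    using star_shape[of b "[]" "[(a, [k1, k2]), (c, [m1, m2])]"] V E2 E3
    by (auto simp: length_Suc_conv numeral_2_eq_2 numeral_3_eq_3 add_mset_commute)
  obtain z z' where st_c: "star G c = {#m1, m2, s, z, z'#}"
    using star_shape[of c "[]" "[(b, [m1, m2]), (a, [s])]"] V E3 E4
    by (auto simp: length_Suc_conv numeral_2_eq_2 numeral_3_eq_3 add_mset_commute)
  show False by (rule no_dense4_B2[OF V st_p st_a st_b st_c])
qed

lemma no_dense4_config_C1: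
  assumes V: "{p, a, b, c} \<subseteq> verts G" "distinct [p, a, b, c]"
    and m: "1 \<le> card (edges_between G p a)"
      "1 \<le> card (edges_between G p b)"
      "1 \<le> card (edges_between G p c)"
      "2 \<le> card (edges_between G a b)"
      "1 \<le> card (edges_between G b c)"
      "1 \<le> card (edges_between G a c)"
      "1 \<le> card (edges_between G p p)"
  shows False
proof -
  obtain t1 where E1: "t1 \<in> edges_between G p a" "t1 \<in> edges_between G a p"
    using one_edge[OF m(1)] by blast
  obtain t2 where E2: "t2 \<in> edges_between G p b" "t2 \<in> edges_between G b p"
    using one_edge[OF m(2)] by blast
  obtain t3 where E3: "t3 \<in> edges_between G p c" "t3 \<in> edges_between G c p"
    using one_edge[OF m(3)] by blast
  obtain k1 k2 where E4: "k1 \<noteq> k2" "k1 \<in> edges_between G a b" "k2 \<in> edges_between G a b"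
      "k1 \<in> edges_between G b a" "k2 \<in> edges_between G b a"
    using two_edges[OF m(4)] by blast
  obtain r where E5: "r \<in> edges_between G b c" "r \<in> edges_between G c b"
    using one_edge[OF m(5)] by blast
  obtain s where E6: "s \<in> edges_between G a c" "s \<in> edges_between G c a"
    using one_edge[OF m(6)] by blast
  obtain l where E7: "l \<in> edges_between G p p"
    using one_edge[OF m(7)] by blast
  have st_p: "star G p = {#l, l, t1, t2, t3#}"
    using star_shape[of p "[l]" "[(a, [t1]), (b, [t2]), (c, [t3])]"] V E1 E2 E3 E7
    by (auto simp: length_Suc_conv numeral_2_eq_2 numeral_3_eq_3 add_mset_commute)
  obtain x where st_a: "star G a = {#t1, k1, k2, s, x#}"
    using star_shape[of a "[]" "[(p, [t1]), (b, [k1, k2]), (c, [s])]"] V E1 E4 E6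
    by (auto simp: length_Suc_conv numeral_2_eq_2 numeral_3_eq_3 add_mset_commute)
  obtain y where st_b: "star G b = {#t2, k1, k2, r, y#}"
    using star_shape[of b "[]" "[(p, [t2]), (a, [k1, k2]), (c, [r])]"] V E2 E4 E5
    by (auto simp: length_Suc_conv numeral_2_eq_2 numeral_3_eq_3 add_mset_commute)
  obtain z z' where st_c: "star G c = {#t3, r, s, z, z'#}"
    using star_shape[of c "[]" "[(p, [t3]), (b, [r]), (a, [s])]"] V E3 E5 E6
    by (auto simp: length_Suc_conv numeral_2_eq_2 numeral_3_eq_3 add_mset_commute)
  show False by (rule no_dense4_C1[OF V st_p st_a st_b st_c])
qed

lemma no_dense4_config_C2:
  assumes V: "{p, a, b, c} \<subseteq> verts G" "distinct [p, a, b, c]"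
    and m: "1 \<le> card (edges_between G p a)"
      "1 \<le> card (edges_between G p b)"
      "1 \<le> card (edges_between G p c)"
      "2 \<le> card (edges_between G a b)"
      "2 \<le> card (edges_between G b c)"
      "1 \<le> card (edges_between G p p)"
  shows False
proof -
  obtain t1 where E1: "t1 \<in> edges_between G p a" "t1 \<in> edges_between G a p"
    using one_edge[OF m(1)] by blast
  obtain t2 where E2: "t2 \<in> edges_between G p b" "t2 \<in> edges_between G b p"
    using one_edge[OF m(2)] by blast
  obtain t3 where E3: "t3 \<in> edges_between G p c" "t3 \<in> edges_between G c p"
    using one_edge[OF m(3)] by blast
  obtain k1 k2 where E4: "k1 \<noteq> k2" "k1 \<in> edges_between G a b" "k2 \<in> edges_between G a b"
      "k1 \<in> edges_between G b a" "k2 \<in> edges_between G b a"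
    using two_edges[OF m(4)] by blast
  obtain m1 m2 where E5: "m1 \<noteq> m2" "m1 \<in> edges_between G b c" "m2 \<in> edges_between G b c"
      "m1 \<in> edges_between G c b" "m2 \<in> edges_between G c b"
    using two_edges[OF m(5)] by blast
  obtain l where E6: "l \<in> edges_between G p p"
    using one_edge[OF m(6)] by blast
  have st_p: "star G p = {#l, l, t1, t2, t3#}"
    using star_shape[of p "[l]" "[(a, [t1]), (b, [t2]), (c, [t3])]"] V E1 E2 E3 E6
    by (auto simp: length_Suc_conv numeral_2_eq_2 numeral_3_eq_3 add_mset_commute)
  obtain x x' where st_a: "star G a = {#t1, k1, k2, x, x'#}"
    using star_shape[of a "[]" "[(p, [t1]), (b, [k1, k2])]"] V E1 E4
    by (auto simp: length_Suc_conv numeral_2_eq_2 numeral_3_eq_3 add_mset_commute)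
  have st_b: "star G b = {#t2, k1, k2, m1, m2#}"
    using star_shape[of b "[]" "[(p, [t2]), (a, [k1, k2]), (c, [m1, m2])]"] V E2 E4 E5
    by (auto simp: length_Suc_conv numeral_2_eq_2 numeral_3_eq_3 add_mset_commute)
  obtain y y' where st_c: "star G c = {#t3, m1, m2, y, y'#}"
    using star_shape[of c "[]" "[(p, [t3]), (b, [m1, m2])]"] V E3 E5
    by (auto simp: length_Suc_conv numeral_2_eq_2 numeral_3_eq_3 add_mset_commute)
  show False by (rule no_dense4_C2[OF V st_p st_a st_b st_c])
qed

lemma no_dense4_config_C3:
  assumes V: "{p, a, b, c} \<subseteq> verts G" "distinct [p, a, b, c]"
    and m: "1 \<le> card (edges_between G p a)"
      "1 \<le> card (edges_between G p b)"
      "2 \<le> card (edges_between G a b)"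
      "2 \<le> card (edges_between G b c)"
      "1 \<le> card (edges_between G a c)"
      "1 \<le> card (edges_between G p p)"
  shows False
proof -
  obtain t1 where E1: "t1 \<in> edges_between G p a" "t1 \<in> edges_between G a p"
    using one_edge[OF m(1)] by blast
  obtain t2 where E2: "t2 \<in> edges_between G p b" "t2 \<in> edges_between G b p"
    using one_edge[OF m(2)] by blast
  obtain k1 k2 where E3: "k1 \<noteq> k2" "k1 \<in> edges_between G a b" "k2 \<in> edges_between G a b"
      "k1 \<in> edges_between G b a" "k2 \<in> edges_between G b a"
    using two_edges[OF m(3)] by blast
  obtain m1 m2 where E4: "m1 \<noteq> m2" "m1 \<in> edges_between G b c" "m2 \<in> edges_between G b c"
      "m1 \<in> edges_between G c b" "m2 \<in> edges_between G c b"
    using two_edges[OF m(4)] by blast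
  obtain s where E5: "s \<in> edges_between G a c" "s \<in> edges_between G c a"
    using one_edge[OF m(5)] by blast
  obtain l where E6: "l \<in> edges_between G p p"
    using one_edge[OF m(6)] by blast
  obtain e where st_p: "star G p = {#l, l, t1, t2, e#}"
    using star_shape[of p "[l]" "[(a, [t1]), (b, [t2])]"] V E1 E2 E6
    by (auto simp: length_Suc_conv numeral_2_eq_2 numeral_3_eq_3 add_mset_commute)
  obtain x where st_a: "star G a = {#t1, k1, k2, s, x#}"
    using star_shape[of a "[]" "[(p, [t1]), (b, [k1, k2]), (c, [s])]"] V E1 E3 E5
    by (auto simp: length_Suc_conv numeral_2_eq_2 numeral_3_eq_3 add_mset_commute)
  have st_b: "star G b = {#t2, k1, k2, m1, m2#}"
    using star_shape[of b "[]" "[(p, [t2]), (a, [k1, k2]), (c, [m1, m2])]"] V E2 E3 E4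
    by (auto simp: length_Suc_conv numeral_2_eq_2 numeral_3_eq_3 add_mset_commute)
  obtain y y' where st_c: "star G c = {#m1, m2, s, y, y'#}"
    using star_shape[of c "[]" "[(b, [m1, m2]), (a, [s])]"] V E4 E5
    by (auto simp: length_Suc_conv numeral_2_eq_2 numeral_3_eq_3 add_mset_commute)
  show False by (rule no_dense4_C3[OF V st_p st_a st_b st_c])
qed

lemma no_dense4_config_C4:
  assumes V: "{p, a, b, c} \<subseteq> verts G" "distinct [p, a, b, c]"
    and m: "1 \<le> card (edges_between G p a)"
      "1 \<le> card (edges_between G p c)"
      "2 \<le> card (edges_between G a b)"
      "2 \<le> card (edges_between G b c)"
      "1 \<le> card (edges_between G a c)"
      "1 \<le> card (edges_between G p p)"
  shows False
proof -
  obtain t1 where E1: "t1 \<in> edges_between G p a" "t1 \<in> edges_between G a p"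
    using one_edge[OF m(1)] by blast
  obtain t3 where E2: "t3 \<in> edges_between G p c" "t3 \<in> edges_between G c p"
    using one_edge[OF m(2)] by blast
  obtain k1 k2 where E3: "k1 \<noteq> k2" "k1 \<in> edges_between G a b" "k2 \<in> edges_between G a b"
      "k1 \<in> edges_between G b a" "k2 \<in> edges_between G b a"
    using two_edges[OF m(3)] by blast
  obtain m1 m2 where E4: "m1 \<noteq> m2" "m1 \<in> edges_between G b c" "m2 \<in> edges_between G b c"
      "m1 \<in> edges_between G c b" "m2 \<in> edges_between G c b"
    using two_edges[OF m(4)] by blast
  obtain s where E5: "s \<in> edges_between G a c" "s \<in> edges_between G c a"
    using one_edge[OF m(5)] by blast
  obtain l where E6: "l \<in> edges_between G p p"
    using one_edge[OF m(6)] by blast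
  obtain e where st_p: "star G p = {#l, l, t1, t3, e#}"
    using star_shape[of p "[l]" "[(a, [t1]), (c, [t3])]"] V E1 E2 E6
    by (auto simp: length_Suc_conv numeral_2_eq_2 numeral_3_eq_3 add_mset_commute)
  obtain x where st_a: "star G a = {#t1, k1, k2, s, x#}"
    using star_shape[of a "[]" "[(p, [t1]), (b, [k1, k2]), (c, [s])]"] V E1 E3 E5
    by (auto simp: length_Suc_conv numeral_2_eq_2 numeral_3_eq_3 add_mset_commute)
  obtain y where st_b: "star G b = {#k1, k2, m1, m2, y#}"
    using star_shape[of b "[]" "[(a, [k1, k2]), (c, [m1, m2])]"] V E3 E4
    by (auto simp: length_Suc_conv numeral_2_eq_2 numeral_3_eq_3 add_mset_commute)
  obtain z where st_c: "star G c = {#t3, m1, m2, s, z#}"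
    using star_shape[of c "[]" "[(p, [t3]), (b, [m1, m2]), (a, [s])]"] V E2 E4 E5
    by (auto simp: length_Suc_conv numeral_2_eq_2 numeral_3_eq_3 add_mset_commute)
  show False by (rule no_dense4_C4[OF V st_p st_a st_b st_c])
qed

lemma no_dense4_config_E1:
  assumes V: "{p, q, a, b} \<subseteq> verts G" "distinct [p, q, a, b]"
    and m: "1 \<le> card (edges_between G p a)"
      "1 \<le> card (edges_between G p b)"
      "1 \<le> card (edges_between G q a)"
      "1 \<le> card (edges_between G q b)"
      "2 \<le> card (edges_between G a b)"
      "1 \<le> card (edges_between G p p)"
      "1 \<le> card (edges_between G q q)"
  shows False
proof -
  obtain t1 where E1: "t1 \<in> edges_between G p a" "t1 \<in> edges_between G a p"
    using one_edge[OF m(1)] by blast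
  obtain t2 where E2: "t2 \<in> edges_between G p b" "t2 \<in> edges_between G b p"
    using one_edge[OF m(2)] by blast
  obtain r1 where E3: "r1 \<in> edges_between G q a" "r1 \<in> edges_between G a q"
    using one_edge[OF m(3)] by blast
  obtain r2 where E4: "r2 \<in> edges_between G q b" "r2 \<in> edges_between G b q"
    using one_edge[OF m(4)] by blast
  obtain k1 k2 where E5: "k1 \<noteq> k2" "k1 \<in> edges_between G a b" "k2 \<in> edges_between G a b"
      "k1 \<in> edges_between G b a" "k2 \<in> edges_between G b a"
    using two_edges[OF m(5)] by blast
  obtain l where E6: "l \<in> edges_between G p p"
    using one_edge[OF m(6)] by blast
  obtain l' where E7: "l' \<in> edges_between G q q"
    using one_edge[OF m(7)] by blast
  obtain e where st_p: "star G p = {#l, l, t1, t2, e#}"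
    using star_shape[of p "[l]" "[(a, [t1]), (b, [t2])]"] V E1 E2 E6
    by (auto simp: length_Suc_conv numeral_2_eq_2 numeral_3_eq_3 add_mset_commute)
  obtain e' where st_q: "star G q = {#l', l', r1, r2, e'#}"
    using star_shape[of q "[l']" "[(a, [r1]), (b, [r2])]"] V E3 E4 E7
    by (auto simp: length_Suc_conv numeral_2_eq_2 numeral_3_eq_3 add_mset_commute)
  obtain x where st_a: "star G a = {#t1, r1, k1, k2, x#}"
    using star_shape[of a "[]" "[(p, [t1]), (q, [r1]), (b, [k1, k2])]"] V E1 E3 E5
    by (auto simp: length_Suc_conv numeral_2_eq_2 numeral_3_eq_3 add_mset_commute)
  obtain y where st_b: "star G b = {#t2, r2, k1, k2, y#}"
    using star_shape[of b "[]" "[(p, [t2]), (q, [r2]), (a, [k1, k2])]"] V E2 E4 E5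
    by (auto simp: length_Suc_conv numeral_2_eq_2 numeral_3_eq_3 add_mset_commute)
  show False by (rule no_dense4_E1[OF V st_p st_q st_a st_b])
qed

lemma no_dense4_config_E2:
  assumes V: "{p, q, a, b} \<subseteq> verts G" "distinct [p, q, a, b]"
    and m: "1 \<le> card (edges_between G p a)"
      "1 \<le> card (edges_between G q a)"
      "1 \<le> card (edges_between G q b)"
      "2 \<le> card (edges_between G a b)"
      "2 \<le> card (edges_between G p p)"
      "1 \<le> card (edges_between G q q)"
  shows False
proof -
  obtain t where E1: "t \<in> edges_between G p a" "t \<in> edges_between G a p"
    using one_edge[OF m(1)] by blast
  obtain r1 where E2: "r1 \<in> edges_between G q a" "r1 \<in> edges_between G a q"
    using one_edge[OF m(2)] by blast
  obtain r2 where E3: "r2 \<in> edges_between G q b" "r2 \<in> edges_between G b q"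
    using one_edge[OF m(3)] by blast
  obtain k1 k2 where E4: "k1 \<noteq> k2" "k1 \<in> edges_between G a b" "k2 \<in> edges_between G a b"
      "k1 \<in> edges_between G b a" "k2 \<in> edges_between G b a"
    using two_edges[OF m(4)] by blast
  obtain l l' where E5: "l \<noteq> l'" "l \<in> edges_between G p p" "l' \<in> edges_between G p p"
    using two_edges[OF m(5)] by blast
  obtain m where E6: "m \<in> edges_between G q q"
    using one_edge[OF m(6)] by blast
  have st_p: "star G p = {#l, l, l', l', t#}"
    using star_shape[of p "[l, l']" "[(a, [t])]"] V E1 E5
    by (auto simp: length_Suc_conv numeral_2_eq_2 numeral_3_eq_3 add_mset_commute)
  obtain e where st_q: "star G q = {#m, m, r1, r2, e#}"
    using star_shape[of q "[m]" "[(a, [r1]), (b, [r2])]"] V E2 E3 E6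
    by (auto simp: length_Suc_conv numeral_2_eq_2 numeral_3_eq_3 add_mset_commute)
  obtain x where st_a: "star G a = {#t, r1, k1, k2, x#}"
    using star_shape[of a "[]" "[(p, [t]), (q, [r1]), (b, [k1, k2])]"] V E1 E2 E4
    by (auto simp: length_Suc_conv numeral_2_eq_2 numeral_3_eq_3 add_mset_commute)
  obtain y y' where st_b: "star G b = {#r2, k1, k2, y, y'#}"
    using star_shape[of b "[]" "[(q, [r2]), (a, [k1, k2])]"] V E3 E4
    by (auto simp: length_Suc_conv numeral_2_eq_2 numeral_3_eq_3 add_mset_commute)
  show False by (rule no_dense4_E2[OF V st_p st_q st_a st_b])
qed

lemma no_two_double_loops:
  assumes V: "{p, q} \<subseteq> verts G" "distinct [p, q]"
    and m: "2 \<le> card (edges_between G p p)"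
      "2 \<le> card (edges_between G q q)"
  shows False
proof -
  obtain l l' where E1: "l \<noteq> l'" "l \<in> edges_between G p p" "l' \<in> edges_between G p p"
    using two_edges[OF m(1)] by blast
  obtain m m' where E2: "m \<noteq> m'" "m \<in> edges_between G q q" "m' \<in> edges_between G q q"
    using two_edges[OF m(2)] by blast
  obtain x where st_p: "star G p = {#l, l, l', l', x#}"
    using star_shape[of p "[l, l']" "[]"] V E1
    by (auto simp: length_Suc_conv numeral_2_eq_2 numeral_3_eq_3 add_mset_commute)
  obtain y where st_q: "star G q = {#m, m, m', m', y#}"
    using star_shape[of q "[m, m']" "[]"] V E2
    by (auto simp: length_Suc_conv numeral_2_eq_2 numeral_3_eq_3 add_mset_commute)
  show False by (rule no_two_double_loops_star[OF V st_p st_q])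
qed

lemma no_doubled_K4:
  assumes V: "{a, b, c, d} \<subseteq> verts G" "distinct [a, b, c, d]"
    and m: "2 \<le> card (edges_between G a b)"
      "2 \<le> card (edges_between G c d)"
      "1 \<le> card (edges_between G a c)"
      "1 \<le> card (edges_between G a d)"
      "1 \<le> card (edges_between G b c)"
      "1 \<le> card (edges_between G b d)"
  shows False
proof -
  obtain k1 k2 where E1: "k1 \<noteq> k2" "k1 \<in> edges_between G a b" "k2 \<in> edges_between G a b"
      "k1 \<in> edges_between G b a" "k2 \<in> edges_between G b a"
    using two_edges[OF m(1)] by blast
  obtain n1 n2 where E2: "n1 \<noteq> n2" "n1 \<in> edges_between G c d" "n2 \<in> edges_between G c d"
      "n1 \<in> edges_between G d c" "n2 \<in> edges_between G d c"
    using two_edges[OF m(2)] by blast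
  obtain p where E3: "p \<in> edges_between G a c" "p \<in> edges_between G c a"
    using one_edge[OF m(3)] by blast
  obtain q where E4: "q \<in> edges_between G a d" "q \<in> edges_between G d a"
    using one_edge[OF m(4)] by blast
  obtain r where E5: "r \<in> edges_between G b c" "r \<in> edges_between G c b"
    using one_edge[OF m(5)] by blast
  obtain s where E6: "s \<in> edges_between G b d" "s \<in> edges_between G d b"
    using one_edge[OF m(6)] by blast
  obtain x where st_a: "star G a = {#k1, k2, p, q, x#}"
    using star_shape[of a "[]" "[(b, [k1, k2]), (c, [p]), (d, [q])]"] V E1 E3 E4
    by (auto simp: length_Suc_conv numeral_2_eq_2 numeral_3_eq_3 add_mset_commute)
  obtain y where st_b: "star G b = {#k1, k2, r, s, y#}"
    using star_shape[of b "[]" "[(a, [k1, k2]), (c, [r]), (d, [s])]"] V E1 E5 E6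
    by (auto simp: length_Suc_conv numeral_2_eq_2 numeral_3_eq_3 add_mset_commute)
  obtain z where st_c: "star G c = {#n1, n2, p, r, z#}"
    using star_shape[of c "[]" "[(d, [n1, n2]), (a, [p]), (b, [r])]"] V E2 E3 E5
    by (auto simp: length_Suc_conv numeral_2_eq_2 numeral_3_eq_3 add_mset_commute)
  obtain w where st_d: "star G d = {#n1, n2, q, s, w#}"
    using star_shape[of d "[]" "[(c, [n1, n2]), (a, [q]), (b, [s])]"] V E2 E4 E6
    by (auto simp: length_Suc_conv numeral_2_eq_2 numeral_3_eq_3 add_mset_commute)
  show False by (rule no_doubled_K4_star[OF V st_a st_b st_c st_d])
qed

lemma no_double_triangle:
  assumes V: "{a, b, c} \<subseteq> verts G" "distinct [a, b, c]"
    and m: "2 \<le> card (edges_between G a b)"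
      "2 \<le> card (edges_between G b c)"
      "2 \<le> card (edges_between G a c)"
  shows False
proof -
  obtain k1 k2 where E1: "k1 \<noteq> k2" "k1 \<in> edges_between G a b" "k2 \<in> edges_between G a b"
      "k1 \<in> edges_between G b a" "k2 \<in> edges_between G b a"
    using two_edges[OF m(1)] by blast
  obtain m1 m2 where E2: "m1 \<noteq> m2" "m1 \<in> edges_between G b c" "m2 \<in> edges_between G b c"
      "m1 \<in> edges_between G c b" "m2 \<in> edges_between G c b"
    using two_edges[OF m(2)] by blast
  obtain s1 s2 where E3: "s1 \<noteq> s2" "s1 \<in> edges_between G a c" "s2 \<in> edges_between G a c"
      "s1 \<in> edges_between G c a" "s2 \<in> edges_between G c a"
    using two_edges[OF m(3)] by blast
  obtain x where st_a: "star G a = {#k1, k2, s1, s2, x#}"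
    using star_shape[of a "[]" "[(b, [k1, k2]), (c, [s1, s2])]"] V E1 E3
    by (auto simp: length_Suc_conv numeral_2_eq_2 numeral_3_eq_3 add_mset_commute)
  obtain y where st_b: "star G b = {#k1, k2, m1, m2, y#}"
    using star_shape[of b "[]" "[(a, [k1, k2]), (c, [m1, m2])]"] V E1 E2
    by (auto simp: length_Suc_conv numeral_2_eq_2 numeral_3_eq_3 add_mset_commute)
  obtain z where st_c: "star G c = {#m1, m2, s1, s2, z#}"
    using star_shape[of c "[]" "[(b, [m1, m2]), (a, [s1, s2])]"] V E2 E3
    by (auto simp: length_Suc_conv numeral_2_eq_2 numeral_3_eq_3 add_mset_commute)
  show False by (rule no_double_triangle_star[OF V st_a st_b st_c])
qed

end

section \<open>Four vertices spanning eight edges\<close>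

context minimal_uncolorable
begin

text \<open>All edges from \<open>v\<close> to itself and to \<open>ws\<close> are fed into
  \<open>star_shape\<close>, whose length equation then bounds them by the degree.\<close>

lemma loops_links_le_5:
  assumes v: "v \<in> verts G" and ws: "distinct (v # ws)"
  shows "2 * card (edges_between G v v) + (\<Sum>w\<leftarrow>ws. card (edges_between G v w)) \<le> 5"
proof -
  obtain ls where ls: "distinct ls" "set ls = edges_between G v v"
    using finite_distinct_list[OF finite_edges_between] by blast
  have "\<forall>w. \<exists>es. distinct es \<and> set es = edges_between G v w"
    using finite_distinct_list[OF finite_edges_between] by blast
  then obtain f where f: "\<And>w. distinct (f w)" "\<And>w. set (f w) = edges_between G v w" by metis
  have len: "length (f w) = card (edges_between G v w)" for w
    using distinct_card[OF f(1)] f(2) by metis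
  have "length ls = card (edges_between G v v)" using distinct_card ls by metis
  moreover have "2 * length ls + length (concat (map snd (map (\<lambda>w. (w, f w)) ws))) \<le> 5"
    using star_shape[OF v ls(1), of "map (\<lambda>w. (w, f w)) ws"] ls(2) f ws
    by (auto simp: comp_def image_iff)
  moreover have "length (concat (map snd (map (\<lambda>w. (w, f w)) ws))) = (\<Sum>w\<leftarrow>ws. card (edges_between G v w))"
    by (simp add: length_concat comp_def len)
  ultimately show ?thesis by simp
qed

abbreviation \<mu> :: "'v \<Rightarrow> 'v \<Rightarrow> nat" where
  "\<mu> u v \<equiv> card (edges_between G u v)"

lemma int_nonneg: "0 \<le> int n"
  by simp

text \<open>What remains for four vertices is linear arithmetic in their ten multiplicities; these
  equations carry it over to the integers.\<close>

lemmas nat_to_int =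
  zle_int[symmetric] int_int_eq[symmetric] of_nat_numeral of_nat_add of_nat_mult of_nat_1 of_nat_0

lemma mu_loop_le_2: "\<mu> v v \<le> 2"
proof (cases "v \<in> verts G")
  case True
  then show ?thesis using loops_links_le_5[of v "[]"] by simp
next
  case False
  then have "edges_between G v v = {}" using edges_between_verts by blast
  then show ?thesis by simp
qed

lemma mu_le_2: "u \<noteq> v \<Longrightarrow> \<mu> u v \<le> 2"
proof (rule ccontr)
  assume "u \<noteq> v" "\<not> \<mu> u v \<le> 2"
  then have m: "3 \<le> \<mu> u v" by simp
  obtain e where "e \<in> edges_between G u v" by (rule three_edges[OF m])
  then have "{u, v} \<subseteq> verts G" using edges_between_verts by blast
  then show False using no_triple_edge[of u v] m \<open>u \<noteq> v\<close> by simp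
qed

text \<open>Without loops eight edges need two doubled pairs. Three doubled pairs form a path, a
  triangle or a star, the star exceeding degree 5. With exactly two, all six pairs are adjacent,
  which is the doubled K4 or configuration A. The instances run through the placements of each
  configuration up to symmetry.\<close>

lemma dense4_no_loop_vertex:
  assumes V: "a \<in> verts G" "b \<in> verts G" "c \<in> verts G" "d \<in> verts G" "distinct [a, b, c, d]"
    and loops: "\<mu> a a = 0" "\<mu> b b = 0" "\<mu> c c = 0" "\<mu> d d = 0"
  shows "\<mu> a a + \<mu> b b + \<mu> c c + \<mu> d d +
      \<mu> a b + \<mu> a c + \<mu> a d + \<mu> b c + \<mu> b d + \<mu> c d \<le> 7"
proof -
  have comm: "\<mu> b a = \<mu> a b" "\<mu> c a = \<mu> a c" "\<mu> d a = \<mu> a d"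
    "\<mu> c b = \<mu> b c" "\<mu> d b = \<mu> b d" "\<mu> d c = \<mu> c d"
    by (simp_all only: edges_between_commute)
  have ne: "a \<noteq> b" "a \<noteq> c" "a \<noteq> d" "b \<noteq> c" "b \<noteq> d" "c \<noteq> d"
    using V(5) by auto
  show ?thesis
    using loops
      mu_le_2[of a b] mu_le_2[of a c] mu_le_2[of a d] mu_le_2[of b c] mu_le_2[of b d] mu_le_2[of c d]
      mu_loop_le_2[of a] mu_loop_le_2[of b] mu_loop_le_2[of c] mu_loop_le_2[of d]
      loops_links_le_5[of a "[b, c, d]"] loops_links_le_5[of b "[a, c, d]"]
      loops_links_le_5[of c "[a, b, d]"] loops_links_le_5[of d "[a, b, c]"]
      no_dense4_config_A[of a b c d] no_dense4_config_A[of a b d c]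
      no_dense4_config_A[of a c b d] no_dense4_config_A[of a c d b]
      no_dense4_config_A[of a d b c] no_dense4_config_A[of a d c b]
      no_dense4_config_A[of b a c d] no_dense4_config_A[of b a d c]
      no_dense4_config_A[of b c d a] no_dense4_config_A[of b d c a]
      no_dense4_config_A[of c a d b] no_dense4_config_A[of c b d a] no_doubled_K4[of a b c d]
      no_doubled_K4[of a c b d] no_doubled_K4[of a d b c] no_double_triangle[of a b c]
      no_double_triangle[of a b d] no_double_triangle[of a c d] no_double_triangle[of b c d]
      no_double_path[of a b c d] no_double_path[of a b d c] no_double_path[of a c b d]
      no_double_path[of a c d b] no_double_path[of a d b c] no_double_path[of a d c b]
      no_double_path[of b a c d] no_double_path[of b a d c] no_double_path[of b c a d]
      no_double_path[of b d a c] no_double_path[of c a b d] no_double_path[of c b a d]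
    by (simp add: V(1-4) ne ne[symmetric] comm del: One_nat_def,
      simp only: nat_to_int, smt (verit) int_nonneg)
qed

text \<open>Links of \<open>a\<close> are single, and \<open>b\<close>, \<open>c\<close>,
  \<open>d\<close> span at most five edges as no triangle is doubled. With one loop at
  \<open>a\<close>, eight edges need three links and at least four edges, giving C1 or C2, or two
  links and five edges, giving C3 or C4. Two loops leave room for one link: B1 or B2.\<close>

lemma dense4_one_loop_vertex:
  assumes V: "a \<in> verts G" "b \<in> verts G" "c \<in> verts G" "d \<in> verts G" "distinct [a, b, c, d]"
    and loops: "1 \<le> \<mu> a a" "\<mu> b b = 0" "\<mu> c c = 0" "\<mu> d d = 0"
  shows "\<mu> a a + \<mu> b b + \<mu> c c + \<mu> d d +
      \<mu> a b + \<mu> a c + \<mu> a d + \<mu> b c + \<mu> b d + \<mu> c d \<le> 7"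
proof -
  have comm: "\<mu> b a = \<mu> a b" "\<mu> c a = \<mu> a c" "\<mu> d a = \<mu> a d"
    "\<mu> c b = \<mu> b c" "\<mu> d b = \<mu> b d" "\<mu> d c = \<mu> c d"
    by (simp_all only: edges_between_commute)
  have ne: "a \<noteq> b" "a \<noteq> c" "a \<noteq> d" "b \<noteq> c" "b \<noteq> d" "c \<noteq> d"
    using V(5) by auto
  show ?thesis
    using loops
      mu_le_2[of a b] mu_le_2[of a c] mu_le_2[of a d] mu_le_2[of b c] mu_le_2[of b d] mu_le_2[of c d]
      mu_loop_le_2[of a] mu_loop_le_2[of b] mu_loop_le_2[of c] mu_loop_le_2[of d]
      loops_links_le_5[of a "[b, c, d]"] no_double_edge_at_loop[of a b]
      no_double_edge_at_loop[of a c] no_double_edge_at_loop[of a d]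
      no_double_triangle[of b c d] no_dense4_config_B1[of a b c d]
      no_dense4_config_B1[of a b d c] no_dense4_config_B1[of a c b d]
      no_dense4_config_B2[of a b c d] no_dense4_config_B2[of a b d c]
      no_dense4_config_B2[of a c b d] no_dense4_config_B2[of a c d b]
      no_dense4_config_B2[of a d b c] no_dense4_config_B2[of a d c b]
      no_dense4_config_C1[of a b c d] no_dense4_config_C1[of a b d c]
      no_dense4_config_C1[of a c d b] no_dense4_config_C2[of a b c d]
      no_dense4_config_C2[of a b d c] no_dense4_config_C2[of a c b d]
      no_dense4_config_C3[of a b c d] no_dense4_config_C3[of a b d c]
      no_dense4_config_C3[of a c b d] no_dense4_config_C3[of a c d b]
      no_dense4_config_C3[of a d b c] no_dense4_config_C3[of a d c b]
      no_dense4_config_C4[of a b c d] no_dense4_config_C4[of a b d c]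
      no_dense4_config_C4[of a c b d]
    by (simp add: V(1-4) ne ne[symmetric] comm del: One_nat_def,
      simp only: nat_to_int, smt (verit) int_nonneg)
qed

text \<open>\<open>a\<close> and \<open>b\<close> are not adjacent, their links are single, and at
  most one of them has two loops. Eight edges are reached only with one loop each, all four links
  and \<open>c\<close>, \<open>d\<close> doubled, which is E1, or with a second loop at the price of
  one link, which is E2.\<close>

lemma dense4_two_loop_vertices:
  assumes V: "a \<in> verts G" "b \<in> verts G" "c \<in> verts G" "d \<in> verts G" "distinct [a, b, c, d]"
    and loops: "1 \<le> \<mu> a a" "1 \<le> \<mu> b b" "\<mu> c c = 0" "\<mu> d d = 0"
  shows "\<mu> a a + \<mu> b b + \<mu> c c + \<mu> d d +
      \<mu> a b + \<mu> a c + \<mu> a d + \<mu> b c + \<mu> b d + \<mu> c d \<le> 7"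
proof -
  have comm: "\<mu> b a = \<mu> a b" "\<mu> c a = \<mu> a c" "\<mu> d a = \<mu> a d"
    "\<mu> c b = \<mu> b c" "\<mu> d b = \<mu> b d" "\<mu> d c = \<mu> c d"
    by (simp_all only: edges_between_commute)
  have ne: "a \<noteq> b" "a \<noteq> c" "a \<noteq> d" "b \<noteq> c" "b \<noteq> d" "c \<noteq> d"
    using V(5) by auto
  show ?thesis
    using loops
      mu_le_2[of a b] mu_le_2[of a c] mu_le_2[of a d] mu_le_2[of b c] mu_le_2[of b d] mu_le_2[of c d]
      mu_loop_le_2[of a] mu_loop_le_2[of b] mu_loop_le_2[of c] mu_loop_le_2[of d]
      loops_links_le_5[of a "[b, c, d]"] loops_links_le_5[of b "[a, c, d]"]
      no_double_edge_at_loop[of a c] no_double_edge_at_loop[of a d]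
      no_double_edge_at_loop[of b c] no_double_edge_at_loop[of b d] no_adjacent_loops[of a b]
      no_two_double_loops[of a b] no_dense4_config_E1[of a b c d]
      no_dense4_config_E2[of a b c d] no_dense4_config_E2[of a b d c]
      no_dense4_config_E2[of b a c d] no_dense4_config_E2[of b a d c]
    by (simp add: V(1-4) ne ne[symmetric] comm del: One_nat_def,
      simp only: nat_to_int, smt (verit) int_nonneg)
qed

text \<open>Among \<open>a\<close>, \<open>b\<close>, \<open>c\<close> there are only loops, at most
  four since only one vertex can have two. If \<open>d\<close> has no loop it receives at most three
  single links; otherwise it receives none and adds at most two loops.\<close>

lemma dense4_three_loop_vertices:
  assumes V: "a \<in> verts G" "b \<in> verts G" "c \<in> verts G" "d \<in> verts G" "distinct [a, b, c, d]"
    and loops: "1 \<le> \<mu> a a" "1 \<le> \<mu> b b" "1 \<le> \<mu> c c"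
  shows "\<mu> a a + \<mu> b b + \<mu> c c + \<mu> d d +
      \<mu> a b + \<mu> a c + \<mu> a d + \<mu> b c + \<mu> b d + \<mu> c d \<le> 7"
proof -
  have none: "\<mu> u v = 0" if "1 \<le> \<mu> u u" "1 \<le> \<mu> v v" "u \<noteq> v" "u \<in> verts G" "v \<in> verts G" for u v
    using no_adjacent_loops[of u v] that by force
  have single: "\<mu> u v \<le> 1" if "1 \<le> \<mu> u u" "u \<noteq> v" "u \<in> verts G" "v \<in> verts G" for u v
    using no_double_edge_at_loop[of u v] that by force
  have double: "\<mu> u u < 2 \<or> \<mu> v v < 2" if "u \<noteq> v" "u \<in> verts G" "v \<in> verts G" for u v
    using no_two_double_loops[of u v] that by force
  have zero: "\<mu> a b = 0" "\<mu> a c = 0" "\<mu> b c = 0"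
    using none[of a b] none[of a c] none[of b c] V loops by simp_all
  have "\<mu> a a + \<mu> b b + \<mu> c c \<le> 4"
    using double[of a b] double[of a c] double[of b c] V
      mu_loop_le_2[of a] mu_loop_le_2[of b] mu_loop_le_2[of c] by auto
  moreover have "\<mu> d d + \<mu> a d + \<mu> b d + \<mu> c d \<le> 3"
  proof (cases "\<mu> d d = 0")
    case True
    then show ?thesis using single[of a d] single[of b d] single[of c d] V loops by simp
  next
    case False
    then have "\<mu> a d = 0" "\<mu> b d = 0" "\<mu> c d = 0"
      using none[of a d] none[of b d] none[of c d] V loops by simp_all
    then show ?thesis using mu_loop_le_2[of d] by simp
  qed
  ultimately show ?thesis using zero by linarith
qed

lemma no_dense4:
  assumes H: "subgraph H G" "card (verts H) = 4"
  shows "card (edges H) \<le> 7"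
proof -
  have "finite (verts H)" using H(2) card.infinite by fastforce
  then obtain ys where ys: "set ys = verts H" "distinct ys" using finite_distinct_list by blast
  \<comment> \<open>Ordering the vertices by their number of loops reduces the position of the loop
    vertices to four cases.\<close>
  define xs where "xs = sort_key (\<lambda>v. \<mu> v v) ys"
  have "length xs = 4" using ys H(2) distinct_card[OF ys(2)] by (simp add: xs_def)
  then obtain a b c d where xs: "xs = [d, c, b, a]"
    by (auto simp: length_Suc_conv numeral_eq_Suc)
  have "sorted (map (\<lambda>v. \<mu> v v) xs)" by (simp add: xs_def)
  then have sorted: "\<mu> d d \<le> \<mu> c c" "\<mu> c c \<le> \<mu> b b" "\<mu> b b \<le> \<mu> a a" by (simp_all add: xs)
  have "distinct xs" "set xs = verts H" using ys by (simp_all add: xs_def)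
  then have dist: "distinct [a, b, c, d]" and vH: "verts H = {a, b, c, d}" by (auto simp: xs)
  then have V: "a \<in> verts G" "b \<in> verts G" "c \<in> verts G" "d \<in> verts G"
    using H(1) by (auto simp: subgraph_def)
  let ?parts = "[edges_between G a a, edges_between G b b, edges_between G c c, edges_between G d d,
    edges_between G a b, edges_between G a c, edges_between G a d, edges_between G b c,
    edges_between G b d, edges_between G c d]"
  have "edges H \<subseteq> \<Union>(set ?parts)"
  proof
    fix e assume e: "e \<in> edges H"
    obtain u v where uv: "ends H e = Upair u v" by (cases "ends H e") auto
    then have "u \<in> {a, b, c, d}" "v \<in> {a, b, c, d}" and "e \<in> edges_between G u v"
      using H(1) e vH by (auto simp: subgraph_def pseudograph_def edges_between_def)
    then show "e \<in> \<Union>(set ?parts)" using edges_between_commute by (elim insertE emptyE) auto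
  qed
  then have "card (edges H) \<le> card (\<Union>(set ?parts))"
    by (intro card_mono) (auto simp: finite_edges_between)
  also have "\<dots> \<le> (\<Sum>A\<leftarrow>?parts. card A)"
    by (simp only: list.set Union_insert Union_empty list.map sum_list.Cons sum_list.Nil)
      (intro order_trans[OF card_Un_le] add_left_mono, simp)
  also have "\<dots> \<le> 7"
  proof -
    consider "\<mu> a a = 0" | "\<mu> a a \<noteq> 0" "\<mu> b b = 0" | "\<mu> b b \<noteq> 0" "\<mu> c c = 0" | "\<mu> c c \<noteq> 0" by blast
    then have "\<mu> a a + \<mu> b b + \<mu> c c + \<mu> d d +
      \<mu> a b + \<mu> a c + \<mu> a d + \<mu> b c + \<mu> b d + \<mu> c d \<le> 7"
    proof cases
      case 1
      then show ?thesis using sorted by (intro dense4_no_loop_vertex V dist) simp_all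
    next
      case 2
      then show ?thesis using sorted by (intro dense4_one_loop_vertex V dist) simp_all
    next
      case 3
      then show ?thesis using sorted by (intro dense4_two_loop_vertices V dist) simp_all
    next
      case 4
      then show ?thesis using sorted by (intro dense4_three_loop_vertices V dist) simp_all
    qed
    then show ?thesis by simp
  qed
  finally show ?thesis .
qed

section \<open>Transfer to subgraphs, loops and adjacency\<close>

lemma no_4_regular_subgraph:
  assumes H: "subgraph H G" "regular 4 H" "2 \<le> card (verts H)"
  shows False
proof (rule no_4_regular_part[of "verts H" "star H"])
  have pH: "pseudograph H" using H(1) by (simp add: subgraph_def)
  then have fin: "finite (edges H)" by (simp add: pseudograph_def)
  show "verts H \<subseteq> verts G" using H(1) by (simp add: subgraph_def)
  show "star H v \<subseteq># star G v" if "v \<in> verts H" for v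
  proof (rule mset_subset_eqI)
    show "count (star H v) e \<le> count (star G v) e" for e
    proof (cases "e \<in> edges H")
      case True
      then have "e \<in> edges G" "ends H e = ends G e" using H(1) by (auto simp: subgraph_def)
      then show ?thesis using True fin finite_edges by (simp add: count_star)
    qed (simp add: count_star[OF fin])
  qed
  show "size (star H v) = 4" if "v \<in> verts H" for v
    using H(2) that fin by (simp add: size_star regular_def)
  show "even (count (\<Sum>v\<in>verts H. star H v) e)" for e by (simp add: count_sum_star[OF pH])
qed (rule H(3))

lemma loop_edges_eq_loops: "loop_edges (verts G) = loops G"
proof -
  have "count (star G v) e = 2 \<longleftrightarrow> e \<in> edges_between G v v" for v e
    using finite_edges by (auto simp: count_star incidence_def edges_between_def)
  then show ?thesis using edges_between_verts
    by (fastforce simp: loop_edges_def loops_def edges_between_def)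
qed

lemma has_loop_iff: "has_loop G v \<longleftrightarrow> 1 \<le> \<mu> v v"
  using finite_edges_between by (simp add: has_loop_def Suc_le_eq card_gt_0_iff)

lemma adjacent_iff: "adjacent G u v \<longleftrightarrow> 1 \<le> \<mu> u v"
  using finite_edges_between by (simp add: adjacent_def Suc_le_eq card_gt_0_iff)

lemma mu_pos_verts: "1 \<le> \<mu> u v \<Longrightarrow> u \<in> verts G \<and> v \<in> verts G"
  using edges_between_verts by (metis one_edge)

lemma no_adjacent_loop_vertices:
  assumes "u \<noteq> v" "has_loop G u" "has_loop G v" "adjacent G u v"
  shows False
  using assms no_adjacent_loops[of u v] mu_pos_verts[of u v]
  by (auto simp: has_loop_iff adjacent_iff)

lemma few_adjacent_loop_vertices:
  assumes v: "v \<in> verts G"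
  shows "card {u \<in> verts G. has_loop G u \<and> adjacent G v u} \<le> 3" (is "card ?W \<le> 3")
proof (rule ccontr)
  assume "\<not> card ?W \<le> 3"
  then have "4 \<le> card ?W" by simp
  then obtain T where T: "T \<subseteq> ?W" "card T = 4" using obtain_subset_with_card_n by metis
  then have "finite T" using card.infinite by fastforce
  then obtain ys where ys: "set ys = T" "distinct ys" using finite_distinct_list by blast
  have "length ys = 4" using ys T(2) distinct_card[OF ys(2)] by simp
  then obtain u1 u2 u3 u4 where "ys = [u1, u2, u3, u4]"
    by (auto simp: length_Suc_conv numeral_eq_Suc)
  then have u: "distinct [u1, u2, u3, u4]" "{u1, u2, u3, u4} \<subseteq> ?W" using ys T(1) by auto
  \<comment> \<open>A vertex with a loop is adjacent to itself and could be counted here. But then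
    every other vertex counted would be an adjacent loop vertex, so all four would equal
    \<open>v\<close>.\<close>
  have "v \<notin> {u1, u2, u3, u4}"
  proof
    assume "v \<in> {u1, u2, u3, u4}"
    then have "has_loop G v" using u(2) by blast
    then have "w = v" if "w \<in> ?W" for w using no_adjacent_loop_vertices[of v w] that by auto
    then have "u1 = v" "u2 = v" using u(2) by blast+
    then show False using u(1) by simp
  qed
  then show False
    using no_4_loops_around[of v u1 u2 u3 u4] v u by (auto simp: has_loop_iff adjacent_iff)
qed

lemma no_loop_K33:
  assumes "distinct [u1, u2, u3]" "distinct [v1, v2, v3]"
    "\<forall>u\<in>{u1, u2, u3}. has_loop G u \<and> (\<forall>v\<in>{v1, v2, v3}. adjacent G u v)"
  shows False
proof -
  \<comment> \<open>A vertex in both triples would have a loop and be adjacent to another of the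
    \<open>u\<close> vertices, which has a loop as well.\<close>
  have "u \<noteq> v" if u: "u \<in> {u1, u2, u3}" and v: "v \<in> {v1, v2, v3}" for u v
  proof
    assume "u = v"
    obtain w where "w \<in> {u1, u2, u3}" "w \<noteq> u" using assms(1) by auto
    then show False
      using no_adjacent_loop_vertices[of w u] assms(3) u v \<open>u = v\<close> by blast
  qed
  then have "\<forall>u\<in>{u1, u2, u3}. \<forall>v\<in>{v1, v2, v3}. u \<noteq> v" by blast
  then have dist: "distinct [u1, u2, u3, v1, v2, v3]" using assms(1,2) by simp
  have pos: "\<forall>u\<in>{u1, u2, u3}. \<forall>v\<in>{v1, v2, v3}. 1 \<le> \<mu> u v"
    "\<forall>u\<in>{u1, u2, u3}. 1 \<le> \<mu> u u"
    using assms(3) unfolding has_loop_iff adjacent_iff by blast+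
  then have "{u1, u2, u3, v1, v2, v3} \<subseteq> verts G" using mu_pos_verts by blast
  then show False using no_K33[of u1 u2 u3 v1 v2 v3] dist pos by simp
qed

end

theorem theorem6:
  fixes G :: "('v, 'e) pgraph"
  assumes "regular 5 G"
    and "\<not> has_coloring_4_1 G"
    and "\<And>H :: (nat, nat) pgraph.
           regular 5 H \<Longrightarrow> card (verts H) < card (verts G) \<Longrightarrow> has_coloring_4_1 H"
  shows
    \<comment> \<open>(a)\<close>
    "(\<nexists>H. subgraph H G \<and> regular 4 H \<and> 2 \<le> card (verts H)) \<and>
    \<comment> \<open>(b)\<close>
     (\<nexists>u v. 3 \<le> card (edges_between G u v)) \<and>
    \<comment> \<open>(c)\<close>
     (\<nexists>v1 v2 v3 v4. distinct [v1, v2, v3, v4] \<and> 2 \<le> card (edges_between G v1 v2) \<and>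
        2 \<le> card (edges_between G v2 v3) \<and> 2 \<le> card (edges_between G v3 v4)) \<and>
    \<comment> \<open>(d)\<close>
     (\<nexists>u v. u \<noteq> v \<and> has_loop G u \<and> 2 \<le> card (edges_between G u v)) \<and>
    \<comment> \<open>(e)\<close>
     (\<nexists>u v. u \<noteq> v \<and> has_loop G u \<and> has_loop G v \<and> adjacent G u v) \<and>
    \<comment> \<open>(f)\<close>
     5 \<le> card (loops G) \<and>
    \<comment> \<open>(g)\<close>
     (\<nexists>u1 u2 u3 v1 v2 v3. distinct [u1, u2, u3] \<and> distinct [v1, v2, v3] \<and>
        (\<forall>u\<in>{u1, u2, u3}. has_loop G u \<and> (\<forall>v\<in>{v1, v2, v3}. adjacent G u v))) \<and>
    \<comment> \<open>(h)\<close>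
     (\<forall>v\<in>verts G. card {u \<in> verts G. has_loop G u \<and> adjacent G v u} \<le> 3) \<and>
    \<comment> \<open>(i)\<close>
     (\<nexists>H. subgraph H G \<and> card (verts H) = 4 \<and> 8 \<le> card (edges H))"
proof -
  interpret minimal_uncolorable G
    by unfold_locales (fact assms)+
  show ?thesis
  proof (intro conjI notI ballI; (elim exE conjE)?)
    show False if "subgraph H G" "regular 4 H" "2 \<le> card (verts H)" for H
      using no_4_regular_subgraph that by blast
    \<comment> \<open>For \<open>u = v\<close> the parallel edges are loops, and three of them would
      exceed degree 5.\<close>
    show False if three: "3 \<le> \<mu> u v" for u v
    proof (cases "u = v")
      case True
      then show False using three mu_loop_le_2[of v] by simp
    next
      case False
      then show False using three mu_le_2[of u v] by simp
    qed
    show False if "distinct [v1, v2, v3, v4]" "2 \<le> \<mu> v1 v2" "2 \<le> \<mu> v2 v3" "2 \<le> \<mu> v3 v4"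
      for v1 v2 v3 v4
      using no_double_path[of v1 v2 v3 v4] that mu_pos_verts[of v1 v2] mu_pos_verts[of v3 v4] by simp
    show False if "u \<noteq> v" "has_loop G u" "2 \<le> \<mu> u v" for u v
      using no_double_edge_at_loop[of u v] that mu_pos_verts[of u v] by (simp add: has_loop_iff)
    show False if "u \<noteq> v" "has_loop G u" "has_loop G v" "adjacent G u v" for u v
      using no_adjacent_loop_vertices that by blast
    show "5 \<le> card (loops G)" using five_loops by (simp add: loop_edges_eq_loops)
    show False if "distinct [u1, u2, u3]" "distinct [v1, v2, v3]"
      "\<forall>u\<in>{u1, u2, u3}. has_loop G u \<and> (\<forall>v\<in>{v1, v2, v3}. adjacent G u v)"
      for u1 u2 u3 v1 v2 v3
      using no_loop_K33 that by blast
    show "card {u \<in> verts G. has_loop G u \<and> adjacent G v u} \<le> 3" if "v \<in> verts G" for v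
      using few_adjacent_loop_vertices that by blast
    show False if "subgraph H G" "card (verts H) = 4" "8 \<le> card (edges H)" for H
      using no_dense4[of H] that by simp
  qed
qed

end
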